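(* Let $C,D$ be CGV configurations, $\Gamma$ a typing environment, $\phi$ a thread marker and $T$ a type. If $\Gamma\vdash_{\mathtt C}^{\phi} C:T$ and ($C\equiv_{\mathtt C} D$ or $C\longrightarrow_{\mathtt C} D$), then $\Gamma\vdash_{\mathtt C}^{\phi} D:T$.
   Context: **Terms.** Runtime terms of CGV (Concurrent GV), with $x,y$ variables, $\ell,i,j$ labels, $I$ a set of labels: $M,N,L ::= x \mid () \mid \lambda x.M \mid M\,N \mid (M,N) \mid \mathsf{let}\,(x,y)=M\,\mathsf{in}\,N \mid \mathsf{new} \mid \mathsf{spawn}\,M \mid \mathsf{send}\,M \mid \mathsf{recv}\,M \mid \mathsf{select}\,\ell\,M \mid \mathsf{case}\,M\,\mathsf{of}\,\{i:N_i\}_{i\in I} \mid M\{\!\{N/x\}\!\} \mid \mathsf{send}'(M,N)$. Here $M\{\!\{N/x\}\!\}$ is an explicit substitution (binding $x$ in $M$); $\lambda x.M$ binds $x$ in $M$; $\mathsf{let}\,(x,y)=M\,\mathsf{in}\,N$ binds $x,y$ in $N$. $\mathrm{fn}(\cdot)$ denotes free variables. In $(\lambda x.M)\,N$ assume $x\notin\mathrm{fn}(N)$; in $\mathsf{let}\,(x,y)=M\,\mathsf{in}\,N$ assume $x\neq y$ and $x,y\notin\mathrm{fn}(M)$. $M\{y/x\}$ is ordinary capture-avoiding substitution. Reduction contexts: $\mathcal R ::= [] \mid \mathcal R\,M \mid \mathsf{spawn}\,\mathcal R \mid \mathsf{send}\,\mathcal R \mid \mathsf{recv}\,\mathcal R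 \mid \mathsf{let}\,(x,y)=\mathcal R\,\mathsf{in}\,M \mid \mathsf{select}\,\ell\,\mathcal R \mid \mathsf{case}\,\mathcal R\,\mathsf{of}\,\{i:M_i\}_{i\in I} \mid \mathcal R\{\!\{M/x\}\!\} \mid M\{\!\{\mathcal R/x\}\!\} \mid \mathsf{send}'(M,\mathcal R)$. $\mathcal R[M]$ fills the hole; $\mathrm{fn}(\mathcal R)=\mathrm{fn}(\mathcal R[()])$; similarly for other contexts. Term structural congruence $\equiv_{\mathtt M}$ is the least congruence with: (SC-SubExt) if $x\notin\mathrm{fn}(\mathcal R)$ then $(\mathcal R[M])\{\!\{N/x\}\!\}\equiv_{\mathtt M}\mathcal R[M\{\!\{N/x\}\!\}]$. Term reduction $\longrightarrow_{\mathtt M}$: $(\lambda x.M)\,N\longrightarrow_{\mathtt M} M\{\!\{N/x\}\!\}$; $\mathsf{let}\,(x,y)=(M_1,M_2)\,\mathsf{in}\,N\longrightarrow_{\mathtt M} N\{\!\{M_1/x\}\!\}\{\!\{M_2/y\}\!\}$ (order of the two substitutions arbitrary); $M\{\!\{y/x\}\!\}\longrightarrow_{\mathtt M} M\{y/x\}$ ($y$ a variable); $x\{\!\{M/x\}\!\}\longrightarrow_{\mathtt M} M$; $\mathsf{send}\,(M,N)\longrightarrow_{\mathtt M}\mathsf{send}'(M,N)$; closed under reduction contexts and under $\equiv_{\mathtt M}$ on both sides. **Configurations.** Markers $\phi ::= \mathsf{main}$ (main) $\mid\lozenge$ (child). Messages $m ::= M \mid \ell$. Configurations $C,D,E ::=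 \phi\,M \mid C\parallel D \mid (\nu x[\vec m\rangle y)C \mid C\{\!\{M/x\}\!\}$, where $\vec m$ is a finite sequence of messages ($\epsilon$ empty); $(\nu x[\vec m\rangle y)$ binds $x,y$, and $C\{\!\{M/x\}\!\}$ binds $x$ in $C$. Thread contexts $\mathcal F ::= \phi\,\mathcal R \mid C\{\!\{\mathcal R/x\}\!\}$; $\hat{\mathcal F}$ denotes a thread context whose hole is not under an explicit substitution, i.e. not built with the clause $\mathcal R\{\!\{M/x\}\!\}$. Configuration contexts $\mathcal G ::= [] \mid \mathcal G\parallel C \mid (\nu x[\vec m\rangle y)\mathcal G \mid \mathcal G\{\!\{M/x\}\!\}$. Structural congruence $\equiv_{\mathtt C}$ is the least congruence with: $M\equiv_{\mathtt M}M'$ implies $\phi\,M\equiv_{\mathtt C}\phi\,M'$; $(\nu x[\epsilon\rangle y)C\equiv_{\mathtt C}(\nu y[\epsilon\rangle x)C$; $(\nu x[\vec m\rangle y)(\nu z[\vec n\rangle w)C\equiv_{\mathtt C}(\nu z[\vec n\rangle w)(\nu x[\vec m\rangle y)C$; if $x,y\notin\mathrm{fn}(C)$ then $(\nu x[\vec m\rangle y)(C\parallel D)\equiv_{\mathtt C}C\parallel(\nu x[\vec m\rangle y)D$ and $(\nu x[\epsilon\rangle y)C\equiv_{\mathtt C}C$; $(\nu x[\vec m\rangle y)(\hat{\mathcal F}[\mathsf{send}'(M,x)]\parallel C)\equiv_{\mathtt C}(\nu x[M,\vec m\rangle y)(\hat{\mathcal F}[x]\parallel C)$; $(\nu x[\vec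 m\rangle y)(\mathcal F[\mathsf{select}\,\ell\,x]\parallel C)\equiv_{\mathtt C}(\nu x[\ell,\vec m\rangle y)(\mathcal F[x]\parallel C)$; $C\parallel\lozenge\,()\equiv_{\mathtt C}C$; $\parallel$ commutative and associative; $\phi\,(M\{\!\{N/x\}\!\})\equiv_{\mathtt C}(\phi\,M)\{\!\{N/x\}\!\}$; if $x\notin\mathrm{fn}(\mathcal G)$ then $(\mathcal G[C])\{\!\{M/x\}\!\}\equiv_{\mathtt C}\mathcal G[C\{\!\{M/x\}\!\}]$. Configuration reduction $\longrightarrow_{\mathtt C}$: $\mathcal F[\mathsf{new}]\longrightarrow_{\mathtt C}(\nu x[\epsilon\rangle y)(\mathcal F[(x,y)])$; $\hat{\mathcal F}[\mathsf{spawn}\,(M,N)]\longrightarrow_{\mathtt C}\hat{\mathcal F}[N]\parallel\lozenge\,M$; $(\nu x[\vec m,M\rangle y)(\hat{\mathcal F}[\mathsf{recv}\,y]\parallel C)\longrightarrow_{\mathtt C}(\nu x[\vec m\rangle y)(\hat{\mathcal F}[(M,y)]\parallel C)$; if $j\in I$, $(\nu x[\vec m,j\rangle y)(\mathcal F[\mathsf{case}\,y\,\mathsf{of}\,\{i:M_i\}_{i\in I}]\parallel C)\longrightarrow_{\mathtt C}(\nu x[\vec m\rangle y)(\mathcal F[M_j\,y]\parallel C)$; if $C\longrightarrow_{\mathtt C}C'$ then $\mathcal G[C]\longrightarrow_{\mathtt C}\mathcal G[C']$; if $M\longrightarrow_{\mathtt M}M'$ then $\mathcal F[M]\longrightarrow_{\mathtt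 C}\mathcal F[M']$; closed under $\equiv_{\mathtt C}$ on both sides. **Types.** $T,U ::= T\times U \mid T\multimap U \mid \mathbf 1 \mid S$ and session types $S ::= {!}T.S \mid {?}T.S \mid \oplus\{i:S_i\}_{i\in I} \mid \&\{i:S_i\}_{i\in I} \mid \mathsf{end}$. Duality: $\overline{{!}T.S}={?}T.\overline S$, $\overline{{?}T.S}={!}T.\overline S$, $\overline{\oplus\{i:S_i\}}=\&\{i:\overline{S_i}\}$, $\overline{\&\{i:S_i\}}=\oplus\{i:\overline{S_i}\}$, $\overline{\mathsf{end}}=\mathsf{end}$. Environments $\Gamma,\Delta$ assign types to variables (unordered); writing $\Gamma,\Delta$ presupposes disjoint variables. **Term typing** $\Gamma\vdash_{\mathtt M}M:T$: (T-Var) $x:T\vdash_{\mathtt M}x:T$. (T-Abs) $\Gamma,x:T\vdash_{\mathtt M}M:U$ gives $\Gamma\vdash_{\mathtt M}\lambda x.M:T\multimap U$. (T-App) $\Gamma\vdash_{\mathtt M}M:T\multimap U$, $\Delta\vdash_{\mathtt M}N:T$ give $\Gamma,\Delta\vdash_{\mathtt M}M\,N:U$. (T-Unit) $\emptyset\vdash_{\mathtt M}():\mathbf 1$. (T-Pair) $\Gamma\vdash_{\mathtt M}M:T$, $\Delta\vdash_{\mathtt M}N:U$ give $\Gamma,\Delta\vdash_{\mathtt M}(M,N):T\times U$. (T-Split) $\Gamma\vdash_{\mathtt M}M:T\times T'$, $\Delta,x:T,y:T'\vdash_{\mathtt M}N:U$ give $\Gamma,\Delta\vdash_{\mathtt M}\mathsf{let}\,(x,y)=M\,\mathsf{in}\,N:U$.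 (T-New) $\emptyset\vdash_{\mathtt M}\mathsf{new}:S\times\overline S$. (T-Spawn) $\Gamma\vdash_{\mathtt M}M:\mathbf 1\times T$ gives $\Gamma\vdash_{\mathtt M}\mathsf{spawn}\,M:T$. (T-EndL) $\Gamma\vdash_{\mathtt M}M:T$ gives $\Gamma,x:\mathsf{end}\vdash_{\mathtt M}M:T$. (T-EndR) $\emptyset\vdash_{\mathtt M}x:\mathsf{end}$. (T-Send) $\Gamma\vdash_{\mathtt M}M:T\times{!}T.S$ gives $\Gamma\vdash_{\mathtt M}\mathsf{send}\,M:S$. (T-Recv) $\Gamma\vdash_{\mathtt M}M:{?}T.S$ gives $\Gamma\vdash_{\mathtt M}\mathsf{recv}\,M:T\times S$. (T-Select) $\Gamma\vdash_{\mathtt M}M:\oplus\{i:S_i\}_{i\in I}$, $j\in I$ give $\Gamma\vdash_{\mathtt M}\mathsf{select}\,j\,M:S_j$. (T-Case) $\Gamma\vdash_{\mathtt M}M:\&\{i:S_i\}_{i\in I}$ and $\Delta\vdash_{\mathtt M}N_i:S_i\multimap U$ for all $i\in I$ give $\Gamma,\Delta\vdash_{\mathtt M}\mathsf{case}\,M\,\mathsf{of}\,\{i:N_i\}_{i\in I}:U$. (T-Sub) $\Gamma,x:T\vdash_{\mathtt M}M:U$, $\Delta\vdash_{\mathtt M}N:T$ give $\Gamma,\Delta\vdash_{\mathtt M}M\{\!\{N/x\}\!\}:U$. (T-Send') $\Gamma\vdash_{\mathtt M}M:T$, $\Delta\vdash_{\mathtt M}N:{!}T.S$ give $\Gamma,\Delta\vdash_{\mathtt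 M}\mathsf{send}'(M,N):S$. **Buffer typing** $\Gamma\vdash_{\mathtt B}[\vec m\rangle:S'>S$: (T-Buf) $\emptyset\vdash_{\mathtt B}[\epsilon\rangle:S'>S'$. (T-BufSend) $\Gamma\vdash_{\mathtt M}M:T$, $\Delta\vdash_{\mathtt B}[\vec m\rangle:S'>S$ give $\Gamma,\Delta\vdash_{\mathtt B}[\vec m,M\rangle:S'>{!}T.S$. (T-BufSelect) $\Gamma\vdash_{\mathtt B}[\vec m\rangle:S'>S_j$, $j\in I$ give $\Gamma\vdash_{\mathtt B}[\vec m,j\rangle:S'>\oplus\{i:S_i\}_{i\in I}$. **Configuration typing** $\Gamma\vdash_{\mathtt C}^{\phi}C:T$, with $\mathsf{main}+\lozenge=\lozenge+\mathsf{main}=\mathsf{main}$, $\lozenge+\lozenge=\lozenge$, $\mathsf{main}+\mathsf{main}$ undefined: (T-Main) $\Gamma\vdash_{\mathtt M}M:T$ gives $\Gamma\vdash_{\mathtt C}^{\mathsf{main}}\mathsf{main}\,M:T$. (T-Child) $\Gamma\vdash_{\mathtt M}M:\mathbf 1$ gives $\Gamma\vdash_{\mathtt C}^{\lozenge}\lozenge\,M:\mathbf 1$. (T-ParL) $\Gamma\vdash_{\mathtt C}^{\lozenge}C:\mathbf 1$, $\Delta\vdash_{\mathtt C}^{\phi}D:T$ give $\Gamma,\Delta\vdash_{\mathtt C}^{\lozenge+\phi}C\parallel D:T$. (T-ParR) $\Gamma\vdash_{\mathtt C}^{\phi}C:T$, $\Delta\vdash_{\mathtt C}^{\lozenge}D:\mathbf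 1$ give $\Gamma,\Delta\vdash_{\mathtt C}^{\phi+\lozenge}C\parallel D:T$. (T-Res) $\Gamma\vdash_{\mathtt B}[\vec m\rangle:S'>S$, $\Delta,x:S',y:\overline S\vdash_{\mathtt C}^{\phi}C:T$ give $\Gamma,\Delta\vdash_{\mathtt C}^{\phi}(\nu x[\vec m\rangle y)C:T$. (T-ResBuf) $\Gamma,y:\overline S\vdash_{\mathtt B}[\vec m\rangle:S'>S$, $\Delta,x:S'\vdash_{\mathtt C}^{\phi}C:T$ give $\Gamma,\Delta\vdash_{\mathtt C}^{\phi}(\nu x[\vec m\rangle y)C:T$. (T-ConfSub) $\Gamma,x:T\vdash_{\mathtt C}^{\phi}C:U$, $\Delta\vdash_{\mathtt M}M:T$ give $\Gamma,\Delta\vdash_{\mathtt C}^{\phi}C\{\!\{M/x\}\!\}:U$.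
   Formalization: In the congruence laws for send' and select, x is also required not to occur free in the thread context or in C (otherwise T-EndR yields counterexamples), and the index set I in T-Case is required to be nonempty (otherwise Δ is unconstrained and preservation fails). *)

theory Defs
  imports "HOL-Library.Finite_Map"
begin

type_synonym var = nat
type_synonym label = string

text \<open>Families \<open>{i : S\<^sub>i}\<close> indexed by a (finite) set of labels are finite maps; the index set is the
  domain of the map.\<close>

datatype ty =
    Prod ty ty
  | Lolli ty ty
  | One
  | Sess sty
and sty =
    Out ty sty
  | In ty sty
  | Plus "(label, sty) fmap"
  | With "(label, sty) fmap"
  | End

primrec dual :: "sty \<Rightarrow> sty" where
  "dual (Out T S) = In T (dual S)"
| "dual (In T S) = Out T (dual S)"
| "dual (Plus Ss) = With (fmmap dual Ss)"
| "dual (With Ss) = Plus (fmmap dual Ss)"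
| "dual End = End"

text \<open>Terms and configurations are taken up to renaming of bound variables.  Free variables are
  names (\<open>Var\<close>); bound variables are de Bruijn indices (\<open>Bnd\<close>), which are used only in
  the auxiliary functions of the representation.  Everything else is written with the named
  binders \<open>Lam\<close>, \<open>LetP\<close>, \<open>Sub\<close>, \<open>Res\<close> and \<open>CSub\<close> defined below.  Abstracting a name shifts
  the dangling indices, so an index that points outside the whole term behaves like one
  more (never typable) free variable and no local-closure side conditions are needed.\<close>

datatype trm =
    Var var
  | Bnd nat
  | Unt
  | LamB trm
  | App trm trm
  | Pr trm trm
  | LetB trm trm
  | New
  | Spawn trm
  | Send trm
  | Recv trm
  | Select label trm
  | Case trm "(label, trm) fmap"
  | SubB trm trm
  | SendP trm trm  \<comment> \<open>\<open>send'(M,N)\<close>\<close>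

text \<open>\<open>close M k x\<close> turns the free name \<open>x\<close> into the index \<open>k\<close>.\<close>

primrec close :: "trm \<Rightarrow> nat \<Rightarrow> var \<Rightarrow> trm" where
  "close (Var z) k x = (if z = x then Bnd k else Var z)"
| "close (Bnd i) k x = Bnd (if i < k then i else Suc i)"
| "close Unt k x = Unt"
| "close (LamB M) k x = LamB (close M (Suc k) x)"
| "close (App M N) k x = App (close M k x) (close N k x)"
| "close (Pr M N) k x = Pr (close M k x) (close N k x)"
| "close (LetB M N) k x = LetB (close M k x) (close N (Suc (Suc k)) x)"
| "close New k x = New"
| "close (Spawn M) k x = Spawn (close M k x)"
| "close (Send M) k x = Send (close M k x)"
| "close (Recv M) k x = Recv (close M k x)"
| "close (Select l M) k x = Select l (close M k x)"
| "close (Case M Ns) k x = Case (close M k x) (fmmap (\<lambda>N. close N k x) Ns)"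
| "close (SubB M N) k x = SubB (close M (Suc k) x) (close N k x)"
| "close (SendP M N) k x = SendP (close M k x) (close N k x)"

text \<open>\<open>\<lambda>x. M\<close>, \<open>let (x,y) = M in N\<close> (with \<open>x \<noteq> y\<close>) and \<open>M{{N/x}}\<close>.\<close>

definition Lam :: "var \<Rightarrow> trm \<Rightarrow> trm" where
  "Lam x M = LamB (close M 0 x)"

definition LetP :: "var \<Rightarrow> var \<Rightarrow> trm \<Rightarrow> trm \<Rightarrow> trm" where
  "LetP x y M N = LetB M (close (close N 0 x) 0 y)"

definition Sub :: "trm \<Rightarrow> trm \<Rightarrow> var \<Rightarrow> trm" where
  "Sub M N x = SubB (close M 0 x) N"

primrec fn :: "trm \<Rightarrow> var set" where
  "fn (Var z) = {z}"
| "fn (Bnd i) = {}"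
| "fn Unt = {}"
| "fn (LamB M) = fn M"
| "fn (App M N) = fn M \<union> fn N"
| "fn (Pr M N) = fn M \<union> fn N"
| "fn (LetB M N) = fn M \<union> fn N"
| "fn New = {}"
| "fn (Spawn M) = fn M"
| "fn (Send M) = fn M"
| "fn (Recv M) = fn M"
| "fn (Select l M) = fn M"
| "fn (Case M Ns) = fn M \<union> \<Union> (fmran' (fmmap fn Ns))"
| "fn (SubB M N) = fn M \<union> fn N"
| "fn (SendP M N) = fn M \<union> fn N"

text \<open>\<open>rename M y x\<close> is \<open>M{y/x}\<close>; it cannot capture because bound variables are indices.\<close>

primrec rename :: "trm \<Rightarrow> var \<Rightarrow> var \<Rightarrow> trm" where
  "rename (Var z) y x = Var (if z = x then y else z)"
| "rename (Bnd i) y x = Bnd i"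
| "rename Unt y x = Unt"
| "rename (LamB M) y x = LamB (rename M y x)"
| "rename (App M N) y x = App (rename M y x) (rename N y x)"
| "rename (Pr M N) y x = Pr (rename M y x) (rename N y x)"
| "rename (LetB M N) y x = LetB (rename M y x) (rename N y x)"
| "rename New y x = New"
| "rename (Spawn M) y x = Spawn (rename M y x)"
| "rename (Send M) y x = Send (rename M y x)"
| "rename (Recv M) y x = Recv (rename M y x)"
| "rename (Select l M) y x = Select l (rename M y x)"
| "rename (Case M Ns) y x = Case (rename M y x) (fmmap (\<lambda>N. rename N y x) Ns)"
| "rename (SubB M N) y x = SubB (rename M y x) (rename N y x)"
| "rename (SendP M N) y x = SendP (rename M y x) (rename N y x)"

text \<open>Sanity checks of the representation: terms that differ in the names of bound variables are
  equal, and the named binders have the expected free variables.\<close>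

lemma close_rename: "y \<notin> fn M \<Longrightarrow> close (rename M y x) k y = close M k x"
proof (induction M arbitrary: k)
  case (Case M Ns)
  have "fmmap (\<lambda>N. close (rename N y x) k y) Ns = fmmap (\<lambda>N. close N k x) Ns"
    using Case by (intro fmap.map_cong) (auto simp: fmap.set_map)
  then show ?case using Case by (simp add: fmap.map_comp comp_def)
qed auto

lemma fn_close: "fn (close M k x) = fn M - {x}"
  by (induction M arbitrary: k) (auto simp: fmap.set_map fmap.map_comp comp_def)

lemma Lam_alpha: "y \<notin> fn M \<Longrightarrow> Lam y (rename M y x) = Lam x M"
  by (simp add: Lam_def close_rename)

lemma Sub_alpha: "y \<notin> fn M \<Longrightarrow> Sub (rename M y x) N y = Sub M N x"
  by (simp add: Sub_def close_rename)

lemma fn_Lam: "fn (Lam x M) = fn M - {x}"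
  by (simp add: Lam_def fn_close)

lemma fn_LetP: "fn (LetP x y M N) = fn M \<union> (fn N - {x, y})"
  by (auto simp: LetP_def fn_close)

lemma fn_Sub: "fn (Sub M N x) = (fn M - {x}) \<union> fn N"
  by (simp add: Sub_def fn_close)

text \<open>Contexts carry named binders, and filling the hole may capture.\<close>

datatype rctx =
    Hole
  | RApp rctx trm
  | RSpawn rctx
  | RSend rctx
  | RRecv rctx
  | RLet var var rctx trm          \<comment> \<open>\<open>let (x,y) = R in M\<close>\<close>
  | RSelect label rctx
  | RCase rctx "(label, trm) fmap"
  | RSub rctx trm var              \<comment> \<open>\<open>R{{M/x}}\<close>\<close>
  | RSubArg trm rctx var           \<comment> \<open>\<open>M{{R/x}}\<close>\<close>
  | RSendP trm rctx

primrec fillR :: "rctx \<Rightarrow> trm \<Rightarrow> trm" where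
  "fillR Hole L = L"
| "fillR (RApp R M) L = App (fillR R L) M"
| "fillR (RSpawn R) L = Spawn (fillR R L)"
| "fillR (RSend R) L = Send (fillR R L)"
| "fillR (RRecv R) L = Recv (fillR R L)"
| "fillR (RLet x y R M) L = LetP x y (fillR R L) M"
| "fillR (RSelect l R) L = Select l (fillR R L)"
| "fillR (RCase R Ms) L = Case (fillR R L) Ms"
| "fillR (RSub R M x) L = Sub (fillR R L) M x"
| "fillR (RSubArg M R x) L = Sub M (fillR R L) x"
| "fillR (RSendP M R) L = SendP M (fillR R L)"

definition fnR :: "rctx \<Rightarrow> var set" where
  "fnR R = fn (fillR R Unt)"

text \<open>The names that the context captures at its hole.  Side conditions on these sets, here and in
  the configuration contexts, spell out the convention that bound names are distinct from each
  other and from all free names of the terms and configurations in a rule.\<close>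

primrec bnR :: "rctx \<Rightarrow> var set" where
  "bnR Hole = {}"
| "bnR (RApp R M) = bnR R"
| "bnR (RSpawn R) = bnR R"
| "bnR (RSend R) = bnR R"
| "bnR (RRecv R) = bnR R"
| "bnR (RLet x y R M) = bnR R"
| "bnR (RSelect l R) = bnR R"
| "bnR (RCase R Ms) = bnR R"
| "bnR (RSub R M x) = insert x (bnR R)"
| "bnR (RSubArg M R x) = bnR R"
| "bnR (RSendP M R) = bnR R"

text \<open>The hole is not under an explicit substitution.\<close>

primrec hatR :: "rctx \<Rightarrow> bool" where
  "hatR Hole = True"
| "hatR (RApp R M) = hatR R"
| "hatR (RSpawn R) = hatR R"
| "hatR (RSend R) = hatR R"
| "hatR (RRecv R) = hatR R"
| "hatR (RLet x y R M) = hatR R"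
| "hatR (RSelect l R) = hatR R"
| "hatR (RCase R Ms) = hatR R"
| "hatR (RSub R M x) = False"
| "hatR (RSubArg M R x) = hatR R"
| "hatR (RSendP M R) = hatR R"

inductive scM :: "trm \<Rightarrow> trm \<Rightarrow> bool" (infix \<open>\<equiv>\<^sub>M\<close> 50) where
  scM_SubExt: "\<lbrakk>x \<notin> fnR R; x \<notin> bnR R; bnR R \<inter> fn N = {}\<rbrakk>
    \<Longrightarrow> Sub (fillR R M) N x \<equiv>\<^sub>M fillR R (Sub M N x)"
| scM_refl: "M \<equiv>\<^sub>M M"
| scM_sym: "M \<equiv>\<^sub>M N \<Longrightarrow> N \<equiv>\<^sub>M M"
| scM_trans: "\<lbrakk>L \<equiv>\<^sub>M M; M \<equiv>\<^sub>M N\<rbrakk> \<Longrightarrow> L \<equiv>\<^sub>M N"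
| scM_Lam: "M \<equiv>\<^sub>M M' \<Longrightarrow> Lam x M \<equiv>\<^sub>M Lam x M'"
| scM_App: "\<lbrakk>M \<equiv>\<^sub>M M'; N \<equiv>\<^sub>M N'\<rbrakk> \<Longrightarrow> App M N \<equiv>\<^sub>M App M' N'"
| scM_Pr: "\<lbrakk>M \<equiv>\<^sub>M M'; N \<equiv>\<^sub>M N'\<rbrakk> \<Longrightarrow> Pr M N \<equiv>\<^sub>M Pr M' N'"
| scM_Let: "\<lbrakk>M \<equiv>\<^sub>M M'; N \<equiv>\<^sub>M N'\<rbrakk> \<Longrightarrow> LetP x y M N \<equiv>\<^sub>M LetP x y M' N'"
| scM_Spawn: "M \<equiv>\<^sub>M M' \<Longrightarrow> Spawn M \<equiv>\<^sub>M Spawn M'"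
| scM_Send: "M \<equiv>\<^sub>M M' \<Longrightarrow> Send M \<equiv>\<^sub>M Send M'"
| scM_Recv: "M \<equiv>\<^sub>M M' \<Longrightarrow> Recv M \<equiv>\<^sub>M Recv M'"
| scM_Select: "M \<equiv>\<^sub>M M' \<Longrightarrow> Select l M \<equiv>\<^sub>M Select l M'"
| scM_Case: "M \<equiv>\<^sub>M M' \<Longrightarrow> Case M Ns \<equiv>\<^sub>M Case M' Ns"
| scM_CaseBranch: "\<lbrakk>fmlookup Ns i = Some N; N \<equiv>\<^sub>M N'\<rbrakk> \<Longrightarrow> Case M Ns \<equiv>\<^sub>M Case M (fmupd i N' Ns)"
| scM_Sub: "\<lbrakk>M \<equiv>\<^sub>M M'; N \<equiv>\<^sub>M N'\<rbrakk> \<Longrightarrow> Sub M N x \<equiv>\<^sub>M Sub M' N' x"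
| scM_SendP: "\<lbrakk>M \<equiv>\<^sub>M M'; N \<equiv>\<^sub>M N'\<rbrakk> \<Longrightarrow> SendP M N \<equiv>\<^sub>M SendP M' N'"

text \<open>The order of the two substitutions created by a \<open>let\<close> is arbitrary, hence two rules.\<close>

inductive redM :: "trm \<Rightarrow> trm \<Rightarrow> bool" (infix \<open>\<longrightarrow>\<^sub>M\<close> 50) where
  redM_Lam: "x \<notin> fn N \<Longrightarrow> App (Lam x M) N \<longrightarrow>\<^sub>M Sub M N x"
| redM_Pair: "\<lbrakk>x \<noteq> y; {x, y} \<inter> fn (Pr M1 M2) = {}\<rbrakk>
    \<Longrightarrow> LetP x y (Pr M1 M2) N \<longrightarrow>\<^sub>M Sub (Sub N M1 x) M2 y"
| redM_Pair': "\<lbrakk>x \<noteq> y; {x, y} \<inter> fn (Pr M1 M2) = {}\<rbrakk>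
    \<Longrightarrow> LetP x y (Pr M1 M2) N \<longrightarrow>\<^sub>M Sub (Sub N M2 y) M1 x"
| redM_SubName: "Sub M (Var y) x \<longrightarrow>\<^sub>M rename M y x"
| redM_NameSub: "Sub (Var x) M x \<longrightarrow>\<^sub>M M"
| redM_Send: "Send (Pr M N) \<longrightarrow>\<^sub>M SendP M N"
| redM_Lift: "M \<longrightarrow>\<^sub>M N \<Longrightarrow> fillR R M \<longrightarrow>\<^sub>M fillR R N"
| redM_LiftSC: "\<lbrakk>M \<equiv>\<^sub>M M'; M' \<longrightarrow>\<^sub>M N'; N' \<equiv>\<^sub>M N\<rbrakk> \<Longrightarrow> M \<longrightarrow>\<^sub>M N"

datatype marker = Main | Child

datatype msg = MTrm trm | MLab label

datatype conf =
    Thread marker trm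
  | Par conf conf
  | ResB "msg list" conf
  | CSubB conf trm

primrec closeMsg :: "msg \<Rightarrow> nat \<Rightarrow> var \<Rightarrow> msg" where
  "closeMsg (MTrm M) k x = MTrm (close M k x)"
| "closeMsg (MLab l) k x = MLab l"

primrec closeC :: "conf \<Rightarrow> nat \<Rightarrow> var \<Rightarrow> conf" where
  "closeC (Thread \<phi> M) k x = Thread \<phi> (close M k x)"
| "closeC (Par C D) k x = Par (closeC C k x) (closeC D k x)"
| "closeC (ResB ms C) k x =
    ResB (map (\<lambda>m. closeMsg m (Suc (Suc k)) x) ms) (closeC C (Suc (Suc k)) x)"
| "closeC (CSubB C M) k x = CSubB (closeC C (Suc k) x) (close M k x)"

text \<open>\<open>Res x ms y C\<close> is \<open>(\<nu>x[ms\<rangle>y)C\<close> (with \<open>x \<noteq> y\<close>), which binds \<open>x\<close> and \<open>y\<close> in the messages as well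
  as in \<open>C\<close>: an endpoint may itself be part of a message, see rule \<open>T_ResBuf\<close>.
  \<open>CSub C M x\<close> is \<open>C{{M/x}}\<close>.\<close>

definition Res :: "var \<Rightarrow> msg list \<Rightarrow> var \<Rightarrow> conf \<Rightarrow> conf" where
  "Res x ms y C =
    ResB (map (\<lambda>m. closeMsg (closeMsg m 0 x) 0 y) ms) (closeC (closeC C 0 x) 0 y)"

definition CSub :: "conf \<Rightarrow> trm \<Rightarrow> var \<Rightarrow> conf" where
  "CSub C M x = CSubB (closeC C 0 x) M"

primrec fnMsg :: "msg \<Rightarrow> var set" where
  "fnMsg (MTrm M) = fn M"
| "fnMsg (MLab l) = {}"

definition fnMsgs :: "msg list \<Rightarrow> var set" where
  "fnMsgs ms = (\<Union>m\<in>set ms. fnMsg m)"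

primrec fnC :: "conf \<Rightarrow> var set" where
  "fnC (Thread \<phi> M) = fn M"
| "fnC (Par C D) = fnC C \<union> fnC D"
| "fnC (ResB ms C) = fnMsgs ms \<union> fnC C"
| "fnC (CSubB C M) = fnC C \<union> fn M"

lemma fn_closeMsg: "fnMsg (closeMsg m k x) = fnMsg m - {x}"
  by (cases m) (auto simp: fn_close)

lemma fn_closeC: "fnC (closeC C k x) = fnC C - {x}"
  by (induction C arbitrary: k) (auto simp: fnMsgs_def fn_close fn_closeMsg)

lemma fnC_Res: "fnC (Res x ms y C) = (fnMsgs ms \<union> fnC C) - {x, y}"
  by (auto simp: Res_def fnMsgs_def fn_closeMsg fn_closeC)

lemma fnC_CSub: "fnC (CSub C M x) = (fnC C - {x}) \<union> fn M"
  by (simp add: CSub_def fn_closeC)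

datatype fctx =
    FThread marker rctx
  | FSub conf rctx var  \<comment> \<open>\<open>C{{R/x}}\<close>\<close>

primrec fillF :: "fctx \<Rightarrow> trm \<Rightarrow> conf" where
  "fillF (FThread \<phi> R) L = Thread \<phi> (fillR R L)"
| "fillF (FSub C R x) L = CSub C (fillR R L) x"

definition fnF :: "fctx \<Rightarrow> var set" where
  "fnF F = fnC (fillF F Unt)"

primrec bnF :: "fctx \<Rightarrow> var set" where
  "bnF (FThread \<phi> R) = bnR R"
| "bnF (FSub C R x) = bnR R"

primrec hatF :: "fctx \<Rightarrow> bool" where
  "hatF (FThread \<phi> R) = hatR R"
| "hatF (FSub C R x) = hatR R"

datatype gctx =
    GHole
  | GPar gctx conf
  | GRes var "msg list" var gctx
  | GSub gctx trm var

primrec fillG :: "gctx \<Rightarrow> conf \<Rightarrow> conf" where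
  "fillG GHole D = D"
| "fillG (GPar G C) D = Par (fillG G D) C"
| "fillG (GRes x ms y G) D = Res x ms y (fillG G D)"
| "fillG (GSub G M x) D = CSub (fillG G D) M x"

definition fnG :: "gctx \<Rightarrow> var set" where
  "fnG G = fnC (fillG G (Thread Child Unt))"

primrec bnG :: "gctx \<Rightarrow> var set" where
  "bnG GHole = {}"
| "bnG (GPar G C) = bnG G"
| "bnG (GRes x ms y G) = insert x (insert y (bnG G))"
| "bnG (GSub G M x) = insert x (bnG G)"

text \<open>In \<open>scC_Send\<close> and \<open>scC_Select\<close>, the endpoint \<open>x\<close> occurs only at the displayed position, that is,
  \<open>x \<notin> fnF F \<union> fnC C\<close>.  Linearity makes this automatic for typed configurations, except that
  rule \<open>T_EndR\<close> can type further occurrences of \<open>x\<close> at type \<open>End\<close> although \<open>x\<close> is in use at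
  another type.  Without the condition the laws, read from right to left, could insert a
  \<open>send'\<close> or a \<open>select\<close> at such an occurrence, and typing would not be preserved.\<close>

inductive scC :: "conf \<Rightarrow> conf \<Rightarrow> bool" (infix \<open>\<equiv>\<^sub>C\<close> 50) where
  scC_TermSC: "M \<equiv>\<^sub>M M' \<Longrightarrow> Thread \<phi> M \<equiv>\<^sub>C Thread \<phi> M'"
| scC_ResSwap: "x \<noteq> y \<Longrightarrow> Res x [] y C \<equiv>\<^sub>C Res y [] x C"
| scC_ResComm: "\<lbrakk>distinct [x, y, z, w]; {x, y} \<inter> fnMsgs ns = {}; {z, w} \<inter> fnMsgs ms = {}\<rbrakk>
    \<Longrightarrow> Res x ms y (Res z ns w C) \<equiv>\<^sub>C Res z ns w (Res x ms y C)"
| scC_ResExt: "\<lbrakk>x \<noteq> y; x \<notin> fnC C; y \<notin> fnC C\<rbrakk>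
    \<Longrightarrow> Res x ms y (Par C D) \<equiv>\<^sub>C Par C (Res x ms y D)"
| scC_ResNil: "\<lbrakk>x \<noteq> y; x \<notin> fnC C; y \<notin> fnC C\<rbrakk> \<Longrightarrow> Res x [] y C \<equiv>\<^sub>C C"
| scC_Send: "\<lbrakk>x \<noteq> y; hatF F; x \<notin> fnF F \<union> fnC C\<rbrakk>
    \<Longrightarrow> Res x ms y (Par (fillF F (SendP M (Var x))) C)
      \<equiv>\<^sub>C Res x (MTrm M # ms) y (Par (fillF F (Var x)) C)"
| scC_Select: "\<lbrakk>x \<noteq> y; x \<notin> bnF F; x \<notin> fnF F \<union> fnC C\<rbrakk>
    \<Longrightarrow> Res x ms y (Par (fillF F (Select l (Var x))) C)
      \<equiv>\<^sub>C Res x (MLab l # ms) y (Par (fillF F (Var x)) C)"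
| scC_ParNil: "Par C (Thread Child Unt) \<equiv>\<^sub>C C"
| scC_ParComm: "Par C D \<equiv>\<^sub>C Par D C"
| scC_ParAssoc: "Par C (Par D E) \<equiv>\<^sub>C Par (Par C D) E"
| scC_ConfSub: "Thread \<phi> (Sub M N x) \<equiv>\<^sub>C CSub (Thread \<phi> M) N x"
| scC_ConfSubExt: "\<lbrakk>x \<notin> fnG G; x \<notin> bnG G; bnG G \<inter> fn M = {}\<rbrakk>
    \<Longrightarrow> CSub (fillG G C) M x \<equiv>\<^sub>C fillG G (CSub C M x)"
| scC_refl: "C \<equiv>\<^sub>C C"
| scC_sym: "C \<equiv>\<^sub>C D \<Longrightarrow> D \<equiv>\<^sub>C C"
| scC_trans: "\<lbrakk>C \<equiv>\<^sub>C D; D \<equiv>\<^sub>C E\<rbrakk> \<Longrightarrow> C \<equiv>\<^sub>C E"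
| scC_Par: "\<lbrakk>C \<equiv>\<^sub>C C'; D \<equiv>\<^sub>C D'\<rbrakk> \<Longrightarrow> Par C D \<equiv>\<^sub>C Par C' D'"
| scC_Res: "C \<equiv>\<^sub>C C' \<Longrightarrow> Res x ms y C \<equiv>\<^sub>C Res x ms y C'"
| scC_CSub: "C \<equiv>\<^sub>C C' \<Longrightarrow> CSub C M x \<equiv>\<^sub>C CSub C' M x"

inductive redC :: "conf \<Rightarrow> conf \<Rightarrow> bool" (infix \<open>\<longrightarrow>\<^sub>C\<close> 50) where
  redC_New: "\<lbrakk>x \<noteq> y; {x, y} \<inter> (fnF F \<union> bnF F) = {}\<rbrakk>
    \<Longrightarrow> fillF F New \<longrightarrow>\<^sub>C Res x [] y (fillF F (Pr (Var x) (Var y)))"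
| redC_Spawn: "hatF F \<Longrightarrow> fillF F (Spawn (Pr M N)) \<longrightarrow>\<^sub>C Par (fillF F N) (Thread Child M)"
| redC_Recv: "\<lbrakk>x \<noteq> y; hatF F\<rbrakk>
    \<Longrightarrow> Res x (ms @ [MTrm M]) y (Par (fillF F (Recv (Var y))) C)
      \<longrightarrow>\<^sub>C Res x ms y (Par (fillF F (Pr M (Var y))) C)"
| redC_Case: "\<lbrakk>x \<noteq> y; y \<notin> bnF F; fmlookup Ms j = Some M\<rbrakk>
    \<Longrightarrow> Res x (ms @ [MLab j]) y (Par (fillF F (Case (Var y) Ms)) C)
      \<longrightarrow>\<^sub>C Res x ms y (Par (fillF F (App M (Var y))) C)"
| redC_LiftC: "C \<longrightarrow>\<^sub>C C' \<Longrightarrow> fillG G C \<longrightarrow>\<^sub>C fillG G C'"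
| redC_LiftM: "M \<longrightarrow>\<^sub>M M' \<Longrightarrow> fillF F M \<longrightarrow>\<^sub>C fillF F M'"
| redC_LiftSC: "\<lbrakk>C \<equiv>\<^sub>C C'; C' \<longrightarrow>\<^sub>C D'; D' \<equiv>\<^sub>C D\<rbrakk> \<Longrightarrow> C \<longrightarrow>\<^sub>C D"

text \<open>Environments are partial maps; only finite ones are derivable.  The environment
  \<open>\<Gamma>, \<Delta>\<close> is \<open>\<Gamma> ++ \<Delta>\<close> together with the premise that the domains are disjoint.\<close>

type_synonym env = "var \<rightharpoonup> ty"

text \<open>In \<open>T_Case\<close>, index sets are nonempty, as usual for labelled choices: for the empty index set,
  \<open>\<Delta>\<close> would be unconstrained, and the typing system would not be linear.\<close>

inductive typM :: "env \<Rightarrow> trm \<Rightarrow> ty \<Rightarrow> bool" (\<open>_ \<turnstile>\<^sub>M _ \<Zspot> _\<close> [51, 51, 51] 50) where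
  T_Var: "[x \<mapsto> T] \<turnstile>\<^sub>M Var x \<Zspot> T"
| T_Abs: "\<lbrakk>x \<notin> dom \<Gamma>; \<Gamma>(x \<mapsto> T) \<turnstile>\<^sub>M M \<Zspot> U\<rbrakk> \<Longrightarrow> \<Gamma> \<turnstile>\<^sub>M Lam x M \<Zspot> Lolli T U"
| T_App: "\<lbrakk>dom \<Gamma> \<inter> dom \<Delta> = {}; \<Gamma> \<turnstile>\<^sub>M M \<Zspot> Lolli T U; \<Delta> \<turnstile>\<^sub>M N \<Zspot> T\<rbrakk>
    \<Longrightarrow> \<Gamma> ++ \<Delta> \<turnstile>\<^sub>M App M N \<Zspot> U"
| T_Unit: "Map.empty \<turnstile>\<^sub>M Unt \<Zspot> One"
| T_Pair: "\<lbrakk>dom \<Gamma> \<inter> dom \<Delta> = {}; \<Gamma> \<turnstile>\<^sub>M M \<Zspot> T; \<Delta> \<turnstile>\<^sub>M N \<Zspot> U\<rbrakk>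
    \<Longrightarrow> \<Gamma> ++ \<Delta> \<turnstile>\<^sub>M Pr M N \<Zspot> Prod T U"
| T_Split: "\<lbrakk>dom \<Gamma> \<inter> dom \<Delta> = {}; x \<noteq> y; {x, y} \<inter> dom \<Delta> = {};
      \<Gamma> \<turnstile>\<^sub>M M \<Zspot> Prod T T'; \<Delta>(x \<mapsto> T, y \<mapsto> T') \<turnstile>\<^sub>M N \<Zspot> U\<rbrakk>
    \<Longrightarrow> \<Gamma> ++ \<Delta> \<turnstile>\<^sub>M LetP x y M N \<Zspot> U"
| T_New: "Map.empty \<turnstile>\<^sub>M New \<Zspot> Prod (Sess S) (Sess (dual S))"
| T_Spawn: "\<Gamma> \<turnstile>\<^sub>M M \<Zspot> Prod One T \<Longrightarrow> \<Gamma> \<turnstile>\<^sub>M Spawn M \<Zspot> T"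
| T_EndL: "\<lbrakk>x \<notin> dom \<Gamma>; \<Gamma> \<turnstile>\<^sub>M M \<Zspot> T\<rbrakk> \<Longrightarrow> \<Gamma>(x \<mapsto> Sess End) \<turnstile>\<^sub>M M \<Zspot> T"
| T_EndR: "Map.empty \<turnstile>\<^sub>M Var x \<Zspot> Sess End"
| T_Send: "\<Gamma> \<turnstile>\<^sub>M M \<Zspot> Prod T (Sess (Out T S)) \<Longrightarrow> \<Gamma> \<turnstile>\<^sub>M Send M \<Zspot> Sess S"
| T_Recv: "\<Gamma> \<turnstile>\<^sub>M M \<Zspot> Sess (In T S) \<Longrightarrow> \<Gamma> \<turnstile>\<^sub>M Recv M \<Zspot> Prod T (Sess S)"
| T_Select: "\<lbrakk>\<Gamma> \<turnstile>\<^sub>M M \<Zspot> Sess (Plus Ss); fmlookup Ss j = Some S\<rbrakk>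
    \<Longrightarrow> \<Gamma> \<turnstile>\<^sub>M Select j M \<Zspot> Sess S"
| T_Case: "\<lbrakk>dom \<Gamma> \<inter> dom \<Delta> = {}; fmdom' Ss \<noteq> {}; fmdom' Ns = fmdom' Ss;
      \<Gamma> \<turnstile>\<^sub>M M \<Zspot> Sess (With Ss);
      \<And>i N S. fmlookup Ns i = Some N \<Longrightarrow> fmlookup Ss i = Some S \<Longrightarrow> \<Delta> \<turnstile>\<^sub>M N \<Zspot> Lolli (Sess S) U\<rbrakk>
    \<Longrightarrow> \<Gamma> ++ \<Delta> \<turnstile>\<^sub>M Case M Ns \<Zspot> U"
| T_Sub: "\<lbrakk>dom \<Gamma> \<inter> dom \<Delta> = {}; x \<notin> dom \<Gamma>; \<Gamma>(x \<mapsto> T) \<turnstile>\<^sub>M M \<Zspot> U; \<Delta> \<turnstile>\<^sub>M N \<Zspot> T\<rbrakk>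
    \<Longrightarrow> \<Gamma> ++ \<Delta> \<turnstile>\<^sub>M Sub M N x \<Zspot> U"
| T_SendP: "\<lbrakk>dom \<Gamma> \<inter> dom \<Delta> = {}; \<Gamma> \<turnstile>\<^sub>M M \<Zspot> T; \<Delta> \<turnstile>\<^sub>M N \<Zspot> Sess (Out T S)\<rbrakk>
    \<Longrightarrow> \<Gamma> ++ \<Delta> \<turnstile>\<^sub>M SendP M N \<Zspot> Sess S"

text \<open>\<open>\<Gamma> \<turnstile>\<^sub>B ms \<Zspot> S' \<rhd> S\<close> is the judgement \<open>\<Gamma> \<turnstile> [ms\<rangle> : S' > S\<close>.  The oldest message is the last one.\<close>

inductive typB :: "env \<Rightarrow> msg list \<Rightarrow> sty \<Rightarrow> sty \<Rightarrow> bool"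
  (\<open>_ \<turnstile>\<^sub>B _ \<Zspot> _ \<rhd> _\<close> [51, 51, 51, 51] 50) where
  T_Buf: "Map.empty \<turnstile>\<^sub>B [] \<Zspot> S' \<rhd> S'"
| T_BufSend: "\<lbrakk>dom \<Gamma> \<inter> dom \<Delta> = {}; \<Gamma> \<turnstile>\<^sub>M M \<Zspot> T; \<Delta> \<turnstile>\<^sub>B ms \<Zspot> S' \<rhd> S\<rbrakk>
    \<Longrightarrow> \<Gamma> ++ \<Delta> \<turnstile>\<^sub>B ms @ [MTrm M] \<Zspot> S' \<rhd> Out T S"
| T_BufSelect: "\<lbrakk>\<Gamma> \<turnstile>\<^sub>B ms \<Zspot> S' \<rhd> S; fmlookup Ss j = Some S\<rbrakk>
    \<Longrightarrow> \<Gamma> \<turnstile>\<^sub>B ms @ [MLab j] \<Zspot> S' \<rhd> Plus Ss"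

fun marker_add :: "marker \<Rightarrow> marker \<Rightarrow> marker option" where
  "marker_add Main Child = Some Main"
| "marker_add Child Main = Some Main"
| "marker_add Child Child = Some Child"
| "marker_add Main Main = None"

text \<open>In \<open>T_Res\<close> and \<open>T_ResBuf\<close> the bound names \<open>x\<close> and \<open>y\<close> are not in the environment of the conclusion.
  This is not a consequence of alpha-renaming because the messages are in their scope.\<close>

inductive typC :: "env \<Rightarrow> marker \<Rightarrow> conf \<Rightarrow> ty \<Rightarrow> bool"
  (\<open>_ \<turnstile>\<^sub>C[_] _ \<Zspot> _\<close> [51, 0, 51, 51] 50) where
  T_Main: "\<Gamma> \<turnstile>\<^sub>M M \<Zspot> T \<Longrightarrow> \<Gamma> \<turnstile>\<^sub>C[Main] Thread Main M \<Zspot> T"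
| T_Child: "\<Gamma> \<turnstile>\<^sub>M M \<Zspot> One \<Longrightarrow> \<Gamma> \<turnstile>\<^sub>C[Child] Thread Child M \<Zspot> One"
| T_ParL: "\<lbrakk>dom \<Gamma> \<inter> dom \<Delta> = {}; \<Gamma> \<turnstile>\<^sub>C[Child] C \<Zspot> One; \<Delta> \<turnstile>\<^sub>C[\<phi>] D \<Zspot> T;
      marker_add Child \<phi> = Some \<psi>\<rbrakk>
    \<Longrightarrow> \<Gamma> ++ \<Delta> \<turnstile>\<^sub>C[\<psi>] Par C D \<Zspot> T"
| T_ParR: "\<lbrakk>dom \<Gamma> \<inter> dom \<Delta> = {}; \<Gamma> \<turnstile>\<^sub>C[\<phi>] C \<Zspot> T; \<Delta> \<turnstile>\<^sub>C[Child] D \<Zspot> One;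
      marker_add \<phi> Child = Some \<psi>\<rbrakk>
    \<Longrightarrow> \<Gamma> ++ \<Delta> \<turnstile>\<^sub>C[\<psi>] Par C D \<Zspot> T"
| T_Res: "\<lbrakk>dom \<Gamma> \<inter> dom \<Delta> = {}; x \<noteq> y; {x, y} \<inter> (dom \<Gamma> \<union> dom \<Delta>) = {};
      \<Gamma> \<turnstile>\<^sub>B ms \<Zspot> S' \<rhd> S; \<Delta>(x \<mapsto> Sess S', y \<mapsto> Sess (dual S)) \<turnstile>\<^sub>C[\<phi>] C \<Zspot> T\<rbrakk>
    \<Longrightarrow> \<Gamma> ++ \<Delta> \<turnstile>\<^sub>C[\<phi>] Res x ms y C \<Zspot> T"
| T_ResBuf: "\<lbrakk>dom \<Gamma> \<inter> dom \<Delta> = {}; x \<noteq> y; {x, y} \<inter> (dom \<Gamma> \<union> dom \<Delta>) = {};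
      \<Gamma>(y \<mapsto> Sess (dual S)) \<turnstile>\<^sub>B ms \<Zspot> S' \<rhd> S; \<Delta>(x \<mapsto> Sess S') \<turnstile>\<^sub>C[\<phi>] C \<Zspot> T\<rbrakk>
    \<Longrightarrow> \<Gamma> ++ \<Delta> \<turnstile>\<^sub>C[\<phi>] Res x ms y C \<Zspot> T"
| T_ConfSub: "\<lbrakk>dom \<Gamma> \<inter> dom \<Delta> = {}; x \<notin> dom \<Gamma>; \<Gamma>(x \<mapsto> T) \<turnstile>\<^sub>C[\<phi>] C \<Zspot> U; \<Delta> \<turnstile>\<^sub>M M \<Zspot> T\<rbrakk>
    \<Longrightarrow> \<Gamma> ++ \<Delta> \<turnstile>\<^sub>C[\<phi>] CSub C M x \<Zspot> U"

end

theory Submission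
  imports Defs
begin

text \<open>
The typing judgements are replaced by syntax-directed ones on the de Bruijn representation, in which
  inversion is exact.  Their contexts record only what a derivation consumes: entries of type
  \<open>end\<close> are dropped, because (T-EndL) and (T-EndR) discard and create them at will.  Contexts are
  then contained in the free names, and \<open>\<Gamma> \<turnstile> C : T\<close> holds iff \<open>\<Gamma>\<close> is finite and \<open>C\<close> has type \<open>T\<close>
  in \<open>\<Gamma>\<close> without its \<open>end\<close> entries.

  Binding a name is an injective renaming of names and indices, so typing is transported along it;
  this gives inversion for a binder with any chosen bound name.  The typing of a filled context
  factors through that of the term in the hole, which may be replaced by any term of the same type
  whose context agrees on the captured names.  With this, each axiom of the congruences and each
  reduction rule becomes a rearrangement of disjoint unions of contexts.
\<close>

section \<open>Linear typing over atoms\<close>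

text \<open>(T-EndL) can be the last rule of any derivation, and (T-EndR) types a name that is
  absent from the environment. So the shape of a term does not tell which rule was used last, and a
  name may occur repeatedly at \<open>end\<close>, even while it has an entry of another type.
  Dropping the \<open>end\<close> entries leaves a linear system in which every typing rule is an
  equivalence. The price is paid in the translation back: (T-Buf) accepts only the empty
  environment, so the dropped entries have to be handed to subderivations that can absorb them. The
  second obstacle is that the congruences can be used from right to left. Their laws are therefore
  proved as equivalences of typings, at every depth and in every context, which makes the closure
  rules immediate.\<close>

datatype atom = Name var | Idx nat

type_synonym actx = "atom \<rightharpoonup> ty"

text \<open>A relation rather than an operation on maps: disjointness is built in, so the algebra of
  splits reduces to pointwise case distinctions.\<close>

definition ctx_split :: "actx \<Rightarrow> actx \<Rightarrow> actx \<Rightarrow> bool" where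
  "ctx_split G G1 G2 \<longleftrightarrow> (\<forall>a. G1 a = None \<and> G a = G2 a \<or> G2 a = None \<and> G a = G1 a)"

text \<open>The entry for a bound variable or an occurrence of type \<open>T\<close>: none at type \<open>end\<close>.\<close>

definition lin :: "ty \<Rightarrow> ty option" where
  "lin T = (if T = Sess End then None else Some T)"

text \<open>What one occurrence of \<open>a\<close> consumes. Being empty at \<open>end\<close>, it
  covers (T-Var) and (T-EndR) together.\<close>

definition single :: "atom \<Rightarrow> ty \<Rightarrow> actx" where
  "single a T = Map.empty(a := lin T)"

fun push :: "ty \<Rightarrow> actx \<Rightarrow> actx" where
  "push T G (Name x) = G (Name x)"
| "push T G (Idx 0) = lin T"
| "push T G (Idx (Suc i)) = G (Idx i)"

text \<open>The number \<open>n\<close> counts the enclosing binders.  It excludes dangling indices, which could otherwise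
  be typed with \<open>end\<close> in the empty context.\<close>

primrec trm_typ :: "trm \<Rightarrow> nat \<Rightarrow> actx \<Rightarrow> ty \<Rightarrow> bool" where
  "trm_typ (Var x) n G T \<longleftrightarrow> G = single (Name x) T"
| "trm_typ (Bnd i) n G T \<longleftrightarrow> i < n \<and> G = single (Idx i) T"
| "trm_typ Unt n G T \<longleftrightarrow> G = Map.empty \<and> T = One"
| "trm_typ (LamB M) n G W \<longleftrightarrow> (\<exists>T U. W = Lolli T U \<and> trm_typ M (Suc n) (push T G) U)"
| "trm_typ (App M N) n G U \<longleftrightarrow> (\<exists>G1 G2 T. ctx_split G G1 G2 \<and> trm_typ M n G1 (Lolli T U) \<and> trm_typ N n G2 T)"
| "trm_typ (Pr M N) n G W \<longleftrightarrow>
    (\<exists>G1 G2 T U. W = Prod T U \<and> ctx_split G G1 G2 \<and> trm_typ M n G1 T \<and> trm_typ N n G2 U)"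
| "trm_typ (LetB M N) n G U \<longleftrightarrow> (\<exists>G1 G2 T T'. ctx_split G G1 G2 \<and> trm_typ M n G1 (Prod T T') \<and>
    trm_typ N (Suc (Suc n)) (push T' (push T G2)) U)"
| "trm_typ New n G W \<longleftrightarrow> (\<exists>S. G = Map.empty \<and> W = Prod (Sess S) (Sess (dual S)))"
| "trm_typ (Spawn M) n G T \<longleftrightarrow> trm_typ M n G (Prod One T)"
| "trm_typ (Send M) n G W \<longleftrightarrow> (\<exists>T S. W = Sess S \<and> trm_typ M n G (Prod T (Sess (Out T S))))"
| "trm_typ (Recv M) n G W \<longleftrightarrow> (\<exists>T S. W = Prod T (Sess S) \<and> trm_typ M n G (Sess (In T S)))"
| "trm_typ (Select l M) n G W \<longleftrightarrow>
    (\<exists>Ss S. W = Sess S \<and> fmlookup Ss l = Some S \<and> trm_typ M n G (Sess (Plus Ss)))"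
| "trm_typ (Case M Ns) n G U \<longleftrightarrow> (\<exists>G1 G2 Ss. ctx_split G G1 G2 \<and> fmdom' Ss \<noteq> {} \<and>
    fmdom' Ns = fmdom' Ss \<and> trm_typ M n G1 (Sess (With Ss)) \<and>
    (\<forall>i P S. fmlookup (fmmap trm_typ Ns) i = Some P \<longrightarrow> fmlookup Ss i = Some S \<longrightarrow>
      P n G2 (Lolli (Sess S) U)))"
| "trm_typ (SubB M N) n G U \<longleftrightarrow>
    (\<exists>G1 G2 T. ctx_split G G1 G2 \<and> trm_typ M (Suc n) (push T G1) U \<and> trm_typ N n G2 T)"
| "trm_typ (SendP M N) n G W \<longleftrightarrow>
    (\<exists>G1 G2 T S. W = Sess S \<and> ctx_split G G1 G2 \<and> trm_typ M n G1 T \<and> trm_typ N n G2 (Sess (Out T S)))"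

text \<open>Recursion through the finite map of branches has to pass through \<open>fmmap\<close>.
  This form speaks of the branches themselves and replaces the defining equation.\<close>

lemma trm_typ_Case [simp]: "trm_typ (Case M Ns) n G U \<longleftrightarrow> (\<exists>G1 G2 Ss. ctx_split G G1 G2 \<and> fmdom' Ss \<noteq> {} \<and>
    fmdom' Ns = fmdom' Ss \<and> trm_typ M n G1 (Sess (With Ss)) \<and>
    (\<forall>i N S. fmlookup Ns i = Some N \<longrightarrow> fmlookup Ss i = Some S \<longrightarrow>
      trm_typ N n G2 (Lolli (Sess S) U)))"
  by (simp cong: conj_cong) metis

declare trm_typ.simps(13) [simp del]

text \<open>The recursion removes the newest message, at the head, where sending and selecting add
  one; \<open>S'\<close> changes along the way and \<open>S\<close> stays fixed. The rules of
  \<open>typB\<close> work at the opposite end.\<close>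

primrec buf_typ :: "msg list \<Rightarrow> nat \<Rightarrow> actx \<Rightarrow> sty \<Rightarrow> sty \<Rightarrow> bool" where
  "buf_typ [] n G S' S \<longleftrightarrow> G = Map.empty \<and> S = S'"
| "buf_typ (m # ms) n G S' S \<longleftrightarrow> (case m of
      MTrm M \<Rightarrow> \<exists>G1 G2 T. ctx_split G G1 G2 \<and> trm_typ M n G1 T \<and> buf_typ ms n G2 (Out T S') S
    | MLab j \<Rightarrow> \<exists>Ss. fmlookup Ss j = Some S' \<and> buf_typ ms n G (Plus Ss) S)"

text \<open>(T-Res) and (T-ResBuf) become one rule: the endpoint \<open>y\<close> (index \<open>0\<close>) goes to either side of the
  split, while \<open>x\<close> (index \<open>1\<close>) must not go to the buffer.\<close>

primrec conf_typ :: "conf \<Rightarrow> nat \<Rightarrow> actx \<Rightarrow> marker \<Rightarrow> ty \<Rightarrow> bool" where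
  "conf_typ (Thread \<psi> M) n G \<phi> T \<longleftrightarrow> \<phi> = \<psi> \<and> (\<psi> = Child \<longrightarrow> T = One) \<and> trm_typ M n G T"
| "conf_typ (Par C D) n G \<phi> T \<longleftrightarrow> (\<exists>G1 G2. ctx_split G G1 G2 \<and>
    (conf_typ C n G1 Child One \<and> conf_typ D n G2 \<phi> T \<or> conf_typ C n G1 \<phi> T \<and> conf_typ D n G2 Child One))"
| "conf_typ (ResB ms C) n G \<phi> T \<longleftrightarrow> (\<exists>H1 H2 S' S.
    ctx_split (push (Sess (dual S)) (push (Sess S') G)) H1 H2 \<and> H1 (Idx 1) = None \<and>
    buf_typ ms (Suc (Suc n)) H1 S' S \<and> conf_typ C (Suc (Suc n)) H2 \<phi> T)"
| "conf_typ (CSubB C M) n G \<phi> U \<longleftrightarrow>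
    (\<exists>G1 G2 T. ctx_split G G1 G2 \<and> conf_typ C (Suc n) (push T G1) \<phi> U \<and> trm_typ M n G2 T)"

section \<open>Algebra of context splits\<close>

lemma ctx_split_comm: "ctx_split G G1 G2 \<longleftrightarrow> ctx_split G G2 G1"
  unfolding ctx_split_def by blast

lemma ctx_split_empty [simp]: "ctx_split G Map.empty G2 \<longleftrightarrow> G2 = G" "ctx_split G G1 Map.empty \<longleftrightarrow> G1 = G"
  unfolding ctx_split_def fun_eq_iff by metis+

text \<open>\<open>C\<close> and \<open>D\<close> lie inside \<open>A\<close>, hence outside
  \<open>B\<close>, and \<open>E\<close> is the union of \<open>D\<close> and
  \<open>B\<close>.\<close>

lemma ctx_split_assoc:
  assumes "ctx_split G A B" "ctx_split A C D"
  obtains E where "ctx_split G C E" "ctx_split E D B"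
proof
  show "ctx_split G C (\<lambda>a. if D a = None then B a else D a)"
    "ctx_split (\<lambda>a. if D a = None then B a else D a) D B"
    using assms unfolding ctx_split_def by metis+
qed

lemma lin_eq [simp]:
  "lin T = None \<longleftrightarrow> T = Sess End"
  "None = lin T \<longleftrightarrow> T = Sess End"
  "lin T = Some U \<longleftrightarrow> T = U \<and> U \<noteq> Sess End"
  "lin T = lin U \<longleftrightarrow> T = U"
  by (auto simp: lin_def)

lemma lin_End [simp]: "lin (Sess End) = None"
  by (simp add: lin_def)

section \<open>Renamings of names and indices\<close>

fun lift :: "(atom \<Rightarrow> atom) \<Rightarrow> atom \<Rightarrow> atom" where
  "lift f (Name x) = (case f (Name x) of Name y \<Rightarrow> Name y | Idx j \<Rightarrow> Idx (Suc j))"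
| "lift f (Idx 0) = Idx 0"
| "lift f (Idx (Suc i)) = (case f (Idx i) of Name y \<Rightarrow> Name y | Idx j \<Rightarrow> Idx (Suc j))"

definition atom_trm :: "atom \<Rightarrow> trm" where
  "atom_trm a = (case a of Name x \<Rightarrow> Var x | Idx i \<Rightarrow> Bnd i)"

text \<open>Closing, opening and \<open>rename\<close> are all instances of this traversal, so that
  one transport lemma serves them all.\<close>

primrec ren :: "trm \<Rightarrow> (atom \<Rightarrow> atom) \<Rightarrow> trm" where
  "ren (Var x) f = atom_trm (f (Name x))"
| "ren (Bnd i) f = atom_trm (f (Idx i))"
| "ren Unt f = Unt"
| "ren (LamB M) f = LamB (ren M (lift f))"
| "ren (App M N) f = App (ren M f) (ren N f)"
| "ren (Pr M N) f = Pr (ren M f) (ren N f)"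
| "ren (LetB M N) f = LetB (ren M f) (ren N (lift (lift f)))"
| "ren New f = New"
| "ren (Spawn M) f = Spawn (ren M f)"
| "ren (Send M) f = Send (ren M f)"
| "ren (Recv M) f = Recv (ren M f)"
| "ren (Select l M) f = Select l (ren M f)"
| "ren (Case M Ns) f = Case (ren M f) (fmmap (\<lambda>N. ren N f) Ns)"
| "ren (SubB M N) f = SubB (ren M (lift f)) (ren N f)"
| "ren (SendP M N) f = SendP (ren M f) (ren N f)"

primrec renMsg :: "msg \<Rightarrow> (atom \<Rightarrow> atom) \<Rightarrow> msg" where
  "renMsg (MTrm M) f = MTrm (ren M f)"
| "renMsg (MLab l) f = MLab l"

primrec renC :: "conf \<Rightarrow> (atom \<Rightarrow> atom) \<Rightarrow> conf" where
  "renC (Thread \<phi> M) f = Thread \<phi> (ren M f)"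
| "renC (Par C D) f = Par (renC C f) (renC D f)"
| "renC (ResB ms C) f = ResB (map (\<lambda>m. renMsg m (lift (lift f))) ms) (renC C (lift (lift f)))"
| "renC (CSubB C M) f = CSubB (renC C (lift f)) (ren M f)"

lemma lift_comp: "lift (g \<circ> f) = lift g \<circ> lift f"
proof
  show "lift (g \<circ> f) a = (lift g \<circ> lift f) a" for a
    by (cases "(f, a)" rule: lift.cases) (auto split: atom.splits)
qed

lemma lift_id [simp]: "lift (\<lambda>a. a) = (\<lambda>a. a)"
proof
  show "lift (\<lambda>a. a) a = a" for a by (cases "(\<lambda>a::atom. a, a)" rule: lift.cases) auto
qed

lemma fmmap_cong_ran: "(\<And>N. N \<in> fmran' Ns \<Longrightarrow> f N = g N) \<Longrightarrow> fmmap f Ns = fmmap g Ns"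
  by (simp cong: fmap.map_cong)

lemma ren_ren: "ren (ren M f) g = ren M (g \<circ> f)"
proof (induction M arbitrary: f g)
  case (Case M Ns)
  then show ?case by (auto simp: fmap.map_comp comp_def intro!: fmmap_cong_ran)
qed (auto simp: lift_comp atom_trm_def split: atom.splits)

lemma ren_id [simp]: "ren M (\<lambda>a. a) = M"
proof (induction M)
  case (Case M Ns)
  then have "fmmap (\<lambda>N. ren N (\<lambda>a. a)) Ns = fmmap id Ns" by (intro fmmap_cong_ran) simp
  with Case show ?case by (simp only: ren.simps fmap.map_id)
qed (simp_all add: atom_trm_def)

lemma renMsg_renMsg: "renMsg (renMsg m f) g = renMsg m (g \<circ> f)"
  by (cases m) (auto simp: ren_ren)

lemma renMsg_id [simp]: "renMsg m (\<lambda>a. a) = m"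
  by (cases m) auto

lemma renC_renC: "renC (renC C f) g = renC C (g \<circ> f)"
  by (induction C arbitrary: f g) (auto simp: lift_comp ren_ren renMsg_renMsg)

lemma renC_id [simp]: "renC C (\<lambda>a. a) = C"
  by (induction C) (simp_all add: map_idI)

section \<open>Closing and opening as renamings\<close>

fun closeA :: "nat \<Rightarrow> var \<Rightarrow> atom \<Rightarrow> atom" where
  "closeA k x (Name z) = (if z = x then Idx k else Name z)"
| "closeA k x (Idx i) = Idx (if i < k then i else Suc i)"

text \<open>A left inverse of \<open>closeA k x\<close>. Both \<open>Idx k\<close> and
  \<open>Name x\<close> go to \<open>Name x\<close>, so it is injective only on contexts without an
  entry for one of them.\<close>

fun openA :: "nat \<Rightarrow> var \<Rightarrow> atom \<Rightarrow> atom" where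
  "openA k x (Name z) = Name z"
| "openA k x (Idx i) = (if i < k then Idx i else if i = k then Name x else Idx (i - 1))"

lemma lift_closeA [simp]: "lift (closeA k x) = closeA (Suc k) x"
proof
  show "lift (closeA k x) a = closeA (Suc k) x a" for a
    by (cases "(closeA k x, a)" rule: lift.cases) auto
qed

lemma lift_openA [simp]: "lift (openA k x) = openA (Suc k) x"
proof
  show "lift (openA k x) a = openA (Suc k) x a" for a
    by (cases "(openA k x, a)" rule: lift.cases) auto
qed

lemma openA_closeA [simp]: "openA k x \<circ> closeA k x = (\<lambda>a. a)"
proof
  show "(openA k x \<circ> closeA k x) a = a" for a by (cases a) auto
qed

lemma closeA_openA: "a \<noteq> Name x \<Longrightarrow> closeA k x (openA k x a) = a"
  by (cases a) auto

lemma close_eq_ren: "close M k x = ren M (closeA k x)"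
  by (induction M arbitrary: k) (auto simp: atom_trm_def intro!: fmmap_cong_ran)

lemma closeMsg_eq_ren: "closeMsg m k x = renMsg m (closeA k x)"
  by (cases m) (auto simp: close_eq_ren)

lemma closeC_eq_ren: "closeC C k x = renC C (closeA k x)"
  by (induction C arbitrary: k) (auto simp: close_eq_ren closeMsg_eq_ren)

text \<open>Every body in index form is the closure of a body with a fresh name \<open>x\<close>.
  This turns index binders into the named binders that the typing rules mention.\<close>

lemma close_open: "x \<notin> fn M \<Longrightarrow> close (ren M (openA k x)) k x = M"
proof (induction M arbitrary: k)
  case (Case M Ns)
  then have "fmmap (\<lambda>N. close (ren N (openA k x)) k x) Ns = fmmap id Ns"
    by (intro fmmap_cong_ran) (auto simp: fmap.set_map)
  with Case show ?case by (simp add: fmap.map_id fmap.map_comp comp_def)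
qed (auto simp: atom_trm_def)

lemma closeMsg_open: "x \<notin> fnMsg m \<Longrightarrow> closeMsg (renMsg m (openA k x)) k x = m"
  by (cases m) (auto simp: close_open)

lemma closeC_open: "x \<notin> fnC C \<Longrightarrow> closeC (renC C (openA k x)) k x = C"
  by (induction C arbitrary: k)
    (auto simp: fnMsgs_def close_open closeMsg_open map_idI)

fun renameA :: "var \<Rightarrow> var \<Rightarrow> atom \<Rightarrow> atom" where
  "renameA y x (Name z) = Name (if z = x then y else z)"
| "renameA y x (Idx i) = Idx i"

lemma lift_renameA [simp]: "lift (renameA y x) = renameA y x"
proof
  show "lift (renameA y x) a = renameA y x a" for a
    by (cases "(renameA y x, a)" rule: lift.cases) auto
qed

lemma rename_eq_ren: "rename M y x = ren M (renameA y x)"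
  by (induction M) (auto simp: atom_trm_def intro!: fmmap_cong_ran)

section \<open>Transport of typing along renamings\<close>

primrec bound :: "nat \<Rightarrow> atom \<Rightarrow> bool" where
  "bound n (Name x) \<longleftrightarrow> True"
| "bound n (Idx i) \<longleftrightarrow> i < n"

text \<open>The two depths differ by one for closing and opening and coincide for
  \<open>rename\<close>.\<close>

definition bound_map :: "nat \<Rightarrow> nat \<Rightarrow> (atom \<Rightarrow> atom) \<Rightarrow> bool" where
  "bound_map n m f \<longleftrightarrow> (\<forall>a. bound n a \<longrightarrow> bound m (f a))"

lemma bound_lift:
  assumes "bound_map n m f"
  shows "bound_map (Suc n) (Suc m) (lift f)"
  unfolding bound_map_def
proof (intro allI impI)
  fix a
  assume a: "bound (Suc n) a"
  show "bound (Suc m) (lift f a)"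
  proof (cases "(f, a)" rule: lift.cases)
    case (1 f' x)
    moreover have "bound m (f (Name x))" using assms by (auto simp: bound_map_def)
    ultimately show ?thesis by (auto split: atom.splits)
  next
    case (3 f' i)
    moreover from this have "bound m (f (Idx i))" using assms a by (auto simp: bound_map_def)
    ultimately show ?thesis by (auto split: atom.splits)
  qed auto
qed

text \<open>Injectivity is required only on the domain, since \<open>M{y/x}\<close> may identify \<open>x\<close> with a \<open>y\<close> that
  occurs at type \<open>end\<close>.\<close>

definition image_ctx :: "(atom \<Rightarrow> atom) \<Rightarrow> actx \<Rightarrow> actx \<Rightarrow> bool" where
  "image_ctx f G G' \<longleftrightarrow> inj_on f (dom G) \<and> (\<forall>a T. G a = Some T \<longrightarrow> G' (f a) = Some T) \<and>
    (\<forall>b T. G' b = Some T \<longrightarrow> (\<exists>a. f a = b \<and> G a = Some T))"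

lemma image_ctx_empty: "image_ctx f Map.empty G' \<longleftrightarrow> G' = Map.empty"
  unfolding image_ctx_def fun_eq_iff by (auto simp: option.expand)

lemma image_ctx_single:
  assumes "image_ctx f (single a T) G'"
  shows "G' = single (f a) T"
proof (cases "T = Sess End")
  case True
  then have "single b T = Map.empty" for b by (simp add: single_def lin_def)
  then show ?thesis using assms by (simp add: image_ctx_empty)
next
  case False
  then have s: "single b T = [b \<mapsto> T]" for b by (simp add: single_def lin_def)
  have "G' (f a) = Some T"
    using assms by (simp add: image_ctx_def s)
  moreover have "G' b = None" if "b \<noteq> f a" for b
  proof (rule ccontr)
    assume "G' b \<noteq> None"
    then obtain U where "G' b = Some U" by blast
    then obtain a' where "f a' = b" "[a \<mapsto> T] a' = Some U"
      using assms unfolding image_ctx_def s by blast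
    with that show False by (simp split: if_splits)
  qed
  ultimately show ?thesis by (auto simp: s fun_eq_iff)
qed

text \<open>Each part of the target is \<open>G'\<close> restricted to the image of the
  corresponding part of the source. Injectivity on \<open>dom G\<close> keeps the two images
  disjoint.\<close>

lemma image_ctx_split:
  assumes "image_ctx f G G'" "ctx_split G G1 G2"
  obtains G1' G2' where "ctx_split G' G1' G2'" "image_ctx f G1 G1'" "image_ctx f G2 G2'"
proof
  let ?G1' = "\<lambda>b. if b \<in> f ` dom G1 then G' b else None"
  let ?G2' = "\<lambda>b. if b \<in> f ` dom G2 then G' b else None"
  have *: "G1 a = Some T \<Longrightarrow> G a = Some T \<and> G2 a = None" "G2 a = Some T \<Longrightarrow> G a = Some T \<and> G1 a = None"
    for a T using assms(2) unfolding ctx_split_def by (metis option.distinct(1))+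
  have **: "G a = Some T \<Longrightarrow> G1 a = Some T \<or> G2 a = Some T" for a T
    using assms(2) unfolding ctx_split_def by (metis option.distinct(1))
  have i: "f a = f b \<Longrightarrow> G a = Some T \<Longrightarrow> G b = Some U \<Longrightarrow> a = b" for a b T U
    using assms(1) by (auto simp: image_ctx_def inj_on_def)
  have r: "G' b = Some T \<Longrightarrow> \<exists>a. f a = b \<and> G a = Some T" for b T
    using assms(1) by (auto simp: image_ctx_def)
  have l: "G a = Some T \<Longrightarrow> G' (f a) = Some T" for a T
    using assms(1) by (auto simp: image_ctx_def)
  show "ctx_split G' ?G1' ?G2'" unfolding ctx_split_def
  proof
    fix b
    show "?G1' b = None \<and> G' b = ?G2' b \<or> ?G2' b = None \<and> G' b = ?G1' b"
    proof (cases "G' b")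
      case (Some T)
      with r obtain a where "f a = b" "G a = Some T" by blast
      with ** consider "G1 a = Some T" | "G2 a = Some T" by blast
      then show ?thesis
      proof cases
        case 1
        then have "b \<notin> f ` dom G2" using * i \<open>f a = b\<close>
          by (auto simp: dom_def) (metis option.distinct(1))
        with 1 \<open>f a = b\<close> show ?thesis by (auto simp: dom_def)
      next
        case 2
        then have "b \<notin> f ` dom G1" using * i \<open>f a = b\<close>
          by (auto simp: dom_def) (metis option.distinct(1))
        with 2 \<open>f a = b\<close> show ?thesis by (auto simp: dom_def)
      qed
    qed auto
  qed
  show "image_ctx f G1 ?G1'" unfolding image_ctx_def inj_on_def
    using * i l by (auto simp: dom_def)+
  show "image_ctx f G2 ?G2'" unfolding image_ctx_def inj_on_def
    using * i l by (auto simp: dom_def)+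
qed

lemma image_ctx_push:
  assumes "image_ctx f G G'" shows "image_ctx (lift f) (push T G) (push T G')"
proof -
  have i: "f a = f b \<Longrightarrow> G a = Some T \<Longrightarrow> G b = Some U \<Longrightarrow> a = b" for a b T U
    using assms(1) by (auto simp: image_ctx_def inj_on_def)
  have r: "G' b = Some T \<Longrightarrow> \<exists>a. f a = b \<and> G a = Some T" for b T
    using assms(1) by (auto simp: image_ctx_def)
  have l: "G a = Some T \<Longrightarrow> G' (f a) = Some T" for a T
    using assms(1) by (auto simp: image_ctx_def)
  \<comment> \<open>\<open>s\<close> shifts an atom past the new binder: an atom under the binder is
    \<open>Idx 0\<close> or \<open>s b\<close> for a unique \<open>b\<close>, and
    \<open>lift f\<close> acts on \<open>s b\<close> as \<open>f\<close> does on
    \<open>b\<close>.\<close>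
  define s where "s a = (case a of Name y \<Rightarrow> Name y | Idx j \<Rightarrow> Idx (Suc j))" for a
  have s: "push T G (s a) = G a" "push T G' (s a) = G' a" "lift f (s a) = s (f a)"
    "s a \<noteq> Idx 0" "s a = s b \<longleftrightarrow> a = b" for a b
    by (auto simp: s_def split: atom.splits)
  have c: "a = Idx 0 \<or> (\<exists>b. a = s b)" for a
  proof (cases a)
    case (Name x) then show ?thesis by (metis s_def atom.simps(5))
  next
    case (Idx i) then show ?thesis by (cases i) (auto simp: s_def split: atom.splits intro: exI[of _ "Idx _"])
  qed
  show ?thesis unfolding image_ctx_def inj_on_def
  proof (intro conjI allI impI ballI)
    fix a b assume "a \<in> dom (push T G)" "b \<in> dom (push T G)" "lift f a = lift f b"
    then show "a = b" using c[of a] c[of b] i s by (auto simp: dom_def) (metis s(4))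
  next
    fix a U assume "push T G a = Some U" then show "push T G' (lift f a) = Some U"
      using c[of a] l s by auto
  next
    fix b U assume *: "push T G' b = Some U" then show "\<exists>a. lift f a = b \<and> push T G a = Some U"
      using c[of b]
    proof (elim disjE exE)
      assume "b = Idx 0" then show ?thesis using * by (intro exI[of _ "Idx 0"]) auto
    next
      fix b' assume "b = s b'" then show ?thesis using * r s by metis
    qed
  qed
qed

text \<open>The typing clauses only split contexts, push entries, or ask for an empty context or a
  single entry, and images respect each of these. Depths, renaming and contexts are all generalised
  because a binder changes them together.\<close>

lemma trm_typ_ren:
  assumes "trm_typ M n G T" "bound_map n m f" "image_ctx f G G'"
  shows "trm_typ (ren M f) m G' T"
  using assms
proof (induction M arbitrary: n m f G G' T)
  case (Var x)
  then have "bound m (f (Name x))" by (auto simp: bound_map_def)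
  then show ?case using Var
    by (auto simp: atom_trm_def dest!: image_ctx_single split: atom.splits)
next
  case (Bnd i)
  then have "bound m (f (Idx i))" by (auto simp: bound_map_def)
  then show ?case using Bnd
    by (auto simp: atom_trm_def dest!: image_ctx_single split: atom.splits)
next
  case (LamB M)
  then show ?case by (fastforce intro: bound_lift image_ctx_push)
next
  case (App M N)
  from App.prems(1) obtain G1 G2 U where *: "ctx_split G G1 G2" "trm_typ M n G1 (Lolli U T)" "trm_typ N n G2 U"
    by auto
  from image_ctx_split[OF App.prems(3) *(1)] obtain G1' G2' where
    **: "ctx_split G' G1' G2'" "image_ctx f G1 G1'" "image_ctx f G2 G2'" .
  show ?case using **(1) App.IH(1)[OF *(2) App.prems(2) **(2)] App.IH(2)[OF *(3) App.prems(2) **(3)]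
    by auto
next
  case (Pr M N)
  from Pr.prems(1) obtain G1 G2 U V where *: "ctx_split G G1 G2" "trm_typ M n G1 U" "trm_typ N n G2 V"
    and T: "T = Prod U V"
    by auto
  from image_ctx_split[OF Pr.prems(3) *(1)] obtain G1' G2' where
    **: "ctx_split G' G1' G2'" "image_ctx f G1 G1'" "image_ctx f G2 G2'" .
  show ?case using **(1) Pr.IH(1)[OF *(2) Pr.prems(2) **(2)] Pr.IH(2)[OF *(3) Pr.prems(2) **(3)]
    by (auto simp: T)
next
  case (LetB M N)
  from LetB.prems(1) obtain G1 G2 U V where *: "ctx_split G G1 G2" "trm_typ M n G1 (Prod U V)"
    "trm_typ N (Suc (Suc n)) (push V (push U G2)) T" by auto
  from image_ctx_split[OF LetB.prems(3) *(1)] obtain G1' G2' where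
    **: "ctx_split G' G1' G2'" "image_ctx f G1 G1'" "image_ctx f G2 G2'" .
  show ?case using **(1) LetB.IH(1)[OF *(2) LetB.prems(2) **(2)]
      LetB.IH(2)[OF *(3) bound_lift[OF bound_lift[OF LetB.prems(2)]]
        image_ctx_push[OF image_ctx_push[OF **(3)]]]
    by auto
next
  case (Case M Ns)
  from Case.prems(1) obtain G1 G2 Ss where *: "ctx_split G G1 G2" "fmdom' Ss \<noteq> {}" "fmdom' Ns = fmdom' Ss"
    "trm_typ M n G1 (Sess (With Ss))"
    "\<forall>i N S. fmlookup Ns i = Some N \<longrightarrow> fmlookup Ss i = Some S \<longrightarrow> trm_typ N n G2 (Lolli (Sess S) T)"
    unfolding trm_typ_Case by blast
  from image_ctx_split[OF Case.prems(3) *(1)] obtain G1' G2' where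
    **: "ctx_split G' G1' G2'" "image_ctx f G1 G1'" "image_ctx f G2 G2'" .
  have "trm_typ (ren N f) m G2' (Lolli (Sess S) T)"
    if "fmlookup Ns i = Some N" "fmlookup Ss i = Some S" for i N S
    using Case.IH(2)[OF fmran'I[OF that(1)] _ Case.prems(2) **(3)] *(5) that by blast
  then have "\<forall>i N S. fmlookup (fmmap (\<lambda>N. ren N f) Ns) i = Some N \<longrightarrow> fmlookup Ss i = Some S \<longrightarrow>
    trm_typ N m G2' (Lolli (Sess S) T)" by auto
  moreover have "fmdom' (fmmap (\<lambda>N. ren N f) Ns) = fmdom' Ss" using *(3) by simp
  ultimately show ?case
    unfolding ren.simps trm_typ_Case using **(1) *(2) Case.IH(1)[OF *(4) Case.prems(2) **(2)] by blast
next
  case (SubB M N)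
  from SubB.prems(1) obtain G1 G2 U where *: "ctx_split G G1 G2" "trm_typ M (Suc n) (push U G1) T" "trm_typ N n G2 U"
    by auto
  from image_ctx_split[OF SubB.prems(3) *(1)] obtain G1' G2' where
    **: "ctx_split G' G1' G2'" "image_ctx f G1 G1'" "image_ctx f G2 G2'" .
  show ?case using **(1) SubB.IH(2)[OF *(3) SubB.prems(2) **(3)]
    SubB.IH(1)[OF *(2) bound_lift[OF SubB.prems(2)] image_ctx_push[OF **(2)]] by auto
next
  case (SendP M N)
  from SendP.prems(1) obtain G1 G2 U V where *: "ctx_split G G1 G2" "trm_typ M n G1 U" "trm_typ N n G2 (Sess (Out U V))"
    and T: "T = Sess V"
    by auto
  from image_ctx_split[OF SendP.prems(3) *(1)] obtain G1' G2' where
    **: "ctx_split G' G1' G2'" "image_ctx f G1 G1'" "image_ctx f G2 G2'" .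
  show ?case using **(1) SendP.IH(1)[OF *(2) SendP.prems(2) **(2)] SendP.IH(2)[OF *(3) SendP.prems(2) **(3)]
    by (auto simp: T)
next
  case (Spawn M)
  then show ?case by (metis ren.simps trm_typ.simps(9))
next
  case (Send M)
  then show ?case by (metis ren.simps(10) trm_typ.simps(10))
next
  case (Recv M)
  then show ?case by (metis ren.simps(11) trm_typ.simps(11))
next
  case (Select l M)
  then show ?case by (metis ren.simps(12) trm_typ.simps(12))
qed (auto simp: image_ctx_empty)

lemma buf_typ_ren:
  assumes "buf_typ ms n G S' S" "bound_map n m f" "image_ctx f G G'"
  shows "buf_typ (map (\<lambda>m. renMsg m f) ms) m G' S' S"
  using assms(1,3)
proof (induction ms arbitrary: G G' S')
  case (Cons msg ms)
  show ?case
  proof (cases msg)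
    case (MTrm M)
    with Cons.prems(1) obtain G1 G2 T where *: "ctx_split G G1 G2" "trm_typ M n G1 T" "buf_typ ms n G2 (Out T S') S"
      by auto
    from image_ctx_split[OF Cons.prems(2) *(1)] obtain G1' G2' where
      **: "ctx_split G' G1' G2'" "image_ctx f G1 G1'" "image_ctx f G2 G2'" .
    then show ?thesis using **(1) Cons.IH[OF *(3) **(3)] trm_typ_ren[OF *(2) assms(2) **(2)] MTrm by auto
  qed (use Cons in auto)
qed (auto simp: image_ctx_empty)

lemma image_ctx_None: "image_ctx f G G' \<Longrightarrow> (\<And>a. f a = b \<Longrightarrow> G a = None) \<Longrightarrow> G' b = None"
  unfolding image_ctx_def by (metis not_Some_eq)

text \<open>\<open>Idx 1\<close> stands for the endpoint \<open>x\<close> of a restriction. It is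
  its own only preimage, so its absence from the buffer survives renaming.\<close>

lemma lift_lift_eq_Idx1: "lift (lift f) a = Idx 1 \<longleftrightarrow> a = Idx 1"
  by (cases "(lift f, a)" rule: lift.cases) (auto split: atom.splits elim!: lift.elims)

lemma conf_typ_ren:
  assumes "conf_typ C n G \<phi> T" "bound_map n m f" "image_ctx f G G'"
  shows "conf_typ (renC C f) m G' \<phi> T"
  using assms
proof (induction C arbitrary: n m f G G' \<phi> T)
  case (Thread \<psi> M)
  then show ?case using trm_typ_ren[of M n G T m f G'] by auto
next
  case (Par C D)
  from Par.prems(1) obtain G1 G2 where *: "ctx_split G G1 G2" 
    "conf_typ C n G1 Child One \<and> conf_typ D n G2 \<phi> T \<or> conf_typ C n G1 \<phi> T \<and> conf_typ D n G2 Child One"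
    by auto
  from image_ctx_split[OF Par.prems(3) *(1)] obtain G1' G2' where
    **: "ctx_split G' G1' G2'" "image_ctx f G1 G1'" "image_ctx f G2 G2'" .
  show ?case using *(2)
      Par.IH(1)[OF _ Par.prems(2) **(2)] Par.IH(2)[OF _ Par.prems(2) **(3)] **(1) by (auto 0 4)
next
  case (ResB ms C)
  note b = bound_lift[OF bound_lift[OF ResB.prems(2)]]
  from ResB.prems(1) obtain H1 H2 S' S where *: 
    "ctx_split (push (Sess (dual S)) (push (Sess S') G)) H1 H2" "H1 (Idx 1) = None" 
    "buf_typ ms (Suc (Suc n)) H1 S' S" "conf_typ C (Suc (Suc n)) H2 \<phi> T"
    by auto
  from image_ctx_split[OF image_ctx_push[OF image_ctx_push[OF ResB.prems(3)]] *(1)]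
  obtain H1' H2' where **: "ctx_split (push (Sess (dual S)) (push (Sess S') G')) H1' H2'"
    "image_ctx (lift (lift f)) H1 H1'" "image_ctx (lift (lift f)) H2 H2'" .
  have "H1' (Idx 1) = None"
    by (intro image_ctx_None[OF **(2)]) (simp only: *(2) lift_lift_eq_Idx1)
  with ** ResB.IH[OF *(4) b **(3)] buf_typ_ren[OF *(3) b **(2)] show ?case
    by (simp only: renC.simps conf_typ.simps) blast
next
  case (CSubB C M)
  from CSubB.prems(1) obtain G1 G2 U where *: "ctx_split G G1 G2" "conf_typ C (Suc n) (push U G1) \<phi> T" "trm_typ M n G2 U"
    by auto
  from image_ctx_split[OF CSubB.prems(3) *(1)] obtain G1' G2' where
    **: "ctx_split G' G1' G2'" "image_ctx f G1 G1'" "image_ctx f G2 G2'" .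
  show ?case using **(1) trm_typ_ren[OF *(3) CSubB.prems(2) **(3)]
      CSubB.IH(1)[OF *(2) bound_lift[OF CSubB.prems(2)] image_ctx_push[OF **(2)]]
    by auto
qed

section \<open>Typing rules for the named binders\<close>

lemma ctx_split_None: "ctx_split G G1 G2 \<Longrightarrow> G a = None \<longleftrightarrow> G1 a = None \<and> G2 a = None"
  unfolding ctx_split_def by metis

lemma single_eq_None [simp]: "single a T b = None \<longleftrightarrow> b \<noteq> a \<or> T = Sess End"
  by (auto simp: single_def)

text \<open>With \<open>end\<close> entries gone, an entry is present only if an occurrence consumes
  it. In a \<open>case\<close>, the context of the branches is constrained by the branches alone;
  since the index set is nonempty, there is one to argue with.\<close>

lemma trm_typ_fn: "trm_typ M n G T \<Longrightarrow> G (Name x) \<noteq> None \<Longrightarrow> x \<in> fn M"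
proof (induction M arbitrary: n G T)
  case (Case M Ns)
  from Case.prems(1) obtain G1 G2 Ss where *: "ctx_split G G1 G2" "fmdom' Ss \<noteq> {}" "fmdom' Ns = fmdom' Ss"
    "trm_typ M n G1 (Sess (With Ss))"
    "\<forall>i N S. fmlookup Ns i = Some N \<longrightarrow> fmlookup Ss i = Some S \<longrightarrow> trm_typ N n G2 (Lolli (Sess S) T)"
    unfolding trm_typ_Case by blast
  from *(2,3) obtain i N S where i: "fmlookup Ns i = Some N" "fmlookup Ss i = Some S"
    by (metis ex_in_conv fmdom'_notI not_Some_eq)
  then have "trm_typ N n G2 (Lolli (Sess S) T)" using *(5) by blast
  note branch = Case.IH(2)[OF fmran'I[OF i(1)] this]
  from Case.prems(2) consider "G1 (Name x) \<noteq> None" | "G2 (Name x) \<noteq> None"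
    using ctx_split_None[OF *(1), of "Name x"] by meson
  then show ?case
  proof cases
    case 1
    then show ?thesis using Case.IH(1)[OF *(4)] by simp
  next
    case 2
    then show ?thesis using branch fmran'I[OF i(1)] by (auto simp: fmap.set_map)
  qed
next
  case (LamB M) then show ?case by (metis push.simps(1) fn.simps(4) trm_typ.simps(4))
next
  case (App M N)
  from App.prems(1) obtain G1 G2 U where "ctx_split G G1 G2" "trm_typ M n G1 (Lolli U T)" "trm_typ N n G2 U" by auto
  then show ?case using App.IH(1)[of n G1 "Lolli U T"] App.IH(2)[of n G2 U]
      App.prems(2) ctx_split_None[of G G1 G2 "Name x"] by (auto simp del: not_None_eq)
next
  case (Pr M N)
  from Pr.prems(1) obtain G1 G2 U V where "ctx_split G G1 G2" "trm_typ M n G1 U" "trm_typ N n G2 V" by auto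
  then show ?case using Pr.IH(1)[of n G1 U] Pr.IH(2)[of n G2 V]
      Pr.prems(2) ctx_split_None[of G G1 G2 "Name x"] by (auto simp del: not_None_eq)
next
  case (LetB M N)
  from LetB.prems(1) obtain G1 G2 U V where "ctx_split G G1 G2" "trm_typ M n G1 (Prod U V)"
    "trm_typ N (Suc (Suc n)) (push V (push U G2)) T" by auto
  then show ?case using LetB.IH(1)[of n G1 "Prod U V"] LetB.IH(2)[of "Suc (Suc n)" "push V (push U G2)" T]
      LetB.prems(2) ctx_split_None[of G G1 G2 "Name x"] by (auto simp del: not_None_eq)
next
  case (SubB M N)
  from SubB.prems(1) obtain G1 G2 U where "ctx_split G G1 G2" "trm_typ M (Suc n) (push U G1) T" "trm_typ N n G2 U" by auto
  then show ?case using SubB.IH(1)[of "Suc n" "push U G1" T] SubB.IH(2)[of n G2 U]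
      SubB.prems(2) ctx_split_None[of G G1 G2 "Name x"] by (auto simp del: not_None_eq)
next
  case (SendP M N)
  from SendP.prems(1) obtain G1 G2 U V where "ctx_split G G1 G2" "trm_typ M n G1 U" "trm_typ N n G2 (Sess (Out U V))" by auto
  then show ?case using SendP.IH(1)[of n G1 U] SendP.IH(2)[of n G2 "Sess (Out U V)"]
      SendP.prems(2) ctx_split_None[of G G1 G2 "Name x"] by (auto simp del: not_None_eq)
next
  case (Spawn M) then show ?case by simp
next
  case (Send M) then show ?case by simp blast
next
  case (Recv M) then show ?case by simp blast
next
  case (Select l M) then show ?case by simp blast
qed auto

lemma buf_typ_fn: "buf_typ ms n G S' S \<Longrightarrow> G (Name x) \<noteq> None \<Longrightarrow> x \<in> fnMsgs ms"
proof (induction ms arbitrary: G S')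
  case (Cons m ms)
  show ?case
  proof (cases m)
    case (MTrm M)
    with Cons.prems(1) obtain G1 G2 T where "ctx_split G G1 G2" "trm_typ M n G1 T" "buf_typ ms n G2 (Out T S') S"
      by auto
    with Cons MTrm show ?thesis by (auto simp: fnMsgs_def ctx_split_None dest: trm_typ_fn)
  qed (use Cons in \<open>auto simp: fnMsgs_def\<close>)
qed auto

lemma conf_typ_fn: "conf_typ C n G \<phi> T \<Longrightarrow> G (Name x) \<noteq> None \<Longrightarrow> x \<in> fnC C"
proof (induction C arbitrary: n G \<phi> T)
  case (Thread \<psi> M) then show ?case by (auto dest: trm_typ_fn)
next
  case (Par C D)
  then obtain G1 G2 \<phi>1 T1 \<phi>2 T2 where "ctx_split G G1 G2" "conf_typ C n G1 \<phi>1 T1" "conf_typ D n G2 \<phi>2 T2"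
    by auto
  then show ?case using Par.IH(1)[of n G1 \<phi>1 T1] Par.IH(2)[of n G2 \<phi>2 T2] Par.prems(2)
      ctx_split_None[of G G1 G2 "Name x"] by (auto simp del: not_None_eq)
next
  case (ResB ms C)
  then obtain H1 H2 S' S where s: "ctx_split (push (Sess (dual S)) (push (Sess S') G)) H1 H2"
    and "buf_typ ms (Suc (Suc n)) H1 S' S" "conf_typ C (Suc (Suc n)) H2 \<phi> T" by auto
  with ResB.IH[of "Suc (Suc n)" H2 \<phi> T] ResB.prems(2) ctx_split_None[OF s, of "Name x"] show ?case
    using buf_typ_fn[of ms "Suc (Suc n)" H1 S' S x] by (auto simp del: not_None_eq)
next
  case (CSubB C M)
  then obtain G1 G2 U where s: "ctx_split G G1 G2" "conf_typ C (Suc n) (push U G1) \<phi> T" "trm_typ M n G2 U"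
    by auto
  then show ?case
    using CSubB.IH[OF s(2)] CSubB.prems(2) ctx_split_None[OF s(1), of "Name x"] trm_typ_fn[OF s(3), of x]
    by (auto simp del: not_None_eq)
qed

section \<open>Inversion for named binders\<close>

lemma bound_map_closeA: "k \<le> n \<Longrightarrow> bound_map n (Suc n) (closeA k x)"
  unfolding bound_map_def
proof (intro allI impI)
  show "bound (Suc n) (closeA k x a)" if "k \<le> n" "bound n a" for a
    using that by (cases a) auto
qed

lemma bound_map_openA: "k \<le> n \<Longrightarrow> bound_map (Suc n) n (openA k x)"
  unfolding bound_map_def
proof (intro allI impI)
  show "bound n (openA k x a)" if "k \<le> n" "bound (Suc n) a" for a
    using that by (cases a) auto
qed

lemma openA_closeA_apply [simp]: "openA k x (closeA k x a) = a"
  by (cases a) auto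

text \<open>Precomposition with \<open>closeA k x\<close> forms the preimage of a context. The range
  of \<open>closeA k x\<close> misses only \<open>Name x\<close>, so nothing of \<open>G\<close> is
  lost.\<close>

lemma image_ctx_closeA:
  "G (Name x) = None \<Longrightarrow> image_ctx (closeA k x) (\<lambda>a. G (closeA k x a)) G"
  unfolding image_ctx_def inj_on_def
  by (metis openA_closeA_apply closeA_openA option.distinct(1))

lemma image_ctx_openA:
  "G (Name x) = None \<Longrightarrow> image_ctx (openA k x) G (\<lambda>a. G (closeA k x a))"
  unfolding image_ctx_def inj_on_def dom_def
  by (smt (verit) openA_closeA_apply closeA_openA option.distinct(1) mem_Collect_eq)

text \<open>From left to right the term is opened with \<open>x\<close> itself, which cancels the
  closing; from right to left the typing is transported along the closing.\<close>

lemma trm_typ_close: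
  assumes "k \<le> n"
  shows "trm_typ (close M k x) (Suc n) G T \<longleftrightarrow> G (Name x) = None \<and> trm_typ M n (\<lambda>a. G (closeA k x a)) T"
proof
  assume *: "trm_typ (close M k x) (Suc n) G T"
  then have G: "G (Name x) = None" using trm_typ_fn[OF *, of x] by (metis Diff_iff insertI1 fn_close)
  with trm_typ_ren[OF * bound_map_openA[OF assms] image_ctx_openA[of G x k, OF G]]
  show "G (Name x) = None \<and> trm_typ M n (\<lambda>a. G (closeA k x a)) T"
    by (simp add: close_eq_ren ren_ren)
next
  assume *: "G (Name x) = None \<and> trm_typ M n (\<lambda>a. G (closeA k x a)) T"
  then show "trm_typ (close M k x) (Suc n) G T"
    unfolding close_eq_ren
    by (intro trm_typ_ren[OF conjunct2 bound_map_closeA[OF assms] image_ctx_closeA]) auto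
qed

lemma buf_typ_close:
  assumes "k \<le> n"
  shows "buf_typ (map (\<lambda>m. closeMsg m k x) ms) (Suc n) G S' S \<longleftrightarrow>
    G (Name x) = None \<and> buf_typ ms n (\<lambda>a. G (closeA k x a)) S' S"
proof
  assume *: "buf_typ (map (\<lambda>m. closeMsg m k x) ms) (Suc n) G S' S"
  then have G: "G (Name x) = None" using buf_typ_fn[OF *, of x] by (auto simp: fn_closeMsg fnMsgs_def simp del: not_None_eq)
  with buf_typ_ren[OF * bound_map_openA[OF assms] image_ctx_openA[of G x k, OF G]]
  show "G (Name x) = None \<and> buf_typ ms n (\<lambda>a. G (closeA k x a)) S' S"
    by (simp add: closeMsg_eq_ren renMsg_renMsg comp_def)
next
  assume *: "G (Name x) = None \<and> buf_typ ms n (\<lambda>a. G (closeA k x a)) S' S"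
  then show "buf_typ (map (\<lambda>m. closeMsg m k x) ms) (Suc n) G S' S"
    unfolding closeMsg_eq_ren
    by (intro buf_typ_ren[OF conjunct2 bound_map_closeA[OF assms] image_ctx_closeA]) auto
qed

lemma conf_typ_close:
  assumes "k \<le> n"
  shows "conf_typ (closeC C k x) (Suc n) G \<phi> T \<longleftrightarrow> G (Name x) = None \<and> conf_typ C n (\<lambda>a. G (closeA k x a)) \<phi> T"
proof
  assume *: "conf_typ (closeC C k x) (Suc n) G \<phi> T"
  then have G: "G (Name x) = None" using conf_typ_fn[OF *, of x] by (metis Diff_iff insertI1 fn_closeC)
  with conf_typ_ren[OF * bound_map_openA[OF assms] image_ctx_openA[of G x k, OF G]]
  show "G (Name x) = None \<and> conf_typ C n (\<lambda>a. G (closeA k x a)) \<phi> T"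
    by (simp add: closeC_eq_ren renC_renC)
next
  assume *: "G (Name x) = None \<and> conf_typ C n (\<lambda>a. G (closeA k x a)) \<phi> T"
  then show "conf_typ (closeC C k x) (Suc n) G \<phi> T"
    unfolding closeC_eq_ren
    by (intro conf_typ_ren[OF conjunct2 bound_map_closeA[OF assms] image_ctx_closeA]) auto
qed

text \<open>Seen from inside a named binder, the entry pushed at index 0 is an ordinary entry for
  \<open>x\<close>.\<close>

lemma push_Name [simp]: "(\<lambda>a. push T G (closeA 0 x a)) = G(Name x := lin T)"
proof
  show "push T G (closeA 0 x a) = (G(Name x := lin T)) a" for a
    by (cases a) auto
qed

text \<open>The bound name \<open>x\<close> is arbitrary, not chosen fresh: it is not free in the
  abstraction, so \<open>G\<close> cannot have an entry for it.\<close>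

lemma trm_typ_Lam: "trm_typ (Lam x M) n G W \<longleftrightarrow>
    (\<exists>T U. W = Lolli T U \<and> G (Name x) = None \<and> trm_typ M n (G(Name x := lin T)) U)"
  by (auto simp: Lam_def trm_typ_close)

lemma trm_typ_Sub: "trm_typ (Sub M N x) n G U \<longleftrightarrow>
    (\<exists>G1 G2 T. ctx_split G G1 G2 \<and> G1 (Name x) = None \<and> trm_typ M n (G1(Name x := lin T)) U \<and> trm_typ N n G2 T)"
  by (auto simp: Sub_def trm_typ_close)

lemma push_upd: "(push T G)(Name x := t) = push T (G(Name x := t))"
proof
  show "((push T G)(Name x := t)) a = push T (G(Name x := t)) a" for a
    by (cases "(T, G, a)" rule: push.cases) auto
qed

text \<open>The absence of \<open>x\<close> is tested after the entry for \<open>y\<close> has been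
  made. For \<open>x = y\<close>, which contexts and congruence do not exclude, this forces
  \<open>T'\<close> to be \<open>Sess End\<close>, and the name is bound as the first
  component.\<close>

lemma trm_typ_LetP: "trm_typ (LetP x y M N) n G U \<longleftrightarrow>
    (\<exists>G1 G2 T T'. ctx_split G G1 G2 \<and> trm_typ M n G1 (Prod T T') \<and>
      G2 (Name y) = None \<and> (G2(Name y := lin T')) (Name x) = None \<and>
      trm_typ N n (G2(Name y := lin T', Name x := lin T)) U)"
  by (auto simp: LetP_def trm_typ_close push_upd)

lemma conf_typ_CSub: "conf_typ (CSub C M x) n G \<phi> U \<longleftrightarrow>
    (\<exists>G1 G2 T. ctx_split G G1 G2 \<and> G1 (Name x) = None \<and> conf_typ C n (G1(Name x := lin T)) \<phi> U \<and> trm_typ M n G2 T)"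
  by (auto simp: CSub_def conf_typ_close)

lemma dual_dual [simp]: "dual (dual S) = S"
proof -
  have True and "dual (dual S) = S" for T :: ty
  proof (induction T and S)
    case (Plus Ss)
    then have "fmmap (\<lambda>S. dual (dual S)) Ss = fmmap id Ss" by (intro fmmap_cong_ran) auto
    then show ?case by (simp add: fmap.map_comp comp_def fmap.map_id)
  next
    case (With Ss)
    then have "fmmap (\<lambda>S. dual (dual S)) Ss = fmmap id Ss" by (intro fmmap_cong_ran) auto
    then show ?case by (simp add: fmap.map_comp comp_def fmap.map_id)
  qed simp_all
  then show ?thesis by blast
qed

lemma dual_eq_End [simp]: "dual S = End \<longleftrightarrow> S = End"
  by (cases S) auto

text \<open>For \<open>x = y\<close>, which the congruence rules and contexts do not exclude, \<open>Res\<close> binds the name as the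
  endpoint \<open>x\<close>, and the endpoint \<open>y\<close> is unused.\<close>

lemma conf_typ_Res: "conf_typ (Res x ms y C) n G \<phi> T \<longleftrightarrow>
    (\<exists>H1 H2 S' S. G (Name x) = None \<and> G (Name y) = None \<and> (x = y \<longrightarrow> S = End) \<and>
      ctx_split (G(Name y := lin (Sess (dual S)), Name x := lin (Sess S'))) H1 H2 \<and>
      H1 (Name x) = None \<and> buf_typ ms n H1 S' S \<and> conf_typ C n H2 \<phi> T)" (is "_ \<longleftrightarrow> ?R")
proof -
  let ?c = "\<lambda>a. closeA 0 y (closeA 0 x a)"
  let ?o = "\<lambda>a. openA 0 x (openA 0 y a)"
  let ?B = "\<lambda>S' S. push (Sess (dual S)) (push (Sess S') G)"
  \<comment> \<open>The two atoms outside the range of \<open>?c\<close>. If \<open>x = y\<close>,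
    the second of them is \<open>Idx 0\<close>, which is how \<open>S = End\<close> arises.\<close>
  let ?N = "\<lambda>H. H (Name y) = None \<and> H (closeA 0 y (Name x)) = None"
  have B: "?B S' S (?c a) = (G(Name y := lin (Sess (dual S)), Name x := lin (Sess S'))) a" for S' S a
    by (cases a) auto
  have "conf_typ (Res x ms y C) n G \<phi> T \<longleftrightarrow> (\<exists>H1 H2 S' S. ctx_split (?B S' S) H1 H2 \<and> H1 (Idx 1) = None \<and>
      (?N H1 \<and> buf_typ ms n (\<lambda>a. H1 (?c a)) S' S) \<and> ?N H2 \<and> conf_typ C n (\<lambda>a. H2 (?c a)) \<phi> T)" (is "_ \<longleftrightarrow> ?L")
  proof -
    have *: "map (\<lambda>m. closeMsg (closeMsg m 0 x) 0 y) ms =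
      map (\<lambda>m. closeMsg m 0 y) (map (\<lambda>m. closeMsg m 0 x) ms)" by simp
    show ?thesis unfolding Res_def conf_typ.simps * by (simp only: buf_typ_close conf_typ_close le0 conj_assoc)
  qed
  also have "?L \<longleftrightarrow> ?R"
  proof
    assume ?L
    then obtain H1 H2 S' S where s: "ctx_split (?B S' S) H1 H2" and *: "H1 (Idx 1) = None"
      "?N H1" "?N H2" "buf_typ ms n (\<lambda>a. H1 (?c a)) S' S" "conf_typ C n (\<lambda>a. H2 (?c a)) \<phi> T" by auto
    have "ctx_split (G(Name y := lin (Sess (dual S)), Name x := lin (Sess S'))) (\<lambda>a. H1 (?c a)) (\<lambda>a. H2 (?c a))"
      using s unfolding ctx_split_def B[symmetric] by blast
    moreover have "G (Name y) = None" using ctx_split_None[OF s, of "Name y"] * by auto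
    moreover have "G (Name x) = None"
      using ctx_split_None[OF s, of "Name x"] * \<open>G (Name y) = None\<close> by (auto split: if_splits)
    moreover have "S = End" if "x = y"
      using ctx_split_None[OF s, of "Idx 0"] * that by auto
    moreover have "H1 (?c (Name x)) = None" using * by simp
    ultimately show ?R using * by blast
  next
    assume ?R
    then obtain h1 h2 S' S where G: "G (Name x) = None" "G (Name y) = None" "x = y \<longrightarrow> S = End"
      and s: "ctx_split (G(Name y := lin (Sess (dual S)), Name x := lin (Sess S'))) h1 h2"
      and *: "h1 (Name x) = None" "buf_typ ms n h1 S' S" "conf_typ C n h2 \<phi> T" by blast
    \<comment> \<open>The inverse passage, from named to indexed contexts:
      \<open>?c (?o a) = a\<close> holds exactly on the range of \<open>?c\<close>, and elsewhere
      the context is empty.\<close>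
    define H where "H h = (\<lambda>a. if ?c (?o a) = a then h (?o a) else None)" for h :: actx
    have H: "(\<lambda>a. H h (?c a)) = h" for h by (simp add: H_def)
    have N: "?N (H h)" for h by (simp add: H_def)
    have 1: "H h1 (Idx 1) = None" using * by (simp add: H_def)
    have "ctx_split (?B S' S) (H h1) (H h2)" unfolding ctx_split_def
    proof
      fix a
      show "H h1 a = None \<and> ?B S' S a = H h2 a \<or> H h2 a = None \<and> ?B S' S a = H h1 a"
      proof (cases "?c (?o a) = a")
        case True
        then have "H h a = h (?o a)" "?B S' S a = ?B S' S (?c (?o a))" for h by (auto simp: H_def)
        then show ?thesis using s unfolding ctx_split_def B by metis
      next
        case False
        then have "?B S' S a = None" using G
          by (cases "(Sess S', G, a)" rule: push.cases) (auto split: if_splits)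
        then show ?thesis using False by (simp add: H_def)
      qed
    qed
    then show ?L using *(2,3) 1 N
      by (intro exI[of _ "H h1"] exI[of _ "H h2"] exI[of _ S'] exI[of _ S] conjI) (simp_all only: H)
  qed
  finally show ?thesis .
qed

section \<open>Contexts\<close>

definition hide :: "var set \<Rightarrow> actx \<Rightarrow> actx" where
  "hide V D = (\<lambda>a. if a \<in> Name ` V then None else D a)"

definition agree :: "var set \<Rightarrow> actx \<Rightarrow> actx \<Rightarrow> bool" where
  "agree V D D' \<longleftrightarrow> (\<forall>x\<in>V. D' (Name x) = D (Name x))"

text \<open>\<open>K T h D\<close> is the typing of \<open>h\<close> in the hole, \<open>J h G\<close> that of the context filled with \<open>h\<close>; \<open>V\<close> and \<open>F\<close>
  are the captured and the free names of the context, and \<open>E\<close> is what the context itself consumes.\<close>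

definition hole :: "('t \<Rightarrow> 'h \<Rightarrow> actx \<Rightarrow> bool) \<Rightarrow> ('h \<Rightarrow> actx \<Rightarrow> bool) \<Rightarrow> var set \<Rightarrow> var set \<Rightarrow>
    'h \<Rightarrow> actx \<Rightarrow> bool" where
  "hole K J V F h G \<longleftrightarrow> (\<exists>E D T. K T h D \<and> ctx_split G E (hide V D) \<and> (\<forall>x. x \<notin> F \<longrightarrow> E (Name x) = None) \<and>
    (\<forall>h' D' G'. K T h' D' \<longrightarrow> agree V D D' \<longrightarrow> ctx_split G' E (hide V D') \<longrightarrow> J h' G'))"

lemma hide_Name [simp]: "hide V D (Name x) = (if x \<in> V then None else D (Name x))"
  by (auto simp: hide_def)

lemma hide_empty [simp]: "hide {} D = D"
  by (simp add: hide_def)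

lemma agree_empty [simp]: "agree {} D D'"
  by (simp add: agree_def)

lemma agree_refl [simp]: "agree V D D"
  by (simp add: agree_def)

section \<open>Building a context around its hole\<close>

lemma hole_top: "K T h G \<Longrightarrow> (\<And>h' G'. K T h' G' \<Longrightarrow> J h' G') \<Longrightarrow> hole K J {} F h G"
  unfolding hole_def by (rule exI[of _ Map.empty]) auto

lemma hole_mono:
  assumes "hole K J V F h G" "\<And>h' G'. J h' G' \<Longrightarrow> J' h' G'"
  shows "hole K J' V F h G"
  using assms unfolding hole_def by blast

text \<open>The context acquires a sibling that consumes \<open>G2\<close>, so the new remainder is
  the union of \<open>E\<close> and \<open>G2\<close>.\<close>

lemma hole_side:
  assumes h: "hole K J V F h G1" and s: "ctx_split G G1 G2" and F2: "\<And>x. x \<notin> F2 \<Longrightarrow> G2 (Name x) = None"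
    and J: "\<And>h' G' G1'. J h' G1' \<Longrightarrow> ctx_split G' G1' G2 \<Longrightarrow> J' h' G'"
  shows "hole K J' V (F \<union> F2) h G"
proof -
  from h obtain E D T where *: "K T h D" "ctx_split G1 E (hide V D)" "\<And>x. x \<notin> F \<Longrightarrow> E (Name x) = None"
    and r: "\<And>h' D' G'. K T h' D' \<Longrightarrow> agree V D D' \<Longrightarrow> ctx_split G' E (hide V D') \<Longrightarrow> J h' G'"
    unfolding hole_def by blast
  from ctx_split_assoc[OF s ctx_split_comm[THEN iffD1, OF *(2)]] obtain E' where
    E': "ctx_split G (hide V D) E'" "ctx_split E' E G2" .
  have "J' h' G'" if "K T h' D'" "agree V D D'" "ctx_split G' E' (hide V D')" for h' D' G'
  proof -
    from ctx_split_assoc[OF that(3) ctx_split_comm[THEN iffD1, OF E'(2)]] obtain G1' where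
      "ctx_split G' G2 G1'" "ctx_split G1' E (hide V D')" .
    then show ?thesis using J r that ctx_split_comm by blast
  qed
  moreover have "E' (Name x) = None" if "x \<notin> F \<union> F2" for x
    using ctx_split_None[OF E'(2)] *(3) F2 that by simp
  ultimately show ?thesis unfolding hole_def using *(1) E'(1) ctx_split_comm by blast
qed

text \<open>The entry \<open>t\<close> of the bound name is consumed either by the surrounding
  context or in the hole. Erasing it from \<open>E\<close> and hiding it at the hole treats both
  cases alike, because agreement on \<open>x\<close> makes every replacement consume the same
  entry.\<close>

lemma hole_under_binder:
  assumes h: "hole K J V F h (G(Name x := t))" and x: "G (Name x) = None"
    and J: "\<And>h' G'. J h' (G'(Name x := t)) \<Longrightarrow> G' (Name x) = None \<Longrightarrow> J' h' G'"
  shows "hole K J' (insert x V) (F - {x}) h G"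
proof -
  from h obtain E D T where *: "K T h D" "ctx_split (G(Name x := t)) E (hide V D)"
    "\<And>x. x \<notin> F \<Longrightarrow> E (Name x) = None"
    and r: "\<And>h' D' G'. K T h' D' \<Longrightarrow> agree V D D' \<Longrightarrow> ctx_split G' E (hide V D') \<Longrightarrow> J h' G'"
    unfolding hole_def by blast
  let ?E = "E(Name x := None)"
  have "ctx_split G ?E (hide (insert x V) D)" unfolding ctx_split_def
  proof
    show "?E a = None \<and> G a = hide (insert x V) D a \<or> hide (insert x V) D a = None \<and> G a = ?E a" for a
      using *(2)[unfolded ctx_split_def, rule_format, of a] x
      by (cases "a = Name x") (auto simp: hide_def)
  qed
  moreover have "J' h' G'" if "K T h' D'" "agree (insert x V) D D'"
    and s: "ctx_split G' ?E (hide (insert x V) D')" for h' D' G'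
  proof (rule J)
    have "ctx_split (G'(Name x := t)) E (hide V D')" unfolding ctx_split_def
    proof
      show "E a = None \<and> (G'(Name x := t)) a = hide V D' a \<or> hide V D' a = None \<and> (G'(Name x := t)) a = E a" for a
        using *(2)[unfolded ctx_split_def, rule_format, of a] s[unfolded ctx_split_def, rule_format, of a] that(2)
        by (cases "a = Name x") (auto simp: hide_def agree_def)
    qed
    then show "J h' (G'(Name x := t))" using r that by (auto simp: agree_def)
    show "G' (Name x) = None" using ctx_split_None[OF s, of "Name x"] by (simp add: hide_def)
  qed
  ultimately show ?thesis unfolding hole_def using *(1,3)
    by (intro exI[of _ ?E] exI[of _ D] exI[of _ T]) auto
qed

lemma hole_ext_in:
  assumes h: "hole K J V F h (G1(Name x := t))" and x: "G1 (Name x) = None" "x \<notin> F" "x \<notin> V"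
    and s: "ctx_split G G1 G2" and G2: "\<And>v. v \<in> V \<Longrightarrow> G2 (Name v) = None"
    and K: "\<And>T D D1. K T h (D1(Name x := t)) \<Longrightarrow> D1 (Name x) = None \<Longrightarrow> ctx_split D D1 G2 \<Longrightarrow> K T h' D"
  shows "J h' G"
proof -
  from h obtain E D T where *: "K T h D" "ctx_split (G1(Name x := t)) E (hide V D)"
    "\<And>x. x \<notin> F \<Longrightarrow> E (Name x) = None"
    and r: "\<And>h' D' G'. K T h' D' \<Longrightarrow> agree V D D' \<Longrightarrow> ctx_split G' E (hide V D') \<Longrightarrow> J h' G'"
    unfolding hole_def by blast
  let ?D1 = "D(Name x := None)"
  \<comment> \<open>What the substitution consumes inside the hole: the old share without
    \<open>x\<close>, joined with the share of the argument.\<close>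
  let ?D = "\<lambda>a. if ?D1 a = None then G2 a else ?D1 a"
  have G2': "G2 a = None" if "a \<in> Name ` V" for a using that G2 by auto
  have "D (Name x) = t"
    using *(2)[unfolded ctx_split_def, rule_format, of "Name x"] *(3)[of x] x by auto
  then have "D = ?D1(Name x := t)" by auto
  moreover have "ctx_split ?D ?D1 G2" unfolding ctx_split_def
  proof
    show "?D1 a = None \<and> ?D a = G2 a \<or> G2 a = None \<and> ?D a = ?D1 a" for a
      using *(2)[unfolded ctx_split_def, rule_format, of a] s[unfolded ctx_split_def, rule_format, of a] G2'[of a]
      by (cases "a = Name x") (auto simp: hide_def split: if_splits)
  qed
  ultimately have "K T h' ?D" using K[of T ?D1 ?D] *(1) by auto
  moreover have "agree V D ?D" using x(3) G2 by (auto simp: agree_def)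
  moreover have "ctx_split G E (hide V ?D)" unfolding ctx_split_def
  proof
    show "E a = None \<and> G a = hide V ?D a \<or> hide V ?D a = None \<and> G a = E a" for a
      using *(2)[unfolded ctx_split_def, rule_format, of a] s[unfolded ctx_split_def, rule_format, of a]
        *(3)[of x] x G2'[of a]
      by (cases "a = Name x") (auto simp: hide_def split: if_splits)
  qed
  ultimately show ?thesis using r by blast
qed

text \<open>The converse motion. \<open>Q\<close> stands for the typing of the argument at the entry
  \<open>t\<close>. Its share \<open>D2\<close> contains no captured name and may therefore leave
  the context.\<close>

lemma hole_ext_out:
  assumes h: "hole K J V F h G" and x: "x \<notin> F" "x \<notin> V"
    and K: "\<And>T D. K T h D \<Longrightarrow> \<exists>D1 D2 t. ctx_split D D1 D2 \<and> D1 (Name x) = None \<and> K T h' (D1(Name x := t)) \<and>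
      Q D2 t \<and> (\<forall>v\<in>V. D2 (Name v) = None)"
  shows "\<exists>G1 G2 t. ctx_split G G1 G2 \<and> G1 (Name x) = None \<and> J h' (G1(Name x := t)) \<and> Q G2 t"
proof -
  from h obtain E D T where *: "K T h D" "ctx_split G E (hide V D)"
    "\<And>x. x \<notin> F \<Longrightarrow> E (Name x) = None"
    and r: "\<And>h' D' G'. K T h' D' \<Longrightarrow> agree V D D' \<Longrightarrow> ctx_split G' E (hide V D') \<Longrightarrow> J h' G'"
    unfolding hole_def by blast
  from K[OF *(1)] obtain D1 D2 t where d: "ctx_split D D1 D2" "D1 (Name x) = None" "K T h' (D1(Name x := t))"
      "Q D2 t" "\<forall>v\<in>V. D2 (Name v) = None" by blast
  \<comment> \<open>The share of the filled context after the argument has left: its own part and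
    the visible part of the body.\<close>
  let ?G = "\<lambda>a. if E a = None then hide V D1 a else E a"
  have E: "E (Name x) = None" using *(3) x by simp
  have "ctx_split G ?G D2" unfolding ctx_split_def
  proof
    show "?G a = None \<and> G a = D2 a \<or> D2 a = None \<and> G a = ?G a" for a
      using *(2)[unfolded ctx_split_def, rule_format, of a] d(1)[unfolded ctx_split_def, rule_format, of a] d(5)
      by (auto simp: hide_def)
  qed
  moreover have "agree V D (D1(Name x := t))"
    unfolding agree_def
  proof
    show "(D1(Name x := t)) (Name v) = D (Name v)" if "v \<in> V" for v
      using d(1)[unfolded ctx_split_def, rule_format, of "Name v"] d(5) x that by auto
  qed
  moreover have "ctx_split (?G(Name x := t)) E (hide V (D1(Name x := t)))" unfolding ctx_split_def
  proof
    show "E a = None \<and> (?G(Name x := t)) a = hide V (D1(Name x := t)) a \<or>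
      hide V (D1(Name x := t)) a = None \<and> (?G(Name x := t)) a = E a" for a
      using *(2)[unfolded ctx_split_def, rule_format, of a] d(1)[unfolded ctx_split_def, rule_format, of a] d(5) E x
      by (cases "a = Name x") (auto simp: hide_def)
  qed
  moreover have "?G (Name x) = None" using E d(2) by (simp add: hide_def)
  ultimately show ?thesis using r d(3,4) by blast
qed

section \<open>Filled term contexts\<close>

lemma fnR_simps [simp]:
  "fnR Hole = {}"
  "fnR (RApp R N) = fnR R \<union> fn N"
  "fnR (RSpawn R) = fnR R"
  "fnR (RSend R) = fnR R"
  "fnR (RRecv R) = fnR R"
  "fnR (RLet x y R N) = fnR R \<union> (fn N - {x, y})"
  "fnR (RSelect l R) = fnR R"
  "fnR (RCase R Ns) = fnR R \<union> \<Union> (fmran' (fmmap fn Ns))"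
  "fnR (RSub R N x) = (fnR R - {x}) \<union> fn N"
  "fnR (RSubArg N R x) = fnR R \<union> (fn N - {x})"
  "fnR (RSendP N R) = fnR R \<union> fn N"
  by (auto simp: fnR_def fn_LetP fn_Sub)

abbreviation holeR :: "nat \<Rightarrow> rctx \<Rightarrow> ty \<Rightarrow> trm \<Rightarrow> actx \<Rightarrow> bool" where
  "holeR n R U \<equiv> hole (\<lambda>T M D. trm_typ M n D T) (\<lambda>M G. trm_typ (fillR R M) n G U) (bnR R) (fnR R)"

lemma trm_typ_fresh: "trm_typ M n G T \<Longrightarrow> x \<notin> fn M \<Longrightarrow> G (Name x) = None"
  using trm_typ_fn by blast

lemma conf_typ_fresh: "conf_typ C n G \<phi> T \<Longrightarrow> x \<notin> fnC C \<Longrightarrow> G (Name x) = None"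
  using conf_typ_fn by blast

lemma buf_typ_fresh: "buf_typ ms n G S' S \<Longrightarrow> x \<notin> fnMsgs ms \<Longrightarrow> G (Name x) = None"
  using buf_typ_fn by blast

text \<open>Only \<open>RSub\<close> captures names at the hole. \<open>RLet\<close> and
  \<open>RSubArg\<close> bind in the sibling of the hole, so they need no binder step, but the bound
  names are removed from what the sibling contributes.\<close>

lemma trm_typ_fillR: "trm_typ (fillR R M) n G U \<Longrightarrow> holeR n R U M G"
proof (induction R arbitrary: G U)
  case Hole
  then show ?case by (auto intro: hole_top)
next
  case (RApp R N)
  from RApp.prems obtain G1 G2 T where *: "ctx_split G G1 G2" "trm_typ (fillR R M) n G1 (Lolli T U)" "trm_typ N n G2 T"
    by auto
  show ?case unfolding fnR_simps bnR.simps
    by (rule hole_side[OF RApp.IH[OF *(2)] *(1) trm_typ_fresh[OF *(3)]])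
      (use *(3) in \<open>unfold fillR.simps trm_typ.simps, blast+\<close>)
next
  case (RLet x y R N)
  from RLet.prems obtain G1 G2 T T' where *: "ctx_split G G1 G2" "trm_typ (fillR R M) n G1 (Prod T T')"
      "G2 (Name y) = None" "(G2(Name y := lin T')) (Name x) = None"
      "trm_typ N n (G2(Name y := lin T', Name x := lin T)) U" by (auto simp: trm_typ_LetP simp del: fun_upd_apply)
  have "G2 (Name z) = None" if "z \<notin> fn N - {x, y}" for z
    using trm_typ_fresh[OF *(5), of z] *(3,4) that by (auto split: if_splits)
  then show ?case unfolding fnR_simps bnR.simps
    by (rule hole_side[OF RLet.IH[OF *(2)] *(1)])
      (use *(3-5) in \<open>unfold fillR.simps trm_typ_LetP, blast+\<close>)
next
  case (RCase R Ns)
  from RCase.prems obtain G1 G2 Ss where *: "ctx_split G G1 G2" "fmdom' Ss \<noteq> {}" "fmdom' Ns = fmdom' Ss"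
    "trm_typ (fillR R M) n G1 (Sess (With Ss))"
    "\<forall>i N S. fmlookup Ns i = Some N \<longrightarrow> fmlookup Ss i = Some S \<longrightarrow> trm_typ N n G2 (Lolli (Sess S) U)"
    by (auto simp del: not_None_eq)
  from *(2,3) obtain i N S where i: "fmlookup Ns i = Some N" "fmlookup Ss i = Some S"
    by (metis ex_in_conv fmdom'_notI not_Some_eq)
  then have "trm_typ N n G2 (Lolli (Sess S) U)" "fn N \<subseteq> \<Union> (fmran' (fmmap fn Ns))"
    using *(5) by (auto simp: fmap.set_map intro: fmran'I)
  then have "G2 (Name z) = None" if "z \<notin> \<Union> (fmran' (fmmap fn Ns))" for z
    using trm_typ_fresh that by blast
  note fresh = this
  show ?case unfolding fnR_simps bnR.simps
  proof (rule hole_side[OF RCase.IH[OF *(4)] *(1) fresh])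
    show "trm_typ (fillR (RCase R Ns) M') n G' U"
      if "trm_typ (fillR R M') n G1' (Sess (With Ss))" "ctx_split G' G1' G2" for M' G' G1'
      unfolding fillR.simps trm_typ_Case using that *(2,3,5)
      by (intro exI[of _ G1'] exI[of _ G2] exI[of _ Ss]) simp
  qed
next
  case (RSub R N x)
  from RSub.prems obtain G1 G2 T where *: "ctx_split G G1 G2" "G1 (Name x) = None"
    "trm_typ (fillR R M) n (G1(Name x := lin T)) U" "trm_typ N n G2 T" by (auto simp: trm_typ_Sub)
  have "hole (\<lambda>T M D. trm_typ M n D T) (\<lambda>M G. G (Name x) = None \<and> trm_typ (fillR R M) n (G(Name x := lin T)) U)
    (insert x (bnR R)) (fnR R - {x}) M G1"
    by (rule hole_under_binder[OF RSub.IH[OF *(3)] *(2)]) (rule conjI)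
  note push = this
  show ?case unfolding fnR_simps bnR.simps
  proof (rule hole_side[OF push *(1) trm_typ_fresh[OF *(4)]])
    show "trm_typ (fillR (RSub R N x) M') n G' U"
      if "G1' (Name x) = None \<and> trm_typ (fillR R M') n (G1'(Name x := lin T)) U" "ctx_split G' G1' G2" for M' G' G1'
      unfolding fillR.simps trm_typ_Sub using that *(4) by blast
  qed
next
  case (RSubArg N R x)
  from RSubArg.prems obtain G1 G2 T where *: "ctx_split G G1 G2" "G1 (Name x) = None"
    "trm_typ N n (G1(Name x := lin T)) U" "trm_typ (fillR R M) n G2 T" by (auto simp: trm_typ_Sub)
  have "G1 (Name z) = None" if "z \<notin> fn N - {x}" for z
    using trm_typ_fresh[OF *(3), of z] *(2) that by (auto split: if_splits)
  note fresh = this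
  show ?case unfolding fnR_simps bnR.simps
  proof (rule hole_side[OF RSubArg.IH[OF *(4)] ctx_split_comm[THEN iffD1, OF *(1)] fresh])
    show "trm_typ (fillR (RSubArg N R x) M') n G' U"
      if "trm_typ (fillR R M') n G2' T" "ctx_split G' G2' G1" for M' G' G2'
      unfolding fillR.simps trm_typ_Sub using that(1) ctx_split_comm[THEN iffD1, OF that(2)] *(2,3) by blast
  qed
next
  case (RSendP N R)
  from RSendP.prems obtain G1 G2 T S where *: "ctx_split G G1 G2" "trm_typ N n G1 T" 
    "trm_typ (fillR R M) n G2 (Sess (Out T S))" and U: "U = Sess S" by auto
  show ?case unfolding fnR_simps bnR.simps
  proof (rule hole_side[OF RSendP.IH[OF *(3)] ctx_split_comm[THEN iffD1, OF *(1)] trm_typ_fresh[OF *(2)]])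
    show "trm_typ (fillR (RSendP N R) M') n G' U"
      if "trm_typ (fillR R M') n G2' (Sess (Out T S))" "ctx_split G' G2' G1" for M' G' G2'
      unfolding fillR.simps trm_typ.simps using that(1) ctx_split_comm[THEN iffD1, OF that(2)] *(2) U by blast
  qed
next
  case (RSpawn R)
  then have "holeR n R (Prod One U) M G" by simp
  then show ?case unfolding fnR_simps bnR.simps by (rule hole_mono) simp
next
  case (RSend R)
  then obtain T S where U: "U = Sess S" and "holeR n R (Prod T (Sess (Out T S))) M G" by auto
  from this(2) show ?case unfolding fnR_simps bnR.simps by (rule hole_mono) (use U in auto)
next
  case (RRecv R)
  then obtain T S where U: "U = Prod T (Sess S)" and "holeR n R (Sess (In T S)) M G" by auto
  from this(2) show ?case unfolding fnR_simps bnR.simps by (rule hole_mono) (use U in auto)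
next
  case (RSelect l R)
  then obtain Ss S where U: "U = Sess S" "fmlookup Ss l = Some S" and "holeR n R (Sess (Plus Ss)) M G" by auto
  from this(3) show ?case unfolding fnR_simps bnR.simps by (rule hole_mono) (use U in auto)
qed

section \<open>Preservation for terms\<close>

text \<open>The argument may cross the context in either direction because the captured names do not
  occur in \<open>N\<close>, hence not in the context that \<open>N\<close> consumes.\<close>

lemma trm_typ_Sub_ext:
  assumes "x \<notin> fnR R" "x \<notin> bnR R" "bnR R \<inter> fn N = {}"
  shows "trm_typ (Sub (fillR R M) N x) n G U \<longleftrightarrow> trm_typ (fillR R (Sub M N x)) n G U"
proof
  assume "trm_typ (Sub (fillR R M) N x) n G U"
  then obtain G1 G2 T where *: "ctx_split G G1 G2" "G1 (Name x) = None"
    "trm_typ (fillR R M) n (G1(Name x := lin T)) U" "trm_typ N n G2 T" unfolding trm_typ_Sub by blast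
  have fresh: "G2 (Name v) = None" if "v \<in> bnR R" for v using trm_typ_fresh[OF *(4)] assms(3) that by blast
  show "trm_typ (fillR R (Sub M N x)) n G U"
  proof (rule hole_ext_in[OF trm_typ_fillR[OF *(3)] *(2) assms(1,2) *(1) fresh])
    show "trm_typ (Sub M N x) n D T'" if "trm_typ M n (D1(Name x := lin T)) T'" "D1 (Name x) = None" "ctx_split D D1 G2"
      for T' D D1 unfolding trm_typ_Sub using that *(4) by blast
  qed
next
  assume "trm_typ (fillR R (Sub M N x)) n G U"
  then have "\<exists>G1 G2 t. ctx_split G G1 G2 \<and> G1 (Name x) = None \<and> trm_typ (fillR R M) n (G1(Name x := t)) U \<and>
    (\<exists>T. t = lin T \<and> trm_typ N n G2 T)"
  proof (rule hole_ext_out[OF trm_typ_fillR assms(1,2)])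
    fix T D
    assume "trm_typ (Sub M N x) n D T"
    then obtain D1 D2 T' where *: "ctx_split D D1 D2" "D1 (Name x) = None"
      "trm_typ M n (D1(Name x := lin T')) T" "trm_typ N n D2 T'" unfolding trm_typ_Sub by blast
    have "\<forall>v\<in>bnR R. D2 (Name v) = None" using trm_typ_fresh[OF *(4)] assms(3) by blast
    with * show "\<exists>D1 D2 t. ctx_split D D1 D2 \<and> D1 (Name x) = None \<and> trm_typ M n (D1(Name x := t)) T \<and>
      (\<exists>T. t = lin T \<and> trm_typ N n D2 T) \<and> (\<forall>v\<in>bnR R. D2 (Name v) = None)" by blast
  qed
  then show "trm_typ (Sub (fillR R M) N x) n G U" unfolding trm_typ_Sub by blast
qed

lemma scM_trm_typ: "M \<equiv>\<^sub>M M' \<Longrightarrow> trm_typ M n G T \<longleftrightarrow> trm_typ M' n G T"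
proof (induction arbitrary: n G T rule: scM.induct)
  case (scM_SubExt x R N M)
  then show ?case by (rule trm_typ_Sub_ext)
next
  case (scM_CaseBranch Ns i N N' M)
  have "insert i (fmdom' Ns) = fmdom' Ns" using scM_CaseBranch(1) by (auto intro: fmdom'I)
  then have "(fmdom' (fmupd i N' Ns) = fmdom' Ss) \<longleftrightarrow> (fmdom' Ns = fmdom' Ss)" for Ss :: "(label, sty) fmap"
    by simp
  moreover have "(\<forall>j L S. fmlookup (fmupd i N' Ns) j = Some L \<longrightarrow> fmlookup Ss j = Some S \<longrightarrow> trm_typ L n G2 (Lolli (Sess S) T))
    \<longleftrightarrow> (\<forall>j L S. fmlookup Ns j = Some L \<longrightarrow> fmlookup Ss j = Some S \<longrightarrow> trm_typ L n G2 (Lolli (Sess S) T))"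
    for G2 Ss using scM_CaseBranch(1,3) by (metis fmupd_lookup option.inject)
  ultimately show ?case unfolding trm_typ_Case by simp
qed (simp_all add: trm_typ_Lam trm_typ_Sub trm_typ_LetP del: fun_upd_apply)

text \<open>If \<open>T\<close> is not \<open>end\<close>, then \<open>y\<close> has no entry in
  \<open>G1\<close> and the renaming is injective on the entries. If \<open>T\<close> is
  \<open>end\<close>, then \<open>x\<close> has no entry, and merging it with a \<open>y\<close>
  that has one does no harm.\<close>

lemma trm_typ_rename:
  assumes M: "trm_typ M n (G1(Name x := lin T)) U" and x: "G1 (Name x) = None"
    and s: "ctx_split G G1 (single (Name y) T)"
  shows "trm_typ (rename M y x) n G U"
  unfolding rename_eq_ren
proof (rule trm_typ_ren[OF M])
  let ?f = "renameA y x"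
  have f: "?f a = (if a = Name x then Name y else a)" for a by (cases a) auto
  show "bound_map n n ?f" unfolding bound_map_def f by (auto split: if_splits)
  have y: "T = Sess End \<or> G1 (Name y) = None" "G (Name y) = (if T = Sess End then G1 (Name y) else Some T)"
    using s[unfolded ctx_split_def, rule_format, of "Name y"] by (auto simp: single_def lin_def split: if_splits)
  have o: "G a = G1 a" if "a \<noteq> Name y" for a
    using s[unfolded ctx_split_def, rule_format, of a] that by (auto simp: single_def)
  show "image_ctx ?f (G1(Name x := lin T)) G" unfolding image_ctx_def
  proof (intro conjI allI impI)
    show "inj_on ?f (dom (G1(Name x := lin T)))"
      using x y(1) by (auto simp: inj_on_def f split: if_splits)
    show "G (?f a) = Some U" if "(G1(Name x := lin T)) a = Some U" for a U
      using that y o[of a] by (cases "a = Name y") (auto simp: f split: if_splits)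
    show "\<exists>a. ?f a = b \<and> (G1(Name x := lin T)) a = Some U" if b: "G b = Some U" for b U
    proof (cases "b = Name y \<and> T \<noteq> Sess End")
      case True
      then show ?thesis using b y by (intro exI[of _ "Name x"]) (auto simp: f lin_def)
    next
      case False
      then have "G1 b = Some U" using b y o by (cases "b = Name y") auto
      then show ?thesis using x False by (intro exI[of _ b]) (auto simp: f)
    qed
  qed
qed

lemma trm_typ_LetP_distinct: "x \<noteq> y \<Longrightarrow> trm_typ (LetP x y M N) n G U \<longleftrightarrow>
    (\<exists>G1 G2 T T'. ctx_split G G1 G2 \<and> trm_typ M n G1 (Prod T T') \<and> G2 (Name y) = None \<and> G2 (Name x) = None \<and>
      trm_typ N n (G2(Name y := lin T', Name x := lin T)) U)"
  unfolding trm_typ_LetP by simp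

lemma redM_trm_typ: "M \<longrightarrow>\<^sub>M M' \<Longrightarrow> trm_typ M n G T \<Longrightarrow> trm_typ M' n G T"
proof (induction arbitrary: n G T rule: redM.induct)
  case (redM_Lam x N M)
  then show ?case by (auto simp: trm_typ_Lam trm_typ_Sub simp del: fun_upd_apply)
next
  case (redM_Pair x y M1 M2 N)
  from redM_Pair(3) obtain G1 G2 T1 T2 where 
    *: "ctx_split G G1 G2" "trm_typ (Pr M1 M2) n G1 (Prod T1 T2)" "G2 (Name y) = None" "G2 (Name x) = None"
    "trm_typ N n (G2(Name y := lin T2, Name x := lin T1)) T"
    unfolding trm_typ_LetP_distinct[OF redM_Pair(1)] by blast
  then obtain D1 D2 where D: "ctx_split G1 D1 D2" "trm_typ M1 n D1 T1" "trm_typ M2 n D2 T2" by auto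
  have fresh: "D1 (Name y) = None" "D1 (Name x) = None" using trm_typ_fresh[OF D(2)] redM_Pair(2) by auto
  \<comment> \<open>\<open>E\<close> belongs to the inner substitution: \<open>D1\<close> for its
    argument and \<open>G2\<close> for its body. \<open>D2\<close> is left for the outer
    one.\<close>
  from ctx_split_assoc[OF *(1) ctx_split_comm[THEN iffD1, OF D(1)]] obtain E where E: "ctx_split G D2 E" "ctx_split E D1 G2" .
  have y: "E (Name y) = None" using ctx_split_None[OF E(2)] *(3) fresh by blast
  have "ctx_split (E(Name y := lin T2)) (G2(Name y := lin T2)) D1" unfolding ctx_split_def
  proof
    show "(G2(Name y := lin T2)) a = None \<and> (E(Name y := lin T2)) a = D1 a \<or>
      D1 a = None \<and> (E(Name y := lin T2)) a = (G2(Name y := lin T2)) a" for a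
      using E(2)[unfolded ctx_split_def, rule_format, of a] fresh by auto
  qed
  then have "trm_typ (Sub N M1 x) n (E(Name y := lin T2)) T" 
    unfolding trm_typ_Sub using *(3-5) D(2) redM_Pair(1) by (metis fun_upd_other atom.inject(1))
  then show ?case unfolding trm_typ_Sub[of "Sub N M1 x"] using y E(1) D(3) ctx_split_comm by blast
next
  case (redM_Pair' x y M1 M2 N)
  from redM_Pair'(3) obtain G1 G2 T1 T2 where 
    *: "ctx_split G G1 G2" "trm_typ (Pr M1 M2) n G1 (Prod T1 T2)" "G2 (Name y) = None" "G2 (Name x) = None"
    "trm_typ N n (G2(Name y := lin T2, Name x := lin T1)) T"
    unfolding trm_typ_LetP_distinct[OF redM_Pair'(1)] by blast
  then obtain D1 D2 where D: "ctx_split G1 D1 D2" "trm_typ M1 n D1 T1" "trm_typ M2 n D2 T2" by auto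
  have fresh: "D2 (Name y) = None" "D2 (Name x) = None" using trm_typ_fresh[OF D(3)] redM_Pair'(2) by auto
  from ctx_split_assoc[OF *(1) D(1)] obtain E where E: "ctx_split G D1 E" "ctx_split E D2 G2" .
  have x: "E (Name x) = None" using ctx_split_None[OF E(2)] *(4) fresh by blast
  have "ctx_split (E(Name x := lin T1)) (G2(Name x := lin T1)) D2" unfolding ctx_split_def
  proof
    show "(G2(Name x := lin T1)) a = None \<and> (E(Name x := lin T1)) a = D2 a \<or>
      D2 a = None \<and> (E(Name x := lin T1)) a = (G2(Name x := lin T1)) a" for a
      using E(2)[unfolded ctx_split_def, rule_format, of a] fresh by auto
  qed
  \<comment> \<open>In this order the outer substitution binds \<open>x\<close>, so its entry is
    made before that of \<open>y\<close>.\<close>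
  moreover have "trm_typ N n (G2(Name x := lin T1, Name y := lin T2)) T"
    using *(5) redM_Pair'(1) by (metis fun_upd_twist atom.inject(1))
  ultimately have "trm_typ (Sub N M2 y) n (E(Name x := lin T1)) T" 
    unfolding trm_typ_Sub using *(3) D(3) redM_Pair'(1) by (metis fun_upd_other atom.inject(1))
  then show ?case unfolding trm_typ_Sub[of "Sub N M2 y"] using x E(1) D(2) ctx_split_comm by blast
next
  case (redM_SubName M y x)
  then show ?case unfolding trm_typ_Sub trm_typ.simps using trm_typ_rename by blast
next
  case (redM_NameSub x M)
  then obtain G1 G2 T' where *: "ctx_split G G1 G2" "G1 (Name x) = None" "G1(Name x := lin T') = single (Name x) T"
    "trm_typ M n G2 T'" unfolding trm_typ_Sub trm_typ.simps by blast
  from *(3) have "lin T' = lin T" by (metis fun_upd_same single_def)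
  \<comment> \<open>Only \<open>end\<close> has no entry, so equal entries determine the type even
    when both are absent.\<close>
  then have "T' = T" by (metis lin_eq(1) lin_eq(3) not_None_eq)
  moreover have "G1 = Map.empty"
  proof
    show "G1 a = None" for a using *(2) fun_cong[OF *(3), of a] by (auto simp: single_def split: if_splits)
  qed
  ultimately show ?case using * by simp
next
  case (redM_Send M N)
  then show ?case by auto
next
  case (redM_Lift M N R)
  then show ?case using trm_typ_fillR[OF redM_Lift.prems] unfolding hole_def by (metis agree_refl)
next
  case (redM_LiftSC M M' N' N)
  then show ?case using scM_trm_typ by blast
qed

section \<open>Filled thread and configuration contexts\<close>

lemma fnF_simps [simp]:
  "fnF (FThread \<phi> R) = fnR R"
  "fnF (FSub C R x) = fnR R \<union> (fnC C - {x})"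
  by (auto simp: fnF_def fnR_def fnC_CSub)

lemma fnG_simps [simp]:
  "fnG GHole = {}"
  "fnG (GPar G C) = fnG G \<union> fnC C"
  "fnG (GRes x ms y G) = (fnG G \<union> fnMsgs ms) - {x} - {y}"
  "fnG (GSub G M x) = (fnG G - {x}) \<union> fn M"
  by (auto simp: fnG_def fnC_CSub fnC_Res)

lemma conf_typ_fillF:
  assumes "conf_typ (fillF F M) n G \<phi> U"
  shows "hole (\<lambda>T M D. trm_typ M n D T) (\<lambda>M G. conf_typ (fillF F M) n G \<phi> U) (bnF F) (fnF F) M G"
proof (cases F)
  case (FThread \<psi> R)
  with assms have *: "\<phi> = \<psi>" "\<psi> = Child \<longrightarrow> U = One" "trm_typ (fillR R M) n G U" by auto
  from trm_typ_fillR[OF *(3)] show ?thesis unfolding FThread fnF_simps bnF.simps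
    by (rule hole_mono) (use * in simp)
next
  case (FSub C R x)
  with assms obtain G1 G2 T where *: "ctx_split G G1 G2" "G1 (Name x) = None" 
    "conf_typ C n (G1(Name x := lin T)) \<phi> U" "trm_typ (fillR R M) n G2 T" by (auto simp: conf_typ_CSub)
  have fresh: "G1 (Name z) = None" if "z \<notin> fnC C - {x}" for z
    using conf_typ_fresh[OF *(3), of z] *(2) that by (auto split: if_splits)
  show ?thesis unfolding FSub fnF_simps bnF.simps
  proof (rule hole_side[OF trm_typ_fillR[OF *(4)] ctx_split_comm[THEN iffD1, OF *(1)] fresh])
    show "conf_typ (fillF (FSub C R x) M') n G' \<phi> U"
      if "trm_typ (fillR R M') n G2' T" "ctx_split G' G2' G1" for M' G' G2'
      unfolding fillF.simps conf_typ_CSub using that(1) ctx_split_comm[THEN iffD1, OF that(2)] *(2,3) by blast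
  qed
qed

text \<open>The type at the hole is a pair of a marker and a type, since parallel composition
  distinguishes its components by both.\<close>

lemma conf_typ_fillG:
  "conf_typ (fillG \<G> C) n G \<phi> U \<Longrightarrow>
    hole (\<lambda>(\<psi>, T) C D. conf_typ C n D \<psi> T) (\<lambda>C G. conf_typ (fillG \<G> C) n G \<phi> U) (bnG \<G>) (fnG \<G>) C G"
proof (induction \<G> arbitrary: G \<phi> U)
  case GHole
  then have "(\<lambda>(\<psi>, T) C D. conf_typ C n D \<psi> T) (\<phi>, U) C G" by simp
  then show ?case unfolding fnG_simps bnG.simps by (rule hole_top) auto
next
  case (GPar \<G> D)
  from GPar.prems obtain G1 G2 \<phi>1 T1 \<phi>2 T2 where *: "ctx_split G G1 G2" "conf_typ (fillG \<G> C) n G1 \<phi>1 T1" "conf_typ D n G2 \<phi>2 T2"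
    and j: "\<phi>1 = Child \<and> T1 = One \<and> \<phi>2 = \<phi> \<and> T2 = U \<or> \<phi>1 = \<phi> \<and> T1 = U \<and> \<phi>2 = Child \<and> T2 = One"
    by auto
  show ?case unfolding fnG_simps bnG.simps
  proof (rule hole_side[OF GPar.IH[OF *(2)] *(1) conf_typ_fresh[OF *(3)]])
    show "conf_typ (fillG (GPar \<G> D) C') n G' \<phi> U" if "conf_typ (fillG \<G> C') n G1' \<phi>1 T1" "ctx_split G' G1' G2" for C' G' G1'
      unfolding fillG.simps conf_typ.simps using that *(3) j by blast
  qed
next
  case (GRes x ms y \<G>)
  from GRes.prems obtain H1 H2 S' S where G: "G (Name x) = None" "G (Name y) = None" "x = y \<longrightarrow> S = End"
    and s: "ctx_split (G(Name y := lin (Sess (dual S)), Name x := lin (Sess S'))) H1 H2"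
    and *: "H1 (Name x) = None" "buf_typ ms n H1 S' S" "conf_typ (fillG \<G> C) n H2 \<phi> U"
    unfolding fillG.simps conf_typ_Res by blast
  let ?K = "\<lambda>(\<psi>, T) C D. conf_typ C n D \<psi> T"
  \<comment> \<open>The stage before the endpoints are bound: the buffer is a sibling of the filled
    configuration. Its share \<open>H1\<close> stays fixed, so it continues to lack
    \<open>x\<close>. The endpoints are then crossed as two separate binders.\<close>
  let ?J = "\<lambda>C' G'. \<exists>H2. ctx_split G' H1 H2 \<and> conf_typ (fillG \<G> C') n H2 \<phi> U"
  have 1: "hole ?K ?J (bnG \<G>) (fnG \<G> \<union> fnMsgs ms) C (G(Name y := lin (Sess (dual S)), Name x := lin (Sess S')))"
  proof (rule hole_side[OF GRes.IH[OF *(3)] ctx_split_comm[THEN iffD1, OF s] buf_typ_fresh[OF *(2)]])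
    show "\<exists>H2. ctx_split G' H1 H2 \<and> conf_typ (fillG \<G> C') n H2 \<phi> U"
      if "conf_typ (fillG \<G> C') n G1' \<phi> U" "ctx_split G' G1' H1" for C' G' G1'
      using that(1) ctx_split_comm[THEN iffD1, OF that(2)] by blast
  qed
  have x: "(G(Name y := lin (Sess (dual S)))) (Name x) = None" using G by (auto simp: lin_def)
  let ?J2 = "\<lambda>C' G'. ?J C' (G'(Name x := lin (Sess S'))) \<and> G' (Name x) = None"
  have 2: "hole ?K ?J2 (insert x (bnG \<G>)) (fnG \<G> \<union> fnMsgs ms - {x}) C (G(Name y := lin (Sess (dual S))))"
    by (rule hole_under_binder[OF 1 x]) (rule conjI)
  have 3: "hole ?K (\<lambda>C G. conf_typ (fillG (GRes x ms y \<G>) C) n G \<phi> U) (insert y (insert x (bnG \<G>)))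
    (fnG \<G> \<union> fnMsgs ms - {x} - {y}) C G"
  proof (rule hole_under_binder[OF 2 G(2)])
    fix C' G'
    assume "?J2 C' (G'(Name y := lin (Sess (dual S))))" and y: "G' (Name y) = None"
    then have "?J C' (G'(Name y := lin (Sess (dual S)), Name x := lin (Sess S')))" "G' (Name x) = None"
      by (auto split: if_splits simp del: fun_upd_apply) (metis fun_upd_apply)
    then show "conf_typ (fillG (GRes x ms y \<G>) C') n G' \<phi> U" unfolding fillG.simps conf_typ_Res
      using y G(3) *(1,2) by blast
  qed
  then show ?case unfolding fnG_simps bnG.simps by (simp only: insert_commute)
next
  case (GSub \<G> N x)
  from GSub.prems obtain G1 G2 T where *: "ctx_split G G1 G2" "G1 (Name x) = None"
    "conf_typ (fillG \<G> C) n (G1(Name x := lin T)) \<phi> U" "trm_typ N n G2 T" by (auto simp: conf_typ_CSub)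
  have push: "hole (\<lambda>(\<psi>, T) C D. conf_typ C n D \<psi> T)
    (\<lambda>C G. G (Name x) = None \<and> conf_typ (fillG \<G> C) n (G(Name x := lin T)) \<phi> U)
    (insert x (bnG \<G>)) (fnG \<G> - {x}) C G1"
    by (rule hole_under_binder[OF GSub.IH[OF *(3)] *(2)]) (rule conjI)
  show ?case unfolding fnG_simps bnG.simps
  proof (rule hole_side[OF push *(1) trm_typ_fresh[OF *(4)]])
    show "conf_typ (fillG (GSub \<G> N x) C') n G' \<phi> U"
      if "G1' (Name x) = None \<and> conf_typ (fillG \<G> C') n (G1'(Name x := lin T)) \<phi> U" "ctx_split G' G1' G2" for C' G' G1'
      unfolding fillG.simps conf_typ_CSub using that *(4) by blast
  qed
qed

section \<open>Structural congruence of configurations\<close>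

text \<open>Merges the two alternatives of the clause for parallel composition, so that
  commutativity and associativity of that operator become facts about \<open>join\<close> and about
  splits.\<close>

definition join :: "marker \<Rightarrow> ty \<Rightarrow> marker \<Rightarrow> ty \<Rightarrow> marker \<Rightarrow> ty \<Rightarrow> bool" where
  "join \<phi>1 T1 \<phi>2 T2 \<phi> T \<longleftrightarrow>
    \<phi>1 = Child \<and> T1 = One \<and> \<phi>2 = \<phi> \<and> T2 = T \<or> \<phi>1 = \<phi> \<and> T1 = T \<and> \<phi>2 = Child \<and> T2 = One"

lemma conf_typ_Par: "conf_typ (Par C D) n G \<phi> T \<longleftrightarrow> (\<exists>G1 G2 \<phi>1 T1 \<phi>2 T2. join \<phi>1 T1 \<phi>2 T2 \<phi> T \<and>
    ctx_split G G1 G2 \<and> conf_typ C n G1 \<phi>1 T1 \<and> conf_typ D n G2 \<phi>2 T2)"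
  unfolding conf_typ.simps join_def by blast

lemma join_comm: "join \<phi>1 T1 \<phi>2 T2 \<phi> T \<longleftrightarrow> join \<phi>2 T2 \<phi>1 T1 \<phi> T"
  by (auto simp: join_def)

lemma join_assoc:
  assumes "join \<phi>1 T1 \<phi>2 T2 \<phi> T" "join \<phi>3 T3 \<phi>4 T4 \<phi>1 T1"
    and "\<phi>3 = Child \<Longrightarrow> T3 = One" "\<phi>4 = Child \<Longrightarrow> T4 = One" "\<phi>2 = Child \<Longrightarrow> T2 = One"
  obtains \<psi> U where "join \<phi>3 T3 \<psi> U \<phi> T" "join \<phi>4 T4 \<phi>2 T2 \<psi> U"
proof -
  have "\<exists>\<psi> U. join \<phi>3 T3 \<psi> U \<phi> T \<and> join \<phi>4 T4 \<phi>2 T2 \<psi> U"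
    using assms unfolding join_def by (elim disjE conjE) auto
  then show ?thesis using that by blast
qed

lemma conf_typ_Child: "conf_typ C n G Child T \<Longrightarrow> T = One"
  by (induction C arbitrary: n G T) auto

lemma conf_typ_Res_distinct: "x \<noteq> y \<Longrightarrow> conf_typ (Res x ms y C) n G \<phi> T \<longleftrightarrow>
    (\<exists>H1 H2 S' S. G (Name x) = None \<and> G (Name y) = None \<and>
      ctx_split (G(Name x := lin (Sess S'), Name y := lin (Sess (dual S)))) H1 H2 \<and>
      H1 (Name x) = None \<and> buf_typ ms n H1 S' S \<and> conf_typ C n H2 \<phi> T)"
  unfolding conf_typ_Res by (simp add: fun_upd_twist)

text \<open>An empty buffer makes the sessions of the endpoints dual to each other. The swapped
  restriction starts from the dual session, and \<open>dual\<close> is an involution.\<close>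

lemma conf_typ_ResSwap: "x \<noteq> y \<Longrightarrow> conf_typ (Res x [] y C) n G \<phi> T \<Longrightarrow> conf_typ (Res y [] x C) n G \<phi> T"
  unfolding conf_typ_Res by (auto simp del: fun_upd_apply)
    (metis dual_dual atom.inject(1) fun_upd_twist)

lemma ctx_split_upd:
  assumes "ctx_split G G1 G2" "G1 a = None"
  shows "ctx_split (G(a := t)) G1 (G2(a := t))"
  using assms by (auto simp: ctx_split_def)

text \<open>Freshness keeps each pair of endpoints out of the other buffer. An endpoint therefore
  goes to its own buffer or to the body, whichever restriction is outside.\<close>

lemma conf_typ_ResComm:
  assumes d: "distinct [x, y, z, w]" and fresh: "{x, y} \<inter> fnMsgs ns = {}" "{z, w} \<inter> fnMsgs ms = {}"
    and conf_typ: "conf_typ (Res x ms y (Res z ns w C)) n G \<phi> T"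
  shows "conf_typ (Res z ns w (Res x ms y C)) n G \<phi> T"
proof -
  have ne: "x \<noteq> y" "z \<noteq> w" "x \<noteq> z" "x \<noteq> w" "y \<noteq> z" "y \<noteq> w" using d by auto
  from conf_typ obtain H1 H2 S' S where G: "G (Name x) = None" "G (Name y) = None"
    and s: "ctx_split (G(Name x := lin (Sess S'), Name y := lin (Sess (dual S)))) H1 H2"
    and H: "H1 (Name x) = None" "buf_typ ms n H1 S' S" "conf_typ (Res z ns w C) n H2 \<phi> T"
    unfolding conf_typ_Res_distinct[OF ne(1)] by blast
  from H(3) obtain K1 K2 R' R where H2: "H2 (Name z) = None" "H2 (Name w) = None"
    and s2: "ctx_split (H2(Name z := lin (Sess R'), Name w := lin (Sess (dual R)))) K1 K2"
    and K: "K1 (Name z) = None" "buf_typ ns n K1 R' R" "conf_typ C n K2 \<phi> T"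
    unfolding conf_typ_Res_distinct[OF ne(2)] by blast
  have Kf: "K1 (Name x) = None" "K1 (Name y) = None" using buf_typ_fresh[OF K(2)] fresh by auto
  have Hf: "H1 (Name z) = None" "H1 (Name w) = None" using buf_typ_fresh[OF H(2)] fresh by auto
  let ?G = "G(Name z := lin (Sess R'), Name w := lin (Sess (dual R)))"
  have Gzw: "G (Name z) = None" "G (Name w) = None"
    using ctx_split_None[OF s, of "Name z"] ctx_split_None[OF s, of "Name w"] Hf H2 ne by auto
  have "ctx_split (?G(Name x := lin (Sess S'), Name y := lin (Sess (dual S)))) H1
     (H2(Name z := lin (Sess R'), Name w := lin (Sess (dual R))))"
    using ctx_split_upd[OF ctx_split_upd[OF s, of "Name z" "lin (Sess R')"], of "Name w" "lin (Sess (dual R))"] Hf ne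
    by (simp add: fun_upd_twist)
  from ctx_split_assoc[OF this[THEN ctx_split_comm[THEN iffD1]] s2] obtain L where
    L: "ctx_split (?G(Name x := lin (Sess S'), Name y := lin (Sess (dual S)))) K1 L" "ctx_split L K2 H1" .
  \<comment> \<open>The entries for \<open>x\<close> and \<open>y\<close> in \<open>L\<close> are
    removed because the inner restriction introduces them itself.\<close>
  let ?L = "L(Name x := None, Name y := None)"
  have Lxy: "L (Name x) = lin (Sess S')" "L (Name y) = lin (Sess (dual S))"
    using L(1)[unfolded ctx_split_def, rule_format, of "Name x"] L(1)[unfolded ctx_split_def, rule_format, of "Name y"] Kf ne
    by auto
  have "ctx_split ?G K1 ?L" unfolding ctx_split_def
  proof
    show "K1 a = None \<and> ?G a = ?L a \<or> ?L a = None \<and> ?G a = K1 a" for a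
      using L(1)[unfolded ctx_split_def, rule_format, of a] Kf G ne by (auto split: if_splits)
  qed
  moreover have "?L(Name x := lin (Sess S'), Name y := lin (Sess (dual S))) = L"
    using Lxy ne by auto
  then have "conf_typ (Res x ms y C) n ?L \<phi> T" unfolding conf_typ_Res_distinct[OF ne(1)]
    using L(2)[THEN ctx_split_comm[THEN iffD1]] H(1,2) K(3) ne
    by (intro exI[of _ H1] exI[of _ K2] exI[of _ S'] exI[of _ S]) simp
  ultimately show ?thesis unfolding conf_typ_Res_distinct[OF ne(2)] using Gzw K(1,2) by blast
qed

text \<open>\<open>C\<close> consumes neither endpoint, so its share can be split off before or
  after the entries for the endpoints are made.\<close>

lemma conf_typ_ResExt:
  assumes "x \<noteq> y" "x \<notin> fnC C" "y \<notin> fnC C"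
  shows "conf_typ (Res x ms y (Par C D)) n G \<phi> T \<longleftrightarrow> conf_typ (Par C (Res x ms y D)) n G \<phi> T"
proof
  assume "conf_typ (Res x ms y (Par C D)) n G \<phi> T"
  then obtain H1 H2 S' S where G: "G (Name x) = None" "G (Name y) = None"
    and s: "ctx_split (G(Name x := lin (Sess S'), Name y := lin (Sess (dual S)))) H1 H2"
    and H: "H1 (Name x) = None" "buf_typ ms n H1 S' S" "conf_typ (Par C D) n H2 \<phi> T"
    unfolding conf_typ_Res_distinct[OF assms(1)] by blast
  from H(3) obtain K1 K2 \<phi>1 T1 \<phi>2 T2 where j: "join \<phi>1 T1 \<phi>2 T2 \<phi> T" and s2: "ctx_split H2 K1 K2"
    and K: "conf_typ C n K1 \<phi>1 T1" "conf_typ D n K2 \<phi>2 T2" unfolding conf_typ_Par by blast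
  have f: "K1 (Name x) = None" "K1 (Name y) = None" using conf_typ_fresh[OF K(1)] assms by auto
  from ctx_split_assoc[OF s[THEN ctx_split_comm[THEN iffD1]] s2] obtain L where
    L: "ctx_split (G(Name x := lin (Sess S'), Name y := lin (Sess (dual S)))) K1 L" "ctx_split L K2 H1" .
  let ?L = "L(Name x := None, Name y := None)"
  have Lxy: "L (Name x) = lin (Sess S')" "L (Name y) = lin (Sess (dual S))"
    using L(1)[unfolded ctx_split_def, rule_format, of "Name x"] L(1)[unfolded ctx_split_def, rule_format, of "Name y"] f assms(1)
    by auto
  have "ctx_split G K1 ?L" unfolding ctx_split_def
  proof
    show "K1 a = None \<and> G a = ?L a \<or> ?L a = None \<and> G a = K1 a" for a
      using L(1)[unfolded ctx_split_def, rule_format, of a] f G by (auto split: if_splits)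
  qed
  moreover have "?L(Name x := lin (Sess S'), Name y := lin (Sess (dual S))) = L"
    using Lxy assms(1) by auto
  then have "conf_typ (Res x ms y D) n ?L \<phi>2 T2" unfolding conf_typ_Res_distinct[OF assms(1)]
    using L(2)[THEN ctx_split_comm[THEN iffD1]] H(1,2) K(2) assms(1)
    by (intro exI[of _ H1] exI[of _ K2] exI[of _ S'] exI[of _ S]) simp
  ultimately show "conf_typ (Par C (Res x ms y D)) n G \<phi> T" unfolding conf_typ_Par using j K(1) by blast
next
  assume "conf_typ (Par C (Res x ms y D)) n G \<phi> T"
  then obtain K1 L \<phi>1 T1 \<phi>2 T2 where j: "join \<phi>1 T1 \<phi>2 T2 \<phi> T" and s: "ctx_split G K1 L"
    and K: "conf_typ C n K1 \<phi>1 T1" "conf_typ (Res x ms y D) n L \<phi>2 T2" unfolding conf_typ_Par by blast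
  from K(2) obtain H1 H2 S' S where L: "L (Name x) = None" "L (Name y) = None"
    and s2: "ctx_split (L(Name x := lin (Sess S'), Name y := lin (Sess (dual S)))) H1 H2"
    and H: "H1 (Name x) = None" "buf_typ ms n H1 S' S" "conf_typ D n H2 \<phi>2 T2"
    unfolding conf_typ_Res_distinct[OF assms(1)] by blast
  have f: "K1 (Name x) = None" "K1 (Name y) = None" using conf_typ_fresh[OF K(1)] assms by auto
  have "ctx_split (G(Name x := lin (Sess S'), Name y := lin (Sess (dual S)))) K1
    (L(Name x := lin (Sess S'), Name y := lin (Sess (dual S))))"
    using ctx_split_upd[OF ctx_split_upd[OF s f(1)] f(2)] .
  from ctx_split_assoc[OF this[THEN ctx_split_comm[THEN iffD1]] s2] obtain H2' where
    H2': "ctx_split (G(Name x := lin (Sess S'), Name y := lin (Sess (dual S)))) H1 H2'" "ctx_split H2' H2 K1" .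
  have "G (Name x) = None" "G (Name y) = None" using ctx_split_None[OF s] f L by auto
  then show "conf_typ (Res x ms y (Par C D)) n G \<phi> T"
    unfolding conf_typ_Res_distinct[OF assms(1)] conf_typ_Par using H2' j K(1) H ctx_split_comm by blast
qed

lemma conf_typ_ResNil:
  assumes "x \<noteq> y" "x \<notin> fnC C" "y \<notin> fnC C"
  shows "conf_typ (Res x [] y C) n G \<phi> T \<longleftrightarrow> conf_typ C n G \<phi> T"
proof
  assume "conf_typ (Res x [] y C) n G \<phi> T"
  then obtain S where G: "G (Name x) = None" "G (Name y) = None"
    and C: "conf_typ C n (G(Name x := lin (Sess S), Name y := lin (Sess (dual S)))) \<phi> T"
    unfolding conf_typ_Res_distinct[OF assms(1)] by auto
  \<comment> \<open>\<open>x\<close> is not free in \<open>C\<close>, so it has no entry, and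
    \<open>end\<close> is the only session without one.\<close>
  have "S = End" using conf_typ_fresh[OF C assms(2)] assms(1) by simp
  then show "conf_typ C n G \<phi> T" using C G by (simp add: fun_upd_idem lin_def)
next
  assume C: "conf_typ C n G \<phi> T"
  have "G (Name x) = None" "G (Name y) = None" using conf_typ_fresh[OF C] assms by auto
  then show "conf_typ (Res x [] y C) n G \<phi> T"
    unfolding conf_typ_Res_distinct[OF assms(1)] using C
    by (intro exI[of _ Map.empty] exI[of _ G] exI[of _ End]) (simp add: fun_upd_idem lin_def)
qed

lemma conf_typ_ParAssoc: "conf_typ (Par C (Par D E)) n G \<phi> T \<longleftrightarrow> conf_typ (Par (Par C D) E) n G \<phi> T"
proof
  assume "conf_typ (Par C (Par D E)) n G \<phi> T"
  then obtain A B \<phi>1 T1 \<phi>2 T2 B1 B2 \<phi>3 T3 \<phi>4 T4 where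
    j: "join \<phi>1 T1 \<phi>2 T2 \<phi> T" "join \<phi>3 T3 \<phi>4 T4 \<phi>2 T2" and s: "ctx_split G A B" "ctx_split B B1 B2"
    and *: "conf_typ C n A \<phi>1 T1" "conf_typ D n B1 \<phi>3 T3" "conf_typ E n B2 \<phi>4 T4" unfolding conf_typ_Par by blast
  from ctx_split_assoc[OF ctx_split_comm[THEN iffD1, OF s(1)] ctx_split_comm[THEN iffD1, OF s(2)]] obtain A'
    where A: "ctx_split G B2 A'" "ctx_split A' B1 A" .
  from join_assoc[OF j(1)[unfolded join_comm[of \<phi>1]] j(2)[unfolded join_comm[of \<phi>3]]] * conf_typ_Child
  obtain \<psi> U where "join \<phi>4 T4 \<psi> U \<phi> T" "join \<phi>3 T3 \<phi>1 T1 \<psi> U" by metis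
  then show "conf_typ (Par (Par C D) E) n G \<phi> T" unfolding conf_typ_Par using A * join_comm ctx_split_comm by meson
next
  assume "conf_typ (Par (Par C D) E) n G \<phi> T"
  then obtain A B \<phi>1 T1 \<phi>2 T2 B1 B2 \<phi>3 T3 \<phi>4 T4 where
    j: "join \<phi>1 T1 \<phi>2 T2 \<phi> T" "join \<phi>3 T3 \<phi>4 T4 \<phi>1 T1" and s: "ctx_split G A B" "ctx_split A B1 B2"
    and *: "conf_typ C n B1 \<phi>3 T3" "conf_typ D n B2 \<phi>4 T4" "conf_typ E n B \<phi>2 T2" unfolding conf_typ_Par by blast
  from ctx_split_assoc[OF s] obtain A' where A: "ctx_split G B1 A'" "ctx_split A' B2 B" .
  from join_assoc[OF j] * conf_typ_Child
  obtain \<psi> U where "join \<phi>3 T3 \<psi> U \<phi> T" "join \<phi>4 T4 \<phi>2 T2 \<psi> U" by metis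
  then show "conf_typ (Par C (Par D E)) n G \<phi> T" unfolding conf_typ_Par using A * by meson
qed

lemma conf_typ_CSub_ext:
  assumes "x \<notin> fnG \<G>" "x \<notin> bnG \<G>" "bnG \<G> \<inter> fn N = {}"
  shows "conf_typ (CSub (fillG \<G> C) N x) n G \<phi> U \<longleftrightarrow> conf_typ (fillG \<G> (CSub C N x)) n G \<phi> U"
proof
  let ?K = "\<lambda>(\<psi>, T) C D. conf_typ C n D \<psi> T"
  assume "conf_typ (CSub (fillG \<G> C) N x) n G \<phi> U"
  then obtain G1 G2 T where *: "ctx_split G G1 G2" "G1 (Name x) = None"
    "conf_typ (fillG \<G> C) n (G1(Name x := lin T)) \<phi> U" "trm_typ N n G2 T" unfolding conf_typ_CSub by blast
  have fresh: "G2 (Name v) = None" if "v \<in> bnG \<G>" for v using trm_typ_fresh[OF *(4)] assms(3) that by blast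
  show "conf_typ (fillG \<G> (CSub C N x)) n G \<phi> U"
  proof (rule hole_ext_in[OF conf_typ_fillG[OF *(3)] *(2) assms(1,2) *(1) fresh])
    show "?K T' (CSub C N x) D" if "?K T' C (D1(Name x := lin T))" "D1 (Name x) = None" "ctx_split D D1 G2"
      for T' D D1 using that *(4) by (cases T') (simp only: prod.case conf_typ_CSub, blast)
  qed
next
  let ?K = "\<lambda>(\<psi>, T) C D. conf_typ C n D \<psi> T"
  assume "conf_typ (fillG \<G> (CSub C N x)) n G \<phi> U"
  then have "\<exists>G1 G2 t. ctx_split G G1 G2 \<and> G1 (Name x) = None \<and> conf_typ (fillG \<G> C) n (G1(Name x := t)) \<phi> U \<and>
    (\<exists>T. t = lin T \<and> trm_typ N n G2 T)"
  proof (rule hole_ext_out[OF conf_typ_fillG assms(1,2)])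
    fix T :: "marker \<times> ty" and D
    assume "?K T (CSub C N x) D"
    then obtain D1 D2 T' where *: "ctx_split D D1 D2" "D1 (Name x) = None"
      "?K T C (D1(Name x := lin T'))" "trm_typ N n D2 T'"
      by (cases T) (simp only: prod.case conf_typ_CSub, blast)
    have "\<forall>v\<in>bnG \<G>. D2 (Name v) = None" using trm_typ_fresh[OF *(4)] assms(3) by blast
    with * show "\<exists>D1 D2 t. ctx_split D D1 D2 \<and> D1 (Name x) = None \<and>
      ?K T C (D1(Name x := t)) \<and>
      (\<exists>T. t = lin T \<and> trm_typ N n D2 T) \<and> (\<forall>v\<in>bnG \<G>. D2 (Name v) = None)" by blast
  qed
  then show "conf_typ (CSub (fillG \<G> C) N x) n G \<phi> U" unfolding conf_typ_CSub by blast
qed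

section \<open>Sending and selecting as congruences\<close>

text \<open>Explicit substitution is the only clause that captures at the hole. From an exposed hole
  a message can thus leave the thread without its names leaving their scope.\<close>

lemma hatR_bnR: "hatR R \<Longrightarrow> bnR R = {}"
  by (induction R) auto

lemma hatF_bnF: "hatF F \<Longrightarrow> bnF F = {}"
  by (cases F) (auto simp: hatR_bnR)

lemma conf_typ_fillF_cases:
  assumes "conf_typ (fillF F M) n G \<phi> U"
  obtains E D T where "trm_typ M n D T" "ctx_split G E (hide (bnF F) D)"
    "\<And>x. x \<notin> fnF F \<Longrightarrow> E (Name x) = None"
    "\<And>M' D' G'. trm_typ M' n D' T \<Longrightarrow> agree (bnF F) D D' \<Longrightarrow> ctx_split G' E (hide (bnF F) D') \<Longrightarrow>
      conf_typ (fillF F M') n G' \<phi> U"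
  using conf_typ_fillF[OF assms] unfolding hole_def by blast

lemma hide_upd: "x \<notin> V \<Longrightarrow> hide V (D(Name x := t)) = (hide V D)(Name x := t)"
  by (auto simp: hide_def fun_eq_iff)

lemma agree_upd: "x \<notin> V \<Longrightarrow> agree V D (D(Name x := t))"
  by (auto simp: agree_def)

lemma single_upd [simp]: "(single a T)(a := lin U) = single a U"
  by (simp add: single_def)

lemma single_same [simp]: "single a T a = lin T"
  by (simp add: single_def)

lemma ctx_split_upd_left:
  assumes "ctx_split G G1 G2" "G2 a = None"
  shows "ctx_split (G(a := t)) (G1(a := t)) G2"
  using assms by (auto simp: ctx_split_def)

lemma ctx_split_right: "ctx_split G G1 G2 \<Longrightarrow> G1 a = None \<Longrightarrow> G2 a = G a"
  unfolding ctx_split_def by metis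

lemma ctx_split_left: "ctx_split G G1 G2 \<Longrightarrow> G2 a = None \<Longrightarrow> G1 a = G a"
  unfolding ctx_split_def by metis

lemma ctx_split_Some:
  assumes "ctx_split G G1 G2" "G2 a = Some T"
  shows "G1 a = None" "G a = Some T"
  using assms unfolding ctx_split_def by (metis option.distinct(1))+

lemma ctx_split_Some_left:
  assumes "ctx_split G G1 G2" "G1 a = Some T"
  shows "G2 a = None" "G a = Some T"
  using assms unfolding ctx_split_def by (metis option.distinct(1))+

lemma ctx_split_rotate:
  assumes "ctx_split A B C" "ctx_split C D E"
  obtains F where "ctx_split A D F" "ctx_split F B E"
  using ctx_split_assoc[OF ctx_split_comm[THEN iffD1, OF assms(1)] assms(2)] ctx_split_comm by metis

text \<open>Bookkeeping for a message that leaves its thread. \<open>H1\<close> and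
  \<open>H2\<close> are the shares of buffer and body, \<open>P\<close> that of the thread next to
  \<open>Q\<close>, and \<open>D\<close> that of the hole. The share \<open>D1\<close> of the
  message passes from \<open>D\<close> to the buffer, while \<open>X\<close> stays behind.\<close>

lemma ctx_split_move_out:
  assumes "ctx_split A H1 H2" "ctx_split H2 P Q" "ctx_split P E D" "ctx_split D D1 X"
  obtains H1' H2' P' where "ctx_split A H1' H2'" "ctx_split H1' D1 H1" "ctx_split H2' P' Q" "ctx_split P' E X"
proof -
  from ctx_split_rotate[OF assms(3,4)] obtain P' where P': "ctx_split P D1 P'" "ctx_split P' E X" .
  from ctx_split_assoc[OF assms(2) P'(1)] obtain H2' where H2': "ctx_split H2 D1 H2'" "ctx_split H2' P' Q" .
  from ctx_split_assoc[OF ctx_split_comm[THEN iffD1, OF assms(1)] ctx_split_comm[THEN iffD1, OF H2'(1)]]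
  obtain H1' where "ctx_split A H2' H1'" "ctx_split H1' D1 H1" .
  then show ?thesis using that P' H2' ctx_split_comm by blast
qed

text \<open>The way back from the buffer into the hole, needed for sending read from right to left
  and for receiving.\<close>

lemma ctx_split_move_in:
  assumes "ctx_split A H1' H2'" "ctx_split H1' D1 H1" "ctx_split H2' P' Q" "ctx_split P' E X"
  obtains H2 P D where "ctx_split A H1 H2" "ctx_split H2 P Q" "ctx_split P E D" "ctx_split D D1 X"
proof -
  from ctx_split_assoc[OF assms(1) ctx_split_comm[THEN iffD1, OF assms(2)]]
  obtain H2 where H2: "ctx_split A H1 H2" "ctx_split H2 D1 H2'" .
  from ctx_split_assoc[OF ctx_split_comm[THEN iffD1, OF H2(2)] assms(3)]
  obtain P0 where P0: "ctx_split H2 P' P0" "ctx_split P0 Q D1" .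
  from ctx_split_assoc[OF ctx_split_comm[THEN iffD1, OF P0(1)] P0(2)]
  obtain P where P: "ctx_split H2 Q P" "ctx_split P D1 P'" .
  from ctx_split_rotate[OF P(2) assms(4)] obtain D where "ctx_split P E D" "ctx_split D D1 X" .
  then show ?thesis using that H2(1) P(1) ctx_split_comm by blast
qed

lemma conf_typ_Send1:
  assumes "x \<noteq> y" "hatF F" "x \<notin> fnF F \<union> fnC C"
    and "conf_typ (Res x ms y (Par (fillF F (SendP M (Var x))) C)) n G \<phi> U"
  shows "conf_typ (Res x (MTrm M # ms) y (Par (fillF F (Var x)) C)) n G \<phi> U"
proof -
  from assms(4) obtain H1 H2 S' S where G: "G (Name x) = None" "G (Name y) = None"
    and s: "ctx_split (G(Name x := lin (Sess S'), Name y := lin (Sess (dual S)))) H1 H2" (is "ctx_split ?A H1 H2")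
    and H: "H1 (Name x) = None" "buf_typ ms n H1 S' S" "conf_typ (Par (fillF F (SendP M (Var x))) C) n H2 \<phi> U"
    unfolding conf_typ_Res_distinct[OF assms(1)] by blast
  from H(3) obtain P Q \<phi>1 T1 \<phi>2 T2 where j: "join \<phi>1 T1 \<phi>2 T2 \<phi> U" and s2: "ctx_split H2 P Q"
    and P: "conf_typ (fillF F (SendP M (Var x))) n P \<phi>1 T1" and Q: "conf_typ C n Q \<phi>2 T2" unfolding conf_typ_Par by blast
  from conf_typ_fillF_cases[OF P] obtain E D T where D: "trm_typ (SendP M (Var x)) n D T" "ctx_split P E D"
    and E: "E (Name x) = None" and r: "\<And>M' D' G'. trm_typ M' n D' T \<Longrightarrow> ctx_split G' E D' \<Longrightarrow>
      conf_typ (fillF F M') n G' \<phi>1 T1"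
    unfolding hatF_bnF[OF assms(2)] hide_empty using assms(3) by (metis Un_iff agree_empty)
  from D(1) obtain D1 T0 S1 where T: "T = Sess S1"
    and s3: "ctx_split D D1 (single (Name x) (Sess (Out T0 S1)))" and M: "trm_typ M n D1 T0" by auto
  have D1: "D1 (Name x) = None" using ctx_split_Some[OF s3, of "Name x"] by (simp add: lin_def)
  have Qx: "Q (Name x) = None" using conf_typ_fresh[OF Q] assms(3) by simp
  \<comment> \<open>The surrounding context, \<open>C\<close> and the buffer have no share in
    \<open>x\<close>, so the displayed occurrence consumes its entire entry; this determines
    \<open>S'\<close>.\<close>
  have "lin (Sess (Out T0 S1)) = ?A (Name x)"
    using ctx_split_right[OF s3 D1] ctx_split_right[OF D(2) E] ctx_split_left[OF s2 Qx] ctx_split_right[OF s H(1)]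
    by simp
  then have S': "S' = Out T0 S1" using assms(1) by simp
  \<comment> \<open>After the step \<open>x\<close> continues at \<open>S1\<close>; the output
    prefix is accounted for by the new head of the buffer.\<close>
  let ?t = "lin (Sess S1)"
  have "ctx_split (?A(Name x := ?t)) H1 (H2(Name x := ?t))" "ctx_split (H2(Name x := ?t)) (P(Name x := ?t)) Q"
    "ctx_split (P(Name x := ?t)) E (D(Name x := ?t))" "ctx_split (D(Name x := ?t)) D1 (single (Name x) (Sess S1))"
    using ctx_split_upd[OF s H(1)] ctx_split_upd_left[OF s2 Qx] ctx_split_upd[OF D(2) E] ctx_split_upd[OF s3 D1, of ?t] by simp_all
  from ctx_split_move_out[OF this] obtain H1' H2' P' where *: "ctx_split (?A(Name x := ?t)) H1' H2'" "ctx_split H1' D1 H1"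
    "ctx_split H2' P' Q" "ctx_split P' E (single (Name x) (Sess S1))" .
  have "conf_typ (fillF F (Var x)) n P' \<phi>1 T1" using r[OF _ *(4)] T by simp
  then have "conf_typ (Par (fillF F (Var x)) C) n H2' \<phi> U" unfolding conf_typ_Par using j *(3) Q by blast
  moreover have "buf_typ (MTrm M # ms) n H1' S1 S" using *(2) M H(2) S' by auto
  moreover have "H1' (Name x) = None" using ctx_split_None[OF *(2)] D1 H(1) by blast
  moreover have "?A(Name x := ?t) = G(Name x := lin (Sess S1), Name y := lin (Sess (dual S)))"
    using assms(1) by (simp add: fun_upd_twist)
  ultimately show ?thesis unfolding conf_typ_Res_distinct[OF assms(1)] using G *(1) by metis
qed

lemma conf_typ_Send2:
  assumes "x \<noteq> y" "hatF F" "x \<notin> fnF F \<union> fnC C"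
    and "conf_typ (Res x (MTrm M # ms) y (Par (fillF F (Var x)) C)) n G \<phi> U"
  shows "conf_typ (Res x ms y (Par (fillF F (SendP M (Var x))) C)) n G \<phi> U"
proof -
  from assms(4) obtain H1 H2 S' S where G: "G (Name x) = None" "G (Name y) = None"
    and s: "ctx_split (G(Name x := lin (Sess S'), Name y := lin (Sess (dual S)))) H1 H2" (is "ctx_split ?A H1 H2")
    and H: "H1 (Name x) = None" "buf_typ (MTrm M # ms) n H1 S' S" "conf_typ (Par (fillF F (Var x)) C) n H2 \<phi> U"
    unfolding conf_typ_Res_distinct[OF assms(1)] by blast
  from H(3) obtain P Q \<phi>1 T1 \<phi>2 T2 where j: "join \<phi>1 T1 \<phi>2 T2 \<phi> U" and s2: "ctx_split H2 P Q"
    and P: "conf_typ (fillF F (Var x)) n P \<phi>1 T1" and Q: "conf_typ C n Q \<phi>2 T2" unfolding conf_typ_Par by blast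
  from H(2) obtain D1 K T0 where s3: "ctx_split H1 D1 K" and M: "trm_typ M n D1 T0" and K: "buf_typ ms n K (Out T0 S') S"
    by auto
  from conf_typ_fillF_cases[OF P] obtain E D T where D: "trm_typ (Var x) n D T" "ctx_split P E D"
    and E: "E (Name x) = None" and r: "\<And>M' D' G'. trm_typ M' n D' T \<Longrightarrow> ctx_split G' E D' \<Longrightarrow>
      conf_typ (fillF F M') n G' \<phi>1 T1"
    unfolding hatF_bnF[OF assms(2)] hide_empty using assms(3) by (metis Un_iff agree_empty)
  have Qx: "Q (Name x) = None" using conf_typ_fresh[OF Q] assms(3) by simp
  have Ds: "D = single (Name x) T" using D(1) by simp
  \<comment> \<open>Here freshness of \<open>x\<close> is decisive: otherwise another occurrence
    could consume the entry while the displayed one has type \<open>end\<close>. Equal entries fix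
    \<open>T\<close> even if the session of \<open>x\<close> is itself \<open>end\<close>.\<close>
  have "lin T = ?A (Name x)"
    using Ds ctx_split_right[OF D(2) E] ctx_split_left[OF s2 Qx] ctx_split_right[OF s H(1)] by simp
  then have T: "T = Sess S'" using assms(1) by simp
  let ?t = "lin (Sess (Out T0 S'))"
  have "ctx_split (?A(Name x := ?t)) H1 (H2(Name x := ?t))" "ctx_split (H2(Name x := ?t)) (P(Name x := ?t)) Q"
    "ctx_split (P(Name x := ?t)) E (single (Name x) (Sess (Out T0 S')))"
    using ctx_split_upd[OF s H(1)] ctx_split_upd_left[OF s2 Qx] ctx_split_upd[OF D(2) E, of ?t] Ds by simp_all
  from ctx_split_move_in[OF this(1) s3 this(2,3)] obtain H2' P' D' where *: "ctx_split (?A(Name x := ?t)) K H2'"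
    "ctx_split H2' P' Q" "ctx_split P' E D'" "ctx_split D' D1 (single (Name x) (Sess (Out T0 S')))" .
  have "trm_typ (SendP M (Var x)) n D' T" using T *(4) M by auto
  then have "conf_typ (fillF F (SendP M (Var x))) n P' \<phi>1 T1" using r *(3) by blast
  then have "conf_typ (Par (fillF F (SendP M (Var x))) C) n H2' \<phi> U" unfolding conf_typ_Par using j *(2) Q by blast
  moreover have "K (Name x) = None" using ctx_split_None[OF s3] H(1) by blast
  moreover have "?A(Name x := ?t) = G(Name x := ?t, Name y := lin (Sess (dual S)))"
    using assms(1) by (simp add: fun_upd_twist)
  ultimately show ?thesis unfolding conf_typ_Res_distinct[OF assms(1)] using G *(1) K by metis
qed

lemma conf_typ_Select:
  assumes "x \<noteq> y" "x \<notin> bnF F" "x \<notin> fnF F \<union> fnC C"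
  shows "conf_typ (Res x ms y (Par (fillF F (Select l (Var x))) C)) n G \<phi> U \<longleftrightarrow>
    conf_typ (Res x (MLab l # ms) y (Par (fillF F (Var x)) C)) n G \<phi> U"
proof -
  \<comment> \<open>Both directions exchange the term in the hole and the buffer while only the
    session of \<open>x\<close> changes. A label consumes nothing, so no share moves between thread
    and buffer; as \<open>x\<close> is not captured, the hole may lie under substitutions.\<close>
  have replace: "conf_typ (Res x ms2 y (Par (fillF F M2) C)) n G \<phi> U"
    if conf_typ: "conf_typ (Res x ms1 y (Par (fillF F M1) C)) n G \<phi> U"
      and M: "\<And>D T. trm_typ M1 n D T \<Longrightarrow> \<exists>V. D = single (Name x) V \<and>
        (\<forall>H S1 S. V = Sess S1 \<longrightarrow> buf_typ ms1 n H S1 S \<longrightarrow> (\<exists>S2. buf_typ ms2 n H S2 S \<and> trm_typ M2 n (single (Name x) (Sess S2)) T))"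
    for ms1 ms2 M1 M2
  proof -
    from conf_typ obtain H1 H2 S' S where G: "G (Name x) = None" "G (Name y) = None"
      and s: "ctx_split (G(Name x := lin (Sess S'), Name y := lin (Sess (dual S)))) H1 H2" (is "ctx_split ?A H1 H2")
      and H: "H1 (Name x) = None" "buf_typ ms1 n H1 S' S" "conf_typ (Par (fillF F M1) C) n H2 \<phi> U"
      unfolding conf_typ_Res_distinct[OF assms(1)] by blast
    from H(3) obtain P Q \<phi>1 T1 \<phi>2 T2 where j: "join \<phi>1 T1 \<phi>2 T2 \<phi> U" and s2: "ctx_split H2 P Q"
      and P: "conf_typ (fillF F M1) n P \<phi>1 T1" and Q: "conf_typ C n Q \<phi>2 T2" unfolding conf_typ_Par by blast
    from conf_typ_fillF_cases[OF P] obtain E D T where D: "trm_typ M1 n D T" "ctx_split P E (hide (bnF F) D)"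
      and E: "E (Name x) = None" and r: "\<And>M' D' G'. trm_typ M' n D' T \<Longrightarrow> agree (bnF F) D D' \<Longrightarrow>
        ctx_split G' E (hide (bnF F) D') \<Longrightarrow> conf_typ (fillF F M') n G' \<phi>1 T1"
      using assms(3) by (metis Un_iff)
    from M[OF D(1)] obtain V where S1: "D = single (Name x) V"
      "\<And>H S S1. V = Sess S1 \<Longrightarrow> buf_typ ms1 n H S1 S \<Longrightarrow> \<exists>S2. buf_typ ms2 n H S2 S \<and> trm_typ M2 n (single (Name x) (Sess S2)) T" by blast
    have Qx: "Q (Name x) = None" using conf_typ_fresh[OF Q] assms(3) by simp
    have "lin V = ?A (Name x)"
      using S1(1) ctx_split_right[OF D(2) E] ctx_split_left[OF s2 Qx] ctx_split_right[OF s H(1)] assms(2) by simp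
    then have "V = Sess S'" using assms(1) by simp
    with S1(2) H(2) obtain S2 where S2: "buf_typ ms2 n H1 S2 S" "trm_typ M2 n (single (Name x) (Sess S2)) T" by blast
    let ?t = "lin (Sess S2)"
    have *: "ctx_split (?A(Name x := ?t)) H1 (H2(Name x := ?t))" "ctx_split (H2(Name x := ?t)) (P(Name x := ?t)) Q"
      "ctx_split (P(Name x := ?t)) E (hide (bnF F) (D(Name x := ?t)))" "agree (bnF F) D (D(Name x := ?t))"
      using ctx_split_upd[OF s H(1)] ctx_split_upd_left[OF s2 Qx] ctx_split_upd[OF D(2) E]
        hide_upd[OF assms(2)] agree_upd[OF assms(2)] by simp_all
    have "conf_typ (fillF F M2) n (P(Name x := ?t)) \<phi>1 T1" using r[OF _ *(4,3)] S2(2) S1(1) by simp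
    then have "conf_typ (Par (fillF F M2) C) n (H2(Name x := ?t)) \<phi> U" unfolding conf_typ_Par using j *(2) Q by blast
    moreover have "?A(Name x := ?t) = G(Name x := ?t, Name y := lin (Sess (dual S)))"
      using assms(1) by (simp add: fun_upd_twist)
    ultimately show ?thesis unfolding conf_typ_Res_distinct[OF assms(1)] using G *(1) S2(1) H(1) by metis
  qed
  show ?thesis
  proof
    assume "conf_typ (Res x ms y (Par (fillF F (Select l (Var x))) C)) n G \<phi> U"
    then show "conf_typ (Res x (MLab l # ms) y (Par (fillF F (Var x)) C)) n G \<phi> U"
      by (rule replace) auto
  next
    assume "conf_typ (Res x (MLab l # ms) y (Par (fillF F (Var x)) C)) n G \<phi> U"
    then show "conf_typ (Res x ms y (Par (fillF F (Select l (Var x))) C)) n G \<phi> U"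
      by (rule replace) auto
  qed
qed

lemma scC_conf_typ: "C \<equiv>\<^sub>C D \<Longrightarrow> conf_typ C n G \<phi> T \<longleftrightarrow> conf_typ D n G \<phi> T"
proof (induction arbitrary: n G \<phi> T rule: scC.induct)
  case (scC_TermSC M M' \<psi>)
  then show ?case by (simp add: scM_trm_typ)
next
  case (scC_ResSwap x y C)
  then show ?case using conf_typ_ResSwap by metis
next
  case (scC_ResComm x y z w ns ms C)
  have "distinct [z, w, x, y]" using scC_ResComm(1) by auto
  then show ?case using conf_typ_ResComm[of x y z w] conf_typ_ResComm[of z w x y] scC_ResComm by blast
next
  case (scC_ResExt x y C ms D)
  then show ?case by (rule conf_typ_ResExt)
next
  case (scC_ResNil x y C)
  then show ?case by (rule conf_typ_ResNil)
next
  case (scC_Send x y F C ms M)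
  then show ?case using conf_typ_Send1 conf_typ_Send2 by blast
next
  case (scC_Select x y F C ms l)
  then show ?case by (rule conf_typ_Select)
next
  case (scC_ParNil C)
  show ?case
  proof
    assume "conf_typ (Par C (Thread Child Unt)) n G \<phi> T"
    then show "conf_typ C n G \<phi> T" using conf_typ_Child by auto
  next
    assume "conf_typ C n G \<phi> T"
    then show "conf_typ (Par C (Thread Child Unt)) n G \<phi> T"
      unfolding conf_typ.simps trm_typ.simps using ctx_split_empty(2)[of G G] by blast
  qed
next
  case (scC_ParComm C D)
  then show ?case unfolding conf_typ_Par using join_comm ctx_split_comm by blast
next
  case (scC_ParAssoc C D E)
  then show ?case by (rule conf_typ_ParAssoc)
next
  case (scC_ConfSub \<psi> M N x)
  then show ?case by (auto simp: trm_typ_Sub conf_typ_CSub simp del: fun_upd_apply)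
next
  case (scC_ConfSubExt x \<G> M C)
  then show ?case by (rule conf_typ_CSub_ext)
qed (simp_all add: conf_typ_Par conf_typ_Res conf_typ_CSub del: conf_typ.simps fun_upd_apply)

section \<open>Reduction of configurations\<close>

text \<open>Access to the oldest message, the one to be received and the one that
  \<open>typB\<close> adds last. The induction exchanges the shares of the first and the last
  message.\<close>

lemma buf_typ_snoc_trm: "buf_typ (ms @ [MTrm M]) n G S' S \<longleftrightarrow>
    (\<exists>G1 G2 T S0. S = Out T S0 \<and> ctx_split G G1 G2 \<and> trm_typ M n G1 T \<and> buf_typ ms n G2 S' S0)"
proof (induction ms arbitrary: G S')
  case Nil
  then show ?case by auto
next
  case (Cons m ms)
  show ?case
  proof (cases m)
    case (MTrm N)
    show ?thesis
    proof
      assume "buf_typ ((m # ms) @ [MTrm M]) n G S' S"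
      then obtain A B T where *: "ctx_split G A B" "trm_typ N n A T" "buf_typ (ms @ [MTrm M]) n B (Out T S') S"
        by (auto simp: MTrm)
      from *(3) obtain B1 B2 T' S0 where **: "S = Out T' S0" "ctx_split B B1 B2" "trm_typ M n B1 T'" "buf_typ ms n B2 (Out T S') S0"
        unfolding Cons by blast
      from ctx_split_rotate[OF *(1) **(2)] obtain E where E: "ctx_split G B1 E" "ctx_split E A B2" .
      then have "buf_typ (m # ms) n E S' S0" using *(2) **(4) by (auto simp: MTrm)
      then show "\<exists>G1 G2 T S0. S = Out T S0 \<and> ctx_split G G1 G2 \<and> trm_typ M n G1 T \<and> buf_typ (m # ms) n G2 S' S0"
        using ** E by blast
    next
      assume "\<exists>G1 G2 T S0. S = Out T S0 \<and> ctx_split G G1 G2 \<and> trm_typ M n G1 T \<and> buf_typ (m # ms) n G2 S' S0"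
      then obtain A B T S0 where *: "S = Out T S0" "ctx_split G A B" "trm_typ M n A T" "buf_typ (m # ms) n B S' S0" by blast
      from *(4) obtain B1 B2 T' where **: "ctx_split B B1 B2" "trm_typ N n B1 T'" "buf_typ ms n B2 (Out T' S') S0"
        by (auto simp: MTrm)
      from ctx_split_rotate[OF *(2) **(1)] obtain E where E: "ctx_split G B1 E" "ctx_split E A B2" .
      then have "buf_typ (ms @ [MTrm M]) n E (Out T' S') S" unfolding Cons using * ** by blast
      then show "buf_typ ((m # ms) @ [MTrm M]) n G S' S" using ** E by (auto simp: MTrm)
    qed
  next
    case (MLab l)
    show ?thesis by (simp only: append_Cons buf_typ.simps MLab msg.case Cons) blast
  qed
qed

lemma buf_typ_snoc_lab: "buf_typ (ms @ [MLab j]) n G S' S \<longleftrightarrow>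
    (\<exists>Ss S0. S = Plus Ss \<and> fmlookup Ss j = Some S0 \<and> buf_typ ms n G S' S0)"
proof (induction ms arbitrary: G S')
  case (Cons m ms)
  then show ?case by (cases m) (simp_all, blast+)
qed auto

lemma conf_typ_New:
  assumes "x \<noteq> y" "{x, y} \<inter> (fnF F \<union> bnF F) = {}" and "conf_typ (fillF F New) n G \<phi> U"
  shows "conf_typ (Res x [] y (fillF F (Pr (Var x) (Var y)))) n G \<phi> U"
proof -
  from conf_typ_fillF_cases[OF assms(3)] obtain E D T where D: "trm_typ New n D T" "ctx_split G E (hide (bnF F) D)"
    and E: "\<And>x. x \<notin> fnF F \<Longrightarrow> E (Name x) = None" 
    and r: "\<And>M' D' G'. trm_typ M' n D' T \<Longrightarrow> agree (bnF F) D D' \<Longrightarrow> ctx_split G' E (hide (bnF F) D') \<Longrightarrow>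
      conf_typ (fillF F M') n G' \<phi> U" by metis
  from D(1) obtain S where *: "D = Map.empty" "T = Prod (Sess S) (Sess (dual S))" by auto
  have f: "E (Name x) = None" "E (Name y) = None" "x \<notin> bnF F" "y \<notin> bnF F" using E assms(2) by auto
  let ?D = "Map.empty(Name x := lin (Sess S), Name y := lin (Sess (dual S)))"
  let ?G = "G(Name x := lin (Sess S), Name y := lin (Sess (dual S)))"
  have "ctx_split ?D (single (Name x) (Sess S)) (single (Name y) (Sess (dual S)))"
    using assms(1) by (auto simp: ctx_split_def single_def)
  then have "trm_typ (Pr (Var x) (Var y)) n ?D T" using *(2) by auto
  moreover have h: "hide (bnF F) Map.empty = Map.empty" by (simp add: hide_def)
  have "ctx_split ?G E (hide (bnF F) ?D)"
    using ctx_split_upd[OF ctx_split_upd[OF D(2) f(1)] f(2)] * hide_upd[OF f(3)] hide_upd[OF f(4)] h by simp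
  moreover have "agree (bnF F) D ?D" using f by (auto simp: agree_def *)
  ultimately have "conf_typ (fillF F (Pr (Var x) (Var y))) n ?G \<phi> U" using r by blast
  \<comment> \<open>\<open>new\<close> consumes nothing, so all of \<open>G\<close> belongs to the
    surrounding context; in particular \<open>x\<close> and \<open>y\<close> have no entry in
    it.\<close>
  moreover have "G = E" using D(2) h * by simp
  ultimately show ?thesis unfolding conf_typ_Res_distinct[OF assms(1)] using f
    by (intro exI[of _ Map.empty] exI[of _ ?G] exI[of _ S] exI[of _ S]) simp
qed

lemma conf_typ_Spawn:
  assumes "hatF F" "conf_typ (fillF F (Spawn (Pr M N))) n G \<phi> U"
  shows "conf_typ (Par (fillF F N) (Thread Child M)) n G \<phi> U"
proof -
  from conf_typ_fillF_cases[OF assms(2)] obtain E D T where D: "trm_typ (Spawn (Pr M N)) n D T" "ctx_split G E D"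
    and r: "\<And>M' D' G'. trm_typ M' n D' T \<Longrightarrow> ctx_split G' E D' \<Longrightarrow> conf_typ (fillF F M') n G' \<phi> U"
    unfolding hatF_bnF[OF assms(1)] hide_empty by (metis agree_empty)
  from D(1) obtain D1 D2 where *: "ctx_split D D1 D2" "trm_typ M n D1 One" "trm_typ N n D2 T" by auto
  from ctx_split_rotate[OF D(2) *(1)] obtain P where P: "ctx_split G D1 P" "ctx_split P E D2" .
  show ?thesis unfolding conf_typ.simps using r[OF *(3) P(2)] P(1) *(2) ctx_split_comm by blast
qed

lemma conf_typ_Recv:
  assumes "x \<noteq> y" "hatF F" and "conf_typ (Res x (ms @ [MTrm M]) y (Par (fillF F (Recv (Var y))) C)) n G \<phi> U"
  shows "conf_typ (Res x ms y (Par (fillF F (Pr M (Var y))) C)) n G \<phi> U"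
proof -
  from assms(3) obtain H1 H2 S' S where G: "G (Name x) = None" "G (Name y) = None"
    and s: "ctx_split (G(Name x := lin (Sess S'), Name y := lin (Sess (dual S)))) H1 H2" (is "ctx_split ?A H1 H2")
    and H: "H1 (Name x) = None" "buf_typ (ms @ [MTrm M]) n H1 S' S" "conf_typ (Par (fillF F (Recv (Var y))) C) n H2 \<phi> U"
    unfolding conf_typ_Res_distinct[OF assms(1)] by blast
  from H(3) obtain P Q \<phi>1 T1 \<phi>2 T2 where j: "join \<phi>1 T1 \<phi>2 T2 \<phi> U" and s2: "ctx_split H2 P Q"
    and P: "conf_typ (fillF F (Recv (Var y))) n P \<phi>1 T1" and Q: "conf_typ C n Q \<phi>2 T2" unfolding conf_typ_Par by blast
  from conf_typ_fillF_cases[OF P] obtain E D T where D: "trm_typ (Recv (Var y)) n D T" "ctx_split P E D"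
    and r: "\<And>M' D' G'. trm_typ M' n D' T \<Longrightarrow> ctx_split G' E D' \<Longrightarrow> conf_typ (fillF F M') n G' \<phi>1 T1"
    unfolding hatF_bnF[OF assms(2)] hide_empty by (metis agree_empty)
  from D(1) obtain T0 S1 where T: "T = Prod T0 (Sess S1)" and Ds: "D = single (Name y) (Sess (In T0 S1))" by auto
  from H(2) obtain D1 K T0' S0 where S: "S = Out T0' S0" and s3: "ctx_split H1 D1 K" "trm_typ M n D1 T0'" "buf_typ ms n K S' S0"
    unfolding buf_typ_snoc_trm by blast
  \<comment> \<open>An input session is not \<open>end\<close>, so \<open>y\<close> has an entry.
    Traced outwards through the splits, it is found to be absent from the buffer and equal to the
    dual of \<open>S\<close>.\<close>
  have y: "D (Name y) = Some (Sess (In T0 S1))" using Ds by simp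
  note y1 = ctx_split_Some[OF D(2) y]
  note y2 = ctx_split_Some_left[OF s2 y1(2)]
  note y3 = ctx_split_Some[OF s y2(2)]
  have dual: "T0 = T0'" "S1 = dual S0" using y3(2) S by auto
  let ?t = "lin (Sess S1)"
  have "ctx_split (?A(Name y := ?t)) H1 (H2(Name y := ?t))" "ctx_split (H2(Name y := ?t)) (P(Name y := ?t)) Q"
    "ctx_split (P(Name y := ?t)) E (single (Name y) (Sess S1))"
    using ctx_split_upd[OF s y3(1)] ctx_split_upd_left[OF s2 y2(1)] ctx_split_upd[OF D(2) y1(1), of ?t] Ds by simp_all
  from ctx_split_move_in[OF this(1) s3(1) this(2,3)] obtain H2' P' D' where *: "ctx_split (?A(Name y := ?t)) K H2'"
    "ctx_split H2' P' Q" "ctx_split P' E D'" "ctx_split D' D1 (single (Name y) (Sess S1))" .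
  have "trm_typ (Pr M (Var y)) n D' T" using T *(4) s3(2) dual by auto
  then have "conf_typ (fillF F (Pr M (Var y))) n P' \<phi>1 T1" using r *(3) by blast
  then have "conf_typ (Par (fillF F (Pr M (Var y))) C) n H2' \<phi> U" unfolding conf_typ_Par using j *(2) Q by blast
  moreover have "K (Name x) = None" using ctx_split_None[OF s3(1)] H(1) by blast
  moreover have "?A(Name y := ?t) = G(Name x := lin (Sess S'), Name y := lin (Sess (dual S0)))"
    using dual by simp
  ultimately show ?thesis unfolding conf_typ_Res_distinct[OF assms(1)] using G *(1) s3(3) by metis
qed

text \<open>A label has no share, so the buffer keeps its context. The selected branch consumes
  \<open>D2\<close>, as every branch does, and only the session of \<open>y\<close> moves
  on.\<close>

lemma conf_typ_Case:
  assumes "x \<noteq> y" "y \<notin> bnF F" "fmlookup Ms j = Some M"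
    and "conf_typ (Res x (ms @ [MLab j]) y (Par (fillF F (Case (Var y) Ms)) C)) n G \<phi> U"
  shows "conf_typ (Res x ms y (Par (fillF F (App M (Var y))) C)) n G \<phi> U"
proof -
  from assms(4) obtain H1 H2 S' S where G: "G (Name x) = None" "G (Name y) = None"
    and s: "ctx_split (G(Name x := lin (Sess S'), Name y := lin (Sess (dual S)))) H1 H2" (is "ctx_split ?A H1 H2")
    and H: "H1 (Name x) = None" "buf_typ (ms @ [MLab j]) n H1 S' S" "conf_typ (Par (fillF F (Case (Var y) Ms)) C) n H2 \<phi> U"
    unfolding conf_typ_Res_distinct[OF assms(1)] by blast
  from H(3) obtain P Q \<phi>1 T1 \<phi>2 T2 where j: "join \<phi>1 T1 \<phi>2 T2 \<phi> U" and s2: "ctx_split H2 P Q"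
    and P: "conf_typ (fillF F (Case (Var y) Ms)) n P \<phi>1 T1" and Q: "conf_typ C n Q \<phi>2 T2" unfolding conf_typ_Par by blast
  from conf_typ_fillF_cases[OF P] obtain E D T where D: "trm_typ (Case (Var y) Ms) n D T" "ctx_split P E (hide (bnF F) D)"
    and r: "\<And>M' D' G'. trm_typ M' n D' T \<Longrightarrow> agree (bnF F) D D' \<Longrightarrow> ctx_split G' E (hide (bnF F) D') \<Longrightarrow>
      conf_typ (fillF F M') n G' \<phi>1 T1" by metis
  from D(1) obtain D2 Ss where s3: "ctx_split D (single (Name y) (Sess (With Ss))) D2"
    and M: "\<And>i N S. fmlookup Ms i = Some N \<Longrightarrow> fmlookup Ss i = Some S \<Longrightarrow> trm_typ N n D2 (Lolli (Sess S) T)"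
    unfolding trm_typ_Case trm_typ.simps by blast
  from H(2) obtain Ss' S0 where S: "S = Plus Ss'" "fmlookup Ss' j = Some S0" "buf_typ ms n H1 S' S0"
    unfolding buf_typ_snoc_lab by blast
  have "single (Name y) (Sess (With Ss)) (Name y) = Some (Sess (With Ss))" by simp
  note y0 = ctx_split_Some_left[OF s3 this]
  have "hide (bnF F) D (Name y) = Some (Sess (With Ss))" using y0(2) assms(2) by simp
  note y1 = ctx_split_Some[OF D(2) this]
  note y2 = ctx_split_Some_left[OF s2 y1(2)]
  note y3 = ctx_split_Some[OF s y2(2)]
  \<comment> \<open>\<open>Ss\<close> is the image of \<open>Ss'\<close> under \<open>dual\<close>,
    so the label in the buffer selects a branch whose session is dual to the sender's
    continuation.\<close>
  have "fmlookup Ss j = Some (dual S0)" using y3(2) S by auto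
  with M assms(3) have M: "trm_typ M n D2 (Lolli (Sess (dual S0)) T)" by blast
  let ?t = "lin (Sess (dual S0))"
  have *: "ctx_split (?A(Name y := ?t)) H1 (H2(Name y := ?t))" "ctx_split (H2(Name y := ?t)) (P(Name y := ?t)) Q"
    "ctx_split (P(Name y := ?t)) E (hide (bnF F) (D(Name y := ?t)))" "agree (bnF F) D (D(Name y := ?t))"
    "ctx_split (D(Name y := ?t)) D2 (single (Name y) (Sess (dual S0)))"
    using ctx_split_upd[OF s y3(1)] ctx_split_upd_left[OF s2 y2(1)] ctx_split_upd[OF D(2) y1(1), of ?t]
      ctx_split_upd_left[OF s3 y0(1), of ?t] hide_upd[OF assms(2)] agree_upd[OF assms(2)]
    by (simp_all add: ctx_split_comm[of "D(Name y := ?t)" D2])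
  have "trm_typ (App M (Var y)) n (D(Name y := ?t)) T" using *(5) M by auto
  then have "conf_typ (fillF F (App M (Var y))) n (P(Name y := ?t)) \<phi>1 T1" using r *(3,4) by blast
  then have "conf_typ (Par (fillF F (App M (Var y))) C) n (H2(Name y := ?t)) \<phi> U" unfolding conf_typ_Par
    using j *(2) Q by blast
  moreover have "?A(Name y := ?t) = G(Name x := lin (Sess S'), Name y := ?t)" by simp
  ultimately show ?thesis unfolding conf_typ_Res_distinct[OF assms(1)] using G *(1) S(3) H(1) by metis
qed

lemma redC_conf_typ: "C \<longrightarrow>\<^sub>C D \<Longrightarrow> conf_typ C n G \<phi> T \<Longrightarrow> conf_typ D n G \<phi> T"
proof (induction arbitrary: n G \<phi> T rule: redC.induct)
  case (redC_New x y F)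
  then show ?case by (rule conf_typ_New)
next
  case (redC_Spawn F M N)
  then show ?case by (rule conf_typ_Spawn)
next
  case (redC_Recv x y F ms M C)
  then show ?case by (rule conf_typ_Recv)
next
  case (redC_Case x y F Ms j M ms C)
  then show ?case by (rule conf_typ_Case)
next
  case (redC_LiftC C C' \<G>)
  from conf_typ_fillG[OF redC_LiftC.prems] obtain E D TT where
    C: "(\<lambda>(\<psi>, T) C D. conf_typ C n D \<psi> T) TT C D" "ctx_split G E (hide (bnG \<G>) D)"
    and r: "\<And>C' D' G'. (\<lambda>(\<psi>, T) C D. conf_typ C n D \<psi> T) TT C' D' \<Longrightarrow> agree (bnG \<G>) D D' \<Longrightarrow>
      ctx_split G' E (hide (bnG \<G>) D') \<Longrightarrow> conf_typ (fillG \<G> C') n G' \<phi> T"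
    unfolding hole_def by blast
  have "(\<lambda>(\<psi>, T) C D. conf_typ C n D \<psi> T) TT C' D" using C(1) redC_LiftC.IH by (cases TT) simp
  then show ?case using r[OF _ agree_refl C(2)] by blast
next
  case (redC_LiftM M M' F)
  from conf_typ_fillF_cases[OF redC_LiftM.prems] obtain E D T' where D: "trm_typ M n D T'" "ctx_split G E (hide (bnF F) D)"
    and r: "\<And>M' D' G'. trm_typ M' n D' T' \<Longrightarrow> agree (bnF F) D D' \<Longrightarrow> ctx_split G' E (hide (bnF F) D') \<Longrightarrow>
      conf_typ (fillF F M') n G' \<phi> T" by metis
  show ?case using r[OF redM_trm_typ[OF redC_LiftM.hyps D(1)] agree_refl D(2)] .
next
  case (redC_LiftSC C C' D' D)
  then show ?case using scC_conf_typ by blast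
qed

section \<open>Equivalence with the original typing judgements\<close>

definition erase :: "env \<Rightarrow> actx" where
  "erase \<Gamma> a = (case a of Name x \<Rightarrow> Option.bind (\<Gamma> x) lin | Idx i \<Rightarrow> None)"

lemma erase_simps [simp]:
  "erase \<Gamma> (Name x) = Option.bind (\<Gamma> x) lin" "erase \<Gamma> (Idx i) = None"
  by (simp_all add: erase_def)

lemma erase_empty [simp]: "erase Map.empty = Map.empty"
proof
  show "erase Map.empty a = None" for a by (cases a) auto
qed

lemma erase_upd [simp]: "erase (\<Gamma>(x \<mapsto> T)) = (erase \<Gamma>)(Name x := lin T)"
proof
  show "erase (\<Gamma>(x \<mapsto> T)) a = ((erase \<Gamma>)(Name x := lin T)) a" for a by (cases a) auto
qed

lemma ctx_split_erase:
  assumes "dom \<Gamma> \<inter> dom \<Delta> = {}"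
  shows "ctx_split (erase (\<Gamma> ++ \<Delta>)) (erase \<Gamma>) (erase \<Delta>)"
  unfolding ctx_split_def
proof
  show "erase \<Gamma> a = None \<and> erase (\<Gamma> ++ \<Delta>) a = erase \<Delta> a \<or>
    erase \<Delta> a = None \<and> erase (\<Gamma> ++ \<Delta>) a = erase \<Gamma> a" for a
  proof (cases a)
    case (Name x)
    then show ?thesis using assms by (cases "\<Gamma> x"; cases "\<Delta> x") (auto simp: map_add_def)
  qed simp
qed

text \<open>(T-EndL) does not change the erased environment, and (T-EndR) is an empty
  \<open>single\<close>. Finiteness is recorded for the converse, which picks fresh names and
  restores \<open>end\<close> entries one at a time.\<close>

lemma typM_imp_trm_typ: "\<Gamma> \<turnstile>\<^sub>M M \<Zspot> T \<Longrightarrow> trm_typ M 0 (erase \<Gamma>) T \<and> finite (dom \<Gamma>)"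
proof (induction rule: typM.induct)
  case (T_Var x T)
  show ?case by (simp add: single_def del: fun_upd_apply)
next
  case (T_Abs x \<Gamma> T M U)
  then show ?case by (auto simp: trm_typ_Lam domIff simp del: fun_upd_apply)
next
  case (T_Split \<Gamma> \<Delta> x y M T T' N U)
  have "erase \<Delta> (Name x) = None" "erase \<Delta> (Name y) = None" using T_Split(3) by (auto simp: domIff)
  then have "trm_typ (LetP x y M N) 0 (erase (\<Gamma> ++ \<Delta>)) U"
    unfolding trm_typ_LetP_distinct[OF T_Split(2)] using ctx_split_erase[OF T_Split(1)] T_Split.IH T_Split(2)
    by (metis erase_upd fun_upd_twist)
  with T_Split.IH show ?case by (simp del: fun_upd_apply)
next
  case (T_EndL x \<Gamma> M T)
  then show ?case by (simp add: domIff fun_upd_idem del: fun_upd_apply)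
next
  case (T_Case \<Gamma> \<Delta> Ss Ns M U)
  \<comment> \<open>Finiteness of \<Delta> is known only through a branch, and there is at least
    one.\<close>
  from T_Case(2,3) obtain i N S where "fmlookup Ns i = Some N" "fmlookup Ss i = Some S"
    by (metis ex_in_conv fmdom'_notI not_Some_eq)
  then have "finite (dom \<Delta>)" using T_Case.IH by blast
  moreover have "trm_typ (Case M Ns) 0 (erase (\<Gamma> ++ \<Delta>)) U"
    unfolding trm_typ_Case using T_Case ctx_split_erase[OF T_Case(1)] by blast
  ultimately show ?case using T_Case.IH by simp
next
  case (T_Sub \<Gamma> \<Delta> x T M U N)
  then have "erase \<Gamma> (Name x) = None" by (simp add: domIff)
  then have "trm_typ (Sub M N x) 0 (erase (\<Gamma> ++ \<Delta>)) U" unfolding trm_typ_Sub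
    using ctx_split_erase[OF T_Sub(1)] T_Sub.IH by (metis erase_upd)
  then show ?case using T_Sub.IH by (simp del: fun_upd_apply)
next
  case (T_App \<Gamma> \<Delta> M T U N)
  then have "trm_typ (App M N) 0 (erase (\<Gamma> ++ \<Delta>)) (U)"
    unfolding trm_typ.simps using ctx_split_erase[OF T_App(1)] by blast
  then show ?case using T_App.IH by simp
next
  case (T_Pair \<Gamma> \<Delta> M T N U)
  then have "trm_typ (Pr M N) 0 (erase (\<Gamma> ++ \<Delta>)) (Prod T U)"
    unfolding trm_typ.simps using ctx_split_erase[OF T_Pair(1)] by blast
  then show ?case using T_Pair.IH by simp
next
  case (T_SendP \<Gamma> \<Delta> M T N S)
  then have "trm_typ (SendP M N) 0 (erase (\<Gamma> ++ \<Delta>)) (Sess S)"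
    unfolding trm_typ.simps using ctx_split_erase[OF T_SendP(1)] by blast
  then show ?case using T_SendP.IH by simp
qed (auto simp: single_def)

lemma typB_imp_buf_typ: "\<Gamma> \<turnstile>\<^sub>B ms \<Zspot> S' \<rhd> S \<Longrightarrow> buf_typ ms 0 (erase \<Gamma>) S' S \<and> finite (dom \<Gamma>)"
proof (induction rule: typB.induct)
  case (T_BufSend \<Gamma> \<Delta> M T ms S' S)
  then show ?case using ctx_split_erase[OF T_BufSend(1)] typM_imp_trm_typ[OF T_BufSend(2)]
    by (auto simp: buf_typ_snoc_trm)
qed (auto simp: buf_typ_snoc_lab)

lemma typC_imp_conf_typ: "\<Gamma> \<turnstile>\<^sub>C[\<phi>] C \<Zspot> T \<Longrightarrow> conf_typ C 0 (erase \<Gamma>) \<phi> T \<and> finite (dom \<Gamma>)"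
proof (induction rule: typC.induct)
  case (T_Main \<Gamma> M T)
  then show ?case using typM_imp_trm_typ by auto
next
  case (T_Child \<Gamma> M)
  then show ?case using typM_imp_trm_typ by auto
next
  case (T_ParL \<Gamma> \<Delta> C \<phi> D T \<psi>)
  moreover have "\<phi> = \<psi>" using T_ParL by (cases \<phi>) auto
  ultimately show ?case using ctx_split_erase[OF T_ParL(1)] by auto
next
  case (T_ParR \<Gamma> \<Delta> \<phi> C T D \<psi>)
  moreover have "\<phi> = \<psi>" using T_ParR by (cases \<phi>) auto
  ultimately show ?case using ctx_split_erase[OF T_ParR(1)] by auto
next
  case (T_Res \<Gamma> \<Delta> x y ms S' S \<phi> C T)
  let ?s = "lin (Sess S')" and ?d = "lin (Sess (dual S))"
  have f: "erase \<Gamma> (Name x) = None" "erase \<Gamma> (Name y) = None" "erase \<Delta> (Name x) = None"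
    "erase \<Delta> (Name y) = None" using T_Res(3) by (auto simp: domIff)
  have s: "ctx_split (erase (\<Gamma> ++ \<Delta>)) (erase \<Gamma>) (erase \<Delta>)" using ctx_split_erase[OF T_Res(1)] .
  have "ctx_split ((erase (\<Gamma> ++ \<Delta>))(Name x := ?s, Name y := ?d)) (erase \<Gamma>) ((erase \<Delta>)(Name x := ?s, Name y := ?d))"
    using ctx_split_upd[OF ctx_split_upd[OF s f(1)] f(2)] .
  then show ?case unfolding conf_typ_Res_distinct[OF T_Res(2)]
    using typB_imp_buf_typ[OF T_Res(4)] T_Res.IH f ctx_split_None[OF s] by (metis erase_upd dom_map_add finite_Un dom_fun_upd finite_insert option.distinct(1))
next
  case (T_ResBuf \<Gamma> \<Delta> x y S ms S' \<phi> C T)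
  let ?s = "lin (Sess S')" and ?d = "lin (Sess (dual S))"
  have f: "erase \<Gamma> (Name x) = None" "erase \<Gamma> (Name y) = None" "erase \<Delta> (Name x) = None"
    "erase \<Delta> (Name y) = None" using T_ResBuf(3) by (auto simp: domIff)
  have s: "ctx_split (erase (\<Gamma> ++ \<Delta>)) (erase \<Gamma>) (erase \<Delta>)" using ctx_split_erase[OF T_ResBuf(1)] .
  have "((erase \<Delta>)(Name x := ?s)) (Name y) = None" using f T_ResBuf(2) by simp
  \<comment> \<open>In (T-ResBuf) the entries of the endpoints go to opposite sides:
    \<open>y\<close> to the buffer and \<open>x\<close> to the configuration.\<close>
  then have "ctx_split ((erase (\<Gamma> ++ \<Delta>))(Name x := ?s, Name y := ?d)) ((erase \<Gamma>)(Name y := ?d)) ((erase \<Delta>)(Name x := ?s))"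
    using ctx_split_upd_left[OF ctx_split_upd[OF s f(1)]] by blast
  moreover have "((erase \<Gamma>)(Name y := ?d)) (Name x) = None" using f T_ResBuf(2) by simp
  ultimately show ?case unfolding conf_typ_Res_distinct[OF T_ResBuf(2)]
    using typB_imp_buf_typ[OF T_ResBuf(4)] T_ResBuf.IH f ctx_split_None[OF s] 
    by (metis erase_upd dom_map_add finite_Un dom_fun_upd finite_insert option.distinct(1))
next
  case (T_ConfSub \<Gamma> \<Delta> x T \<phi> C U M)
  then have "erase \<Gamma> (Name x) = None" by (simp add: domIff)
  then have "conf_typ (CSub C M x) 0 (erase (\<Gamma> ++ \<Delta>)) \<phi> U" unfolding conf_typ_CSub
    using ctx_split_erase[OF T_ConfSub(1)] T_ConfSub.IH typM_imp_trm_typ[OF T_ConfSub(4)] by (metis erase_upd)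
  then show ?case using T_ConfSub.IH typM_imp_trm_typ[OF T_ConfSub(4)] by (simp del: fun_upd_apply)
qed

section \<open>From linear typing back to the typing rules\<close>

text \<open>All erased entries are restored on the right. The final clause states that the left
  environment gets none of them, as it must when it is the share of a buffer.\<close>

lemma ctx_split_erase_obtain:
  assumes "ctx_split (erase \<Gamma>) G1 G2"
  obtains \<Gamma>1 \<Gamma>2 where "\<Gamma> = \<Gamma>1 ++ \<Gamma>2" "dom \<Gamma>1 \<inter> dom \<Gamma>2 = {}" "erase \<Gamma>1 = G1" "erase \<Gamma>2 = G2"
    "\<And>x. \<Gamma>1 x = None \<longleftrightarrow> G1 (Name x) = None"
proof -
  define \<Gamma>1 where "\<Gamma>1 = (\<lambda>x. if G1 (Name x) = None then None else \<Gamma> x)"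
  define \<Gamma>2 where "\<Gamma>2 = (\<lambda>x. if G1 (Name x) = None then \<Gamma> x else None)"
  have s: "G1 (Name x) = None \<and> Option.bind (\<Gamma> x) lin = G2 (Name x) \<or>
    G2 (Name x) = None \<and> Option.bind (\<Gamma> x) lin = G1 (Name x)" for x
    using assms[unfolded ctx_split_def, rule_format, of "Name x"] by simp
  have i: "G1 (Idx i) = None" "G2 (Idx i) = None" for i
    using ctx_split_None[OF assms, of "Idx i"] by simp_all
  have *: "G1 (Name x) \<noteq> None \<Longrightarrow> \<Gamma> x \<noteq> None" for x
    using s[of x] by (cases "\<Gamma> x") auto
  show thesis
  proof (rule that)
    show "\<Gamma> = \<Gamma>1 ++ \<Gamma>2"
    proof
      show "\<Gamma> x = (\<Gamma>1 ++ \<Gamma>2) x" for x by (simp add: \<Gamma>1_def \<Gamma>2_def map_add_def split: option.splits)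
    qed
    show "dom \<Gamma>1 \<inter> dom \<Gamma>2 = {}" by (auto simp: \<Gamma>1_def \<Gamma>2_def split: if_splits)
    show "erase \<Gamma>1 = G1"
    proof
      show "erase \<Gamma>1 a = G1 a" for a
      proof (cases a)
        case (Name x)
        then show ?thesis using s[of x] by (cases "G1 (Name x)") (auto simp: \<Gamma>1_def)
      qed (simp add: i)
    qed
    show "erase \<Gamma>2 = G2"
    proof
      show "erase \<Gamma>2 a = G2 a" for a
      proof (cases a)
        case (Name x)
        then show ?thesis using s[of x] by (cases "G1 (Name x)") (auto simp: \<Gamma>2_def)
      qed (simp add: i)
    qed
    show "\<Gamma>1 x = None \<longleftrightarrow> G1 (Name x) = None" for x using *[of x] by (auto simp: \<Gamma>1_def simp del: not_None_eq)
  qed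
qed

text \<open>Under these hypotheses \<Gamma> exceeds \<Delta> only by \<open>end\<close> entries,
  finitely many, and (T-EndL) adds each of them.\<close>

lemma typM_weaken:
  assumes "\<Delta> \<turnstile>\<^sub>M M \<Zspot> T" "finite (dom \<Gamma>)" "dom \<Delta> \<subseteq> dom \<Gamma>" "erase \<Gamma> = erase \<Delta>"
  shows "\<Gamma> \<turnstile>\<^sub>M M \<Zspot> T"
proof -
  have "finite A \<Longrightarrow> A \<subseteq> dom \<Gamma> - dom \<Delta> \<Longrightarrow> (\<lambda>x. if x \<in> A then Some (Sess End) else \<Delta> x) \<turnstile>\<^sub>M M \<Zspot> T" for A
  proof (induction rule: finite_induct)
    case empty
    then show ?case using assms(1) by simp
  next
    case (insert z A)
    have "(\<lambda>x. if x \<in> insert z A then Some (Sess End) else \<Delta> x) =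
      (\<lambda>x. if x \<in> A then Some (Sess End) else \<Delta> x)(z \<mapsto> Sess End)" by auto
    moreover have "z \<notin> dom (\<lambda>x. if x \<in> A then Some (Sess End) else \<Delta> x)" using insert by auto
    ultimately show ?case using insert T_EndL by auto
  qed
  from this[of "dom \<Gamma> - dom \<Delta>"] have "(\<lambda>x. if x \<in> dom \<Gamma> - dom \<Delta> then Some (Sess End) else \<Delta> x) \<turnstile>\<^sub>M M \<Zspot> T"
    using assms(2) by simp
  moreover have "(\<lambda>x. if x \<in> dom \<Gamma> - dom \<Delta> then Some (Sess End) else \<Delta> x) = \<Gamma>"
  proof
    fix x
    have "Option.bind (\<Gamma> x) lin = Option.bind (\<Delta> x) lin" using fun_cong[OF assms(4), of "Name x"] by simp
    then show "(if x \<in> dom \<Gamma> - dom \<Delta> then Some (Sess End) else \<Delta> x) = \<Gamma> x"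
      using assms(3) by (cases "\<Gamma> x"; cases "\<Delta> x") (auto simp: lin_def split: if_splits)
  qed
  ultimately show ?thesis by simp
qed

text \<open>At \<open>end\<close> the derivation starts with (T-EndR) from nothing, otherwise with
  (T-Var) from one entry. All other entries of \<Gamma> are \<open>end\<close> and enter by
  weakening.\<close>

lemma typM_Var:
  assumes "erase \<Gamma> = single (Name x) T" "finite (dom \<Gamma>)"
  shows "\<Gamma> \<turnstile>\<^sub>M Var x \<Zspot> T"
proof (cases "T = Sess End")
  case True
  have "erase \<Gamma> = erase Map.empty" using assms(1) True by (simp add: single_def)
  with True show ?thesis using typM_weaken[OF T_EndR assms(2)] by simp
next
  case False
  have "erase \<Gamma> = erase [x \<mapsto> T]" using assms(1) by (simp add: single_def)
  moreover have "x \<in> dom \<Gamma>" using False fun_cong[OF assms(1), of "Name x"] by (cases "\<Gamma> x") auto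
  ultimately show ?thesis using typM_weaken[OF T_Var assms(2)] by simp
qed

lemma finite_fn: "finite (fn M)"
proof (induction M)
  case (Case M Ns)
  have "finite (fmran' (fmmap fn Ns))"
    unfolding fmran'_alt_def by (rule finite_fset)
  then show ?case using Case by (auto simp: fmap.set_map)
qed auto

lemma finite_fnC: "finite (fnC C)"
proof (induction C)
  case (ResB ms C)
  have "finite (fnMsg m)" for m by (cases m) (auto simp: finite_fn)
  with ResB show ?case by (auto simp: fnMsgs_def)
qed (auto simp: finite_fn)

text \<open>Structural induction fails on \<open>M\<close> alone: below a binder the rules type the
  body opened with a fresh name, which is not a subterm. It is a renaming of a subterm, so the
  statement ranges over all renamings \<open>f\<close>.\<close>

lemma ren_trm_typ_imp_typM:
  "finite (dom \<Gamma>) \<Longrightarrow> trm_typ (ren M f) 0 (erase \<Gamma>) T \<Longrightarrow> \<Gamma> \<turnstile>\<^sub>M ren M f \<Zspot> T"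
proof (induction M arbitrary: f \<Gamma> T)
  case (Var x)
  then show ?case using typM_Var by (auto simp: atom_trm_def split: atom.splits)
next
  case (Bnd i)
  then show ?case using typM_Var by (auto simp: atom_trm_def split: atom.splits)
next
  case Unt
  then show ?case using typM_weaken[OF T_Unit] by simp
next
  case New
  then show ?case using typM_weaken[OF T_New] by auto
next
  case (LamB M)
  let ?M = "ren M (lift f)"
  obtain x where x: "x \<notin> fn ?M \<union> dom \<Gamma>"
    using ex_new_if_finite[OF infinite_UNIV_nat, of "fn ?M \<union> dom \<Gamma>"] finite_fn LamB.prems(1) by auto
  let ?N = "ren M (openA 0 x \<circ> lift f)"
  have e: "LamB ?M = Lam x ?N" unfolding Lam_def using close_open[of x ?M 0] x by (simp add: ren_ren)
  from LamB.prems(2) obtain T1 T2 where T: "T = Lolli T1 T2" "trm_typ ?N 0 ((erase \<Gamma>)(Name x := lin T1)) T2"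
    unfolding ren.simps e trm_typ_Lam by blast
  have fin: "finite (dom (\<Gamma>(x \<mapsto> T1)))" using LamB.prems(1) by simp
  have "\<Gamma>(x \<mapsto> T1) \<turnstile>\<^sub>M ?N \<Zspot> T2" using LamB.IH[OF fin T(2)[folded erase_upd]] .
  then show ?case unfolding ren.simps e T(1) using x by (intro T_Abs) auto
next
  case (App M N)
  from App.prems(2) obtain G1 G2 U where *: "ctx_split (erase \<Gamma>) G1 G2" "trm_typ (ren M f) 0 G1 (Lolli U T)"
    "trm_typ (ren N f) 0 G2 U" by auto
  from ctx_split_erase_obtain[OF *(1)] obtain \<Gamma>1 \<Gamma>2 where 
    **: "\<Gamma> = \<Gamma>1 ++ \<Gamma>2" "dom \<Gamma>1 \<inter> dom \<Gamma>2 = {}" "erase \<Gamma>1 = G1" "erase \<Gamma>2 = G2" by metis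
  have fin: "finite (dom \<Gamma>1)" "finite (dom \<Gamma>2)" using App.prems(1) **(1) by auto
  show ?case unfolding ren.simps **(1)
    by (rule T_App[OF **(2) App.IH(1)[OF fin(1) *(2)[folded **(3)]] App.IH(2)[OF fin(2) *(3)[folded **(4)]]])
next
  case (Pr M N)
  from Pr.prems(2) obtain G1 G2 U V where *: "ctx_split (erase \<Gamma>) G1 G2" "trm_typ (ren M f) 0 G1 U"
    "trm_typ (ren N f) 0 G2 V" and T: "T = Prod U V" by auto
  from ctx_split_erase_obtain[OF *(1)] obtain \<Gamma>1 \<Gamma>2 where 
    **: "\<Gamma> = \<Gamma>1 ++ \<Gamma>2" "dom \<Gamma>1 \<inter> dom \<Gamma>2 = {}" "erase \<Gamma>1 = G1" "erase \<Gamma>2 = G2" by metis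
  have fin: "finite (dom \<Gamma>1)" "finite (dom \<Gamma>2)" using Pr.prems(1) **(1) by auto
  show ?case unfolding ren.simps **(1) T
    by (rule T_Pair[OF **(2) Pr.IH(1)[OF fin(1) *(2)[folded **(3)]] Pr.IH(2)[OF fin(2) *(3)[folded **(4)]]])
next
  case (LetB M N)
  let ?N = "ren N (lift (lift f))"
  \<comment> \<open>Index 0 is the second component. It is opened first, reversing the order in
    which \<open>LetP\<close> closes its names.\<close>
  obtain y where y: "y \<notin> fn ?N \<union> dom \<Gamma>"
    using ex_new_if_finite[OF infinite_UNIV_nat, of "fn ?N \<union> dom \<Gamma>"] finite_fn LetB.prems(1) by auto
  let ?N1 = "ren ?N (openA 0 y)"
  obtain x where x: "x \<notin> fn ?N1 \<union> dom \<Gamma> \<union> {y}"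
    using ex_new_if_finite[OF infinite_UNIV_nat, of "fn ?N1 \<union> dom \<Gamma> \<union> {y}"] finite_fn LetB.prems(1) by auto
  let ?N2 = "ren N (openA 0 x \<circ> (openA 0 y \<circ> lift (lift f)))"
  have "close (close ?N2 0 x) 0 y = ?N"
    using close_open[of y ?N 0] close_open[of x ?N1 0] x y by (simp add: ren_ren)
  then have e: "LetB (ren M f) ?N = LetP x y (ren M f) ?N2" unfolding LetP_def by simp
  have xy: "x \<noteq> y" using x by simp
  from LetB.prems(2) obtain G1 G2 U V where *: "ctx_split (erase \<Gamma>) G1 G2" "trm_typ (ren M f) 0 G1 (Prod U V)"
    "trm_typ ?N2 0 (G2(Name y := lin V, Name x := lin U)) T"
    unfolding ren.simps e trm_typ_LetP_distinct[OF xy] by blast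
  from ctx_split_erase_obtain[OF *(1)] obtain \<Gamma>1 \<Gamma>2 where 
    **: "\<Gamma> = \<Gamma>1 ++ \<Gamma>2" "dom \<Gamma>1 \<inter> dom \<Gamma>2 = {}" "erase \<Gamma>1 = G1" "erase \<Gamma>2 = G2" by metis
  have fin: "finite (dom \<Gamma>1)" "finite (dom \<Gamma>2)" using LetB.prems(1) **(1) by auto
  have "trm_typ ?N2 0 (erase (\<Gamma>2(x \<mapsto> U, y \<mapsto> V))) T"
    using *(3) **(4) xy by (metis erase_upd fun_upd_twist atom.inject(1))
  moreover have "finite (dom (\<Gamma>2(x \<mapsto> U, y \<mapsto> V)))" using fin by simp
  ultimately have "\<Gamma>2(x \<mapsto> U, y \<mapsto> V) \<turnstile>\<^sub>M ?N2 \<Zspot> T" by (intro LetB.IH)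
  moreover have "\<Gamma>1 \<turnstile>\<^sub>M ren M f \<Zspot> Prod U V" using *(2) **(3) fin by (intro LetB.IH) simp_all
  moreover have "{x, y} \<inter> dom \<Gamma>2 = {}" using x y **(1) by auto
  ultimately show ?case unfolding ren.simps e **(1) using xy **(2) by (intro T_Split) auto
next
  case (Case M Ns)
  from Case.prems(2) obtain G1 G2 Ss where *: "ctx_split (erase \<Gamma>) G1 G2" "fmdom' Ss \<noteq> {}"
    "fmdom' (fmmap (\<lambda>N. ren N f) Ns) = fmdom' Ss"
    "trm_typ (ren M f) 0 G1 (Sess (With Ss))"
    "\<forall>i N S. fmlookup (fmmap (\<lambda>N. ren N f) Ns) i = Some N \<longrightarrow> fmlookup Ss i = Some S \<longrightarrow> trm_typ N 0 G2 (Lolli (Sess S) T)"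
    unfolding ren.simps trm_typ_Case by blast
  from ctx_split_erase_obtain[OF *(1)] obtain \<Gamma>1 \<Gamma>2 where 
    **: "\<Gamma> = \<Gamma>1 ++ \<Gamma>2" "dom \<Gamma>1 \<inter> dom \<Gamma>2 = {}" "erase \<Gamma>1 = G1" "erase \<Gamma>2 = G2" by metis
  have fin: "finite (dom \<Gamma>1)" "finite (dom \<Gamma>2)" using Case.prems(1) **(1) by auto
  have "\<Gamma>1 \<turnstile>\<^sub>M ren M f \<Zspot> Sess (With Ss)" using *(4) **(3) fin by (intro Case.IH) simp_all
  moreover have "\<Gamma>2 \<turnstile>\<^sub>M N \<Zspot> Lolli (Sess S) T"
    if N: "fmlookup (fmmap (\<lambda>N. ren N f) Ns) i = Some N" and S: "fmlookup Ss i = Some S" for i N S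
  proof -
    from N obtain N' where N': "fmlookup Ns i = Some N'" "N = ren N' f" by auto
    have "trm_typ (ren N' f) 0 (erase \<Gamma>2) (Lolli (Sess S) T)" using *(5) N S N'(2) **(4) by blast
    from Case.IH(2)[OF fmran'I[OF N'(1)] fin(2) this] show ?thesis using N'(2) by simp
  qed
  ultimately show ?case unfolding ren.simps **(1) using *(2,3) **(2) by (intro T_Case) blast+
next
  case (SubB M N)
  let ?M = "ren M (lift f)"
  obtain x where x: "x \<notin> fn ?M \<union> dom \<Gamma>"
    using ex_new_if_finite[OF infinite_UNIV_nat, of "fn ?M \<union> dom \<Gamma>"] finite_fn SubB.prems(1) by auto
  let ?M1 = "ren M (openA 0 x \<circ> lift f)"
  have e: "SubB ?M (ren N f) = Sub ?M1 (ren N f) x"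
    unfolding Sub_def using close_open[of x ?M 0] x by (simp add: ren_ren)
  from SubB.prems(2) obtain G1 G2 U where *: "ctx_split (erase \<Gamma>) G1 G2" "trm_typ ?M1 0 (G1(Name x := lin U)) T"
    "trm_typ (ren N f) 0 G2 U" unfolding ren.simps e trm_typ_Sub by blast
  from ctx_split_erase_obtain[OF *(1)] obtain \<Gamma>1 \<Gamma>2 where 
    **: "\<Gamma> = \<Gamma>1 ++ \<Gamma>2" "dom \<Gamma>1 \<inter> dom \<Gamma>2 = {}" "erase \<Gamma>1 = G1" "erase \<Gamma>2 = G2" by metis
  have fin: "finite (dom \<Gamma>1)" "finite (dom \<Gamma>2)" using SubB.prems(1) **(1) by auto
  have fin': "finite (dom (\<Gamma>1(x \<mapsto> U)))" using fin by simp
  have "\<Gamma>1(x \<mapsto> U) \<turnstile>\<^sub>M ?M1 \<Zspot> T" using SubB.IH(1)[OF fin' *(2)[folded **(3), folded erase_upd]] .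
  moreover have "\<Gamma>2 \<turnstile>\<^sub>M ren N f \<Zspot> U" using *(3) **(4) fin by (intro SubB.IH) simp_all
  moreover have "x \<notin> dom \<Gamma>1" using x **(1) by auto
  ultimately show ?case unfolding ren.simps e **(1) using **(2) by (intro T_Sub)
next
  case (SendP M N)
  from SendP.prems(2) obtain G1 G2 U V where *: "ctx_split (erase \<Gamma>) G1 G2" "trm_typ (ren M f) 0 G1 U"
    "trm_typ (ren N f) 0 G2 (Sess (Out U V))" and T: "T = Sess V" by auto
  from ctx_split_erase_obtain[OF *(1)] obtain \<Gamma>1 \<Gamma>2 where 
    **: "\<Gamma> = \<Gamma>1 ++ \<Gamma>2" "dom \<Gamma>1 \<inter> dom \<Gamma>2 = {}" "erase \<Gamma>1 = G1" "erase \<Gamma>2 = G2" by metis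
  have fin: "finite (dom \<Gamma>1)" "finite (dom \<Gamma>2)" using SendP.prems(1) **(1) by auto
  show ?case unfolding ren.simps **(1) T
    by (rule T_SendP[OF **(2) SendP.IH(1)[OF fin(1) *(2)[folded **(3)]] SendP.IH(2)[OF fin(2) *(3)[folded **(4)]]])
next
  case (Spawn M)
  then show ?case by (auto intro: typM.T_Spawn)
next
  case (Send M)
  then show ?case by (auto intro: typM.T_Send)
next
  case (Recv M)
  then show ?case by (auto intro: typM.T_Recv)
next
  case (Select l M)
  then show ?case by (auto intro: typM.T_Select)
qed

lemma trm_typ_imp_typM: "finite (dom \<Gamma>) \<Longrightarrow> trm_typ M 0 (erase \<Gamma>) T \<Longrightarrow> \<Gamma> \<turnstile>\<^sub>M M \<Zspot> T"
  using ren_trm_typ_imp_typM[of \<Gamma> M "\<lambda>a. a" T] by simp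

text \<open>No buffer rule discards \<open>end\<close>, and (T-Buf) demands the empty environment;
  hence the assumption that \<Gamma> has no such entry. The induction starts from the end of the
  list, as the rules do.\<close>

lemma buf_typ_imp_typB:
  "finite (dom \<Gamma>) \<Longrightarrow> (\<And>x. \<Gamma> x \<noteq> Some (Sess End)) \<Longrightarrow> buf_typ ms 0 (erase \<Gamma>) S' S \<Longrightarrow> \<Gamma> \<turnstile>\<^sub>B ms \<Zspot> S' \<rhd> S"
proof (induction ms arbitrary: \<Gamma> S rule: rev_induct)
  case Nil
  have e: "erase \<Gamma> = Map.empty" using Nil(3) by simp
  have "\<Gamma> x = None" for x
    using Nil(2)[of x] fun_cong[OF e, of "Name x"] by (cases "\<Gamma> x") auto
  then have "\<Gamma> = Map.empty" by blast
  then show ?case using Nil(3) T_Buf by auto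
next
  case (snoc m ms)
  show ?case
  proof (cases m)
    case (MTrm M)
    from snoc.prems(3) obtain G1 G2 T S0 where *: "S = Out T S0" "ctx_split (erase \<Gamma>) G1 G2" "trm_typ M 0 G1 T"
      "buf_typ ms 0 G2 S' S0" unfolding MTrm buf_typ_snoc_trm by blast
    from ctx_split_erase_obtain[OF *(2)] obtain \<Gamma>1 \<Gamma>2 where 
      **: "\<Gamma> = \<Gamma>1 ++ \<Gamma>2" "dom \<Gamma>1 \<inter> dom \<Gamma>2 = {}" "erase \<Gamma>1 = G1" "erase \<Gamma>2 = G2" by metis
    have fin: "finite (dom \<Gamma>1)" "finite (dom \<Gamma>2)" using snoc.prems(1) **(1) by auto
    have "\<Gamma>2 x \<noteq> Some (Sess End)" for x
      using snoc.prems(2)[of x] unfolding **(1) by (auto simp: map_add_Some_iff)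
    then have "\<Gamma>2 \<turnstile>\<^sub>B ms \<Zspot> S' \<rhd> S0" using *(4) **(4) fin by (intro snoc.IH) simp_all
    then show ?thesis unfolding MTrm *(1) **(1)
      using trm_typ_imp_typM[OF fin(1)] *(3) **(3) by (intro T_BufSend[OF **(2)]) auto
  next
    case (MLab l)
    with snoc show ?thesis by (auto simp: buf_typ_snoc_lab intro!: T_BufSelect)
  qed
qed

lemma renC_conf_typ_imp_typC:
  "finite (dom \<Gamma>) \<Longrightarrow> conf_typ (renC C f) 0 (erase \<Gamma>) \<phi> T \<Longrightarrow> \<Gamma> \<turnstile>\<^sub>C[\<phi>] renC C f \<Zspot> T"
proof (induction C arbitrary: f \<Gamma> \<phi> T)
  case (Thread \<psi> M)
  then show ?case using trm_typ_imp_typM[of \<Gamma> "ren M f" T] by (cases \<psi>) (auto intro: typC.intros)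
next
  case (Par C D)
  from Par.prems(2) obtain G1 G2 \<phi>1 T1 \<phi>2 T2 where j: "join \<phi>1 T1 \<phi>2 T2 \<phi> T" and s: "ctx_split (erase \<Gamma>) G1 G2"
    and *: "conf_typ (renC C f) 0 G1 \<phi>1 T1" "conf_typ (renC D f) 0 G2 \<phi>2 T2" unfolding renC.simps conf_typ_Par by blast
  from ctx_split_erase_obtain[OF s] obtain \<Gamma>1 \<Gamma>2 where 
    **: "\<Gamma> = \<Gamma>1 ++ \<Gamma>2" "dom \<Gamma>1 \<inter> dom \<Gamma>2 = {}" "erase \<Gamma>1 = G1" "erase \<Gamma>2 = G2" by metis
  have fin: "finite (dom \<Gamma>1)" "finite (dom \<Gamma>2)" using Par.prems(1) **(1) by auto
  have CD: "\<Gamma>1 \<turnstile>\<^sub>C[\<phi>1] renC C f \<Zspot> T1" "\<Gamma>2 \<turnstile>\<^sub>C[\<phi>2] renC D f \<Zspot> T2"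
    using * **(3,4) fin by (auto intro!: Par.IH)
  have "marker_add Child \<phi> = Some \<phi>" "marker_add \<phi> Child = Some \<phi>" by (cases \<phi>; simp)+
  then show ?case unfolding renC.simps **(1) using j CD T_ParL[OF **(2)] T_ParR[OF **(2)]
    unfolding join_def by blast
next
  case (ResB ms C)
  let ?C = "renC C (lift (lift f))" and ?ms = "map (\<lambda>m. renMsg m (lift (lift f))) ms"
  have fm: "finite (fnMsgs ms)" for ms using finite_fnC[of "ResB ms (Thread Main Unt)"] by simp
  obtain y where y: "y \<notin> fnC ?C \<union> fnMsgs ?ms \<union> dom \<Gamma>"
    using ex_new_if_finite[OF infinite_UNIV_nat, of "fnC ?C \<union> fnMsgs ?ms \<union> dom \<Gamma>"] finite_fnC fm ResB.prems(1) by auto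
  let ?C1 = "renC ?C (openA 0 y)" and ?ms1 = "map (\<lambda>m. renMsg m (openA 0 y)) ?ms"
  obtain x where x: "x \<notin> fnC ?C1 \<union> fnMsgs ?ms1 \<union> dom \<Gamma> \<union> {y}"
    using ex_new_if_finite[OF infinite_UNIV_nat, of "fnC ?C1 \<union> fnMsgs ?ms1 \<union> dom \<Gamma> \<union> {y}"] finite_fnC fm ResB.prems(1) by auto
  let ?C2 = "renC C (openA 0 x \<circ> (openA 0 y \<circ> lift (lift f)))" and ?ms2 = "map (\<lambda>m. renMsg m (openA 0 x)) ?ms1"
  have "closeC (closeC ?C2 0 x) 0 y = ?C"
    using closeC_open[of y ?C 0] closeC_open[of x ?C1 0] x y by (simp add: renC_renC)
  moreover have "map (\<lambda>m. closeMsg m 0 x) ?ms2 = ?ms1"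
    using x closeMsg_open[of x _ 0] by (auto simp: fnMsgs_def)
  moreover have "map (\<lambda>m. closeMsg m 0 y) ?ms1 = ?ms"
    using y closeMsg_open[of y _ 0] by (auto simp: fnMsgs_def)
  ultimately have e: "ResB ?ms ?C = Res x ?ms2 y ?C2"
    unfolding Res_def by (metis (no_types, lifting) map_map comp_def map_eq_conv)
  have xy: "x \<noteq> y" and dx: "x \<notin> dom \<Gamma>" "y \<notin> dom \<Gamma>" using x y by auto
  from ResB.prems(2) obtain H1 H2 S' S where
    s: "ctx_split ((erase \<Gamma>)(Name x := lin (Sess S'), Name y := lin (Sess (dual S)))) H1 H2"
    and H: "H1 (Name x) = None" "buf_typ ?ms2 0 H1 S' S" "conf_typ ?C2 0 H2 \<phi> T"
    unfolding renC.simps e conf_typ_Res_distinct[OF xy] by blast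
  let ?\<Gamma> = "\<Gamma>(x \<mapsto> Sess S', y \<mapsto> Sess (dual S))"
  from s have "ctx_split (erase ?\<Gamma>) H1 H2" by simp
  from ctx_split_erase_obtain[OF this] obtain \<Gamma>1 \<Gamma>2 where 
    **: "?\<Gamma> = \<Gamma>1 ++ \<Gamma>2" "dom \<Gamma>1 \<inter> dom \<Gamma>2 = {}" "erase \<Gamma>1 = H1" "erase \<Gamma>2 = H2"
    and n: "\<And>z. \<Gamma>1 z = None \<longleftrightarrow> H1 (Name z) = None" by metis
  have at: "(\<Gamma>1 z = None \<and> \<Gamma>2 z = ?\<Gamma> z) \<or> (\<Gamma>2 z = None \<and> \<Gamma>1 z = ?\<Gamma> z)" for z
    using fun_cong[OF **(1), of z] **(2) by (cases "\<Gamma>1 z"; cases "\<Gamma>2 z") (auto simp: map_add_def)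
  have "finite (dom ?\<Gamma>)" using ResB.prems(1) by simp
  then have fin: "finite (dom \<Gamma>1)" "finite (dom \<Gamma>2)" unfolding **(1) by auto
  \<comment> \<open>\<Gamma>1 has exactly the entries of the buffer's linear context, which never
    records \<open>end\<close>.\<close>
  have "\<Gamma>1 z \<noteq> Some (Sess End)" for z
    using n[of z] fun_cong[OF **(3), of "Name z"] by (cases "\<Gamma>1 z") auto
  with fin(1) H(2) **(3) have B: "\<Gamma>1 \<turnstile>\<^sub>B ?ms2 \<Zspot> S' \<rhd> S" by (intro buf_typ_imp_typB) auto
  have CC: "\<Gamma>2 \<turnstile>\<^sub>C[\<phi>] ?C2 \<Zspot> T" using ResB.IH[OF fin(2) H(3)[folded **(4)]] .
  have x1: "\<Gamma>1 x = None" "\<Gamma>2 x = Some (Sess S')" using n[of x] H(1) at[of x] xy by auto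
  show ?case
  \<comment> \<open>Whether the buffer consumes \<open>y\<close> decides between (T-Res) and
    (T-ResBuf). An endpoint \<open>y\<close> at \<open>end\<close> is left to the
    configuration.\<close>
  proof (cases "\<Gamma>1 y")
    case None
    let ?\<Delta> = "\<Gamma>2(x := None, y := None)"
    have y2: "\<Gamma>2 y = Some (Sess (dual S))" using at[of y] None by auto
    have "\<Gamma> z = (\<Gamma>1 ++ ?\<Delta>) z" for z
      using at[of z] x1 None dx by (auto simp: map_add_def domIff split: option.splits if_splits)
    then have \<Gamma>: "\<Gamma> = \<Gamma>1 ++ ?\<Delta>" by blast
    have "?\<Delta>(x \<mapsto> Sess S', y \<mapsto> Sess (dual S)) = \<Gamma>2" using x1 y2 by auto
    with CC have "?\<Delta>(x \<mapsto> Sess S', y \<mapsto> Sess (dual S)) \<turnstile>\<^sub>C[\<phi>] ?C2 \<Zspot> T" by (simp only:)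
    moreover have "dom \<Gamma>1 \<inter> dom ?\<Delta> = {}" "{x, y} \<inter> (dom \<Gamma>1 \<union> dom ?\<Delta>) = {}"
      using **(2) x1 None by auto
    ultimately have "\<Gamma>1 ++ ?\<Delta> \<turnstile>\<^sub>C[\<phi>] Res x ?ms2 y ?C2 \<Zspot> T"
      by (intro T_Res[OF _ xy _ B])
    then show ?thesis unfolding renC.simps e \<Gamma>[symmetric] .
  next
    case (Some U)
    let ?\<Delta>1 = "\<Gamma>1(y := None)" and ?\<Delta>2 = "\<Gamma>2(x := None)"
    have y2: "\<Gamma>1 y = Some (Sess (dual S))" "\<Gamma>2 y = None" using at[of y] Some by auto
    have "\<Gamma> z = (?\<Delta>1 ++ ?\<Delta>2) z" for z
      using at[of z] x1 y2 dx by (auto simp: map_add_def domIff split: option.splits if_splits)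
    then have \<Gamma>: "\<Gamma> = ?\<Delta>1 ++ ?\<Delta>2" by blast
    have "?\<Delta>1(y \<mapsto> Sess (dual S)) = \<Gamma>1" "?\<Delta>2(x \<mapsto> Sess S') = \<Gamma>2" using x1 y2 by auto
    with B CC have "?\<Delta>1(y \<mapsto> Sess (dual S)) \<turnstile>\<^sub>B ?ms2 \<Zspot> S' \<rhd> S"
      "?\<Delta>2(x \<mapsto> Sess S') \<turnstile>\<^sub>C[\<phi>] ?C2 \<Zspot> T" by (simp_all only:)
    moreover have "dom ?\<Delta>1 \<inter> dom ?\<Delta>2 = {}" "{x, y} \<inter> (dom ?\<Delta>1 \<union> dom ?\<Delta>2) = {}"
      using **(2) x1 y2 by auto
    ultimately have "?\<Delta>1 ++ ?\<Delta>2 \<turnstile>\<^sub>C[\<phi>] Res x ?ms2 y ?C2 \<Zspot> T"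
      using xy by (intro T_ResBuf)
    then show ?thesis unfolding renC.simps e \<Gamma>[symmetric] .
  qed
next
  case (CSubB C M)
  let ?C = "renC C (lift f)"
  obtain x where x: "x \<notin> fnC ?C \<union> dom \<Gamma>"
    using ex_new_if_finite[OF infinite_UNIV_nat, of "fnC ?C \<union> dom \<Gamma>"] finite_fnC CSubB.prems(1) by auto
  let ?C1 = "renC C (openA 0 x \<circ> lift f)"
  have e: "CSubB ?C (ren M f) = CSub ?C1 (ren M f) x"
    unfolding CSub_def using closeC_open[of x ?C 0] x by (simp add: renC_renC)
  from CSubB.prems(2) obtain G1 G2 U where *: "ctx_split (erase \<Gamma>) G1 G2" "conf_typ ?C1 0 (G1(Name x := lin U)) \<phi> T"
    "trm_typ (ren M f) 0 G2 U" unfolding renC.simps e conf_typ_CSub by blast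
  from ctx_split_erase_obtain[OF *(1)] obtain \<Gamma>1 \<Gamma>2 where 
    **: "\<Gamma> = \<Gamma>1 ++ \<Gamma>2" "dom \<Gamma>1 \<inter> dom \<Gamma>2 = {}" "erase \<Gamma>1 = G1" "erase \<Gamma>2 = G2" by metis
  have fin: "finite (dom \<Gamma>1)" "finite (dom \<Gamma>2)" using CSubB.prems(1) **(1) by auto
  have fin': "finite (dom (\<Gamma>1(x \<mapsto> U)))" using fin by simp
  have "\<Gamma>1(x \<mapsto> U) \<turnstile>\<^sub>C[\<phi>] ?C1 \<Zspot> T" using CSubB.IH[OF fin' *(2)[folded **(3), folded erase_upd]] .
  moreover have "\<Gamma>2 \<turnstile>\<^sub>M ren M f \<Zspot> U" using *(3) **(4) fin trm_typ_imp_typM by simp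
  moreover have "x \<notin> dom \<Gamma>1" using x **(1) by auto
  ultimately show ?case unfolding renC.simps e **(1) using **(2) by (intro T_ConfSub)
qed

lemma typC_iff_conf_typ: "\<Gamma> \<turnstile>\<^sub>C[\<phi>] C \<Zspot> T \<longleftrightarrow> conf_typ C 0 (erase \<Gamma>) \<phi> T \<and> finite (dom \<Gamma>)"
  using typC_imp_conf_typ renC_conf_typ_imp_typC[of \<Gamma> C "\<lambda>a. a"] by auto

theorem theorem2p6:
  fixes C D :: conf and \<Gamma> :: env and \<phi> :: marker and T :: ty
  assumes "\<Gamma> \<turnstile>\<^sub>C[\<phi>] C \<Zspot> T"
    and "C \<equiv>\<^sub>C D \<or> C \<longrightarrow>\<^sub>C D"
  shows "\<Gamma> \<turnstile>\<^sub>C[\<phi>] D \<Zspot> T"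
  using assms scC_conf_typ redC_conf_typ unfolding typC_iff_conf_typ by blast

end
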